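(* Assume $A=\mathbb{F}_q[\theta]$ and let $\phi:\mathbb{F}_q[\theta]\to\mathbb{C}_\infty[\tau]$ be a Drinfeld module of rank $r$. The following identities hold in $\mathbb{C}_\infty\overline\otimes\Omega$: $$\zeta_\phi\cdot\omega_\phi=\frac{d\theta}{\theta\otimes1-1\otimes\theta},\qquad \zeta_\phi\cdot\omega_\phi^{(k)}=0\ \text{ if }1\le k\le r-1 .$$
   Context: $X=\mathbb{P}^1_{\mathbb{F}_q}$, $\theta$ is a rational function on $X$ with a simple pole at $\infty$, $A=\mathbb{F}_q[\theta]$, $K_\infty=\mathbb{F}_q(\!(\theta^{-1})\!)$, $\mathbb{C}_\infty$ is the completion of an algebraic closure of $K_\infty$, and $\Omega=A\,d\theta$. Tensor products without subscript are over $\mathbb{F}_q$. For a discrete $\mathbb{F}_q$-vector space $M$ with basis $(m_i)_i$, $\mathbb{C}_\infty\overline\otimes M$ is the completion of $\mathbb{C}_\infty\otimes M$ for the sup norm; its elements are uniquely $\sum_ic_i\otimes m_i$ with $c_i\to0$, and $x^{(k)}=\sum_ic_i^{q^k}\otimes m_i$ for $x=\sum_i c_i\otimes m_i$, $k\in\mathbb{Z}$. $\mathbb{C}_\infty\overline\otimes\Omega$ is a module over the ring $\mathbb{C}_\infty\overline\otimes A$, in which $\theta\otimes1-1\otimes\theta$ is invertible; $d\theta$ stands for $1\otimes d\theta$. A Drinfeld module is an $\mathbb{F}_q$-algebra homomorphism $\phi:A\to\mathbb{C}_\infty[\tau]$ ($\tau c=c^q\tau$) with constant term of $\phi_a$ equal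 to $a$ and $\phi_a\neq a$ for some $a$. Its exponential $\exp_\phi\in\mathbb{C}_\infty[\![\tau]\!]$ is the unique series with leading term $1$ with $\exp_\phi a=\phi_a\exp_\phi$ for all $a\in A$; it is entire, $\Lambda_\phi=\ker(\exp_\phi)\subseteq\mathbb{C}_\infty$ is a discrete free $A$-module, and its rank is the rank $r\ge1$ of $\phi$. The pairing between $\Omega$ and $K_\infty/A$ is normalized so that $\langle d\theta,\theta^n\rangle=\delta_{-1,n}$ for all $n\in\mathbb{Z}$ (and $\langle a\,d\theta,b\rangle=\langle d\theta,ab\rangle$); it induces a perfect pairing between $\mathrm{Hom}_A(\Lambda_\phi,\Omega)$ and $K_\infty\Lambda_\phi/\Lambda_\phi\cong\Lambda_\phi\otimes_AK_\infty/A$, $\langle\mu,b\lambda\rangle=\langle\mu(\lambda),b\rangle$. $\zeta_\phi:=-\sum_{\lambda\in\Lambda_\phi\setminus\{0\}}\lambda^{-1}\otimes\lambda\in\mathbb{C}_\infty\overline\otimes\Lambda_\phi$. $\omega_\phi:=\sum_i\exp_\phi(\mu_i^* )\otimes\mu_i\in\mathbb{C}_\infty\overline\otimes\mathrm{Hom}_A(\Lambda_\phi,\Omega)$, where $(\mu_i)_i$ is any $\mathbb{F}_q$-basis of $\mathrm{Hom}_A(\Lambda_\phi,\Omega)$ with dual basis $(\mu_i^* )_i$ in $K_\infty\Lambda_\phi/\Lambda_\phi$. The dot product is $\left(\sum_ic_i\otimes\lambda_i\right)\cdot\left(\sum_jd_j\otimes\mu_j\right)=\sum_{i,j}c_id_j\otimes\mu_j(\lambda_i)\in\mathbb{C}_\infty\overline\otimes\Omega$.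 *)

theory Defs
  imports
    "HOL-Analysis.Analysis"
    "HOL-Computational_Algebra.Formal_Laurent_Series"
    "HOL-Computational_Algebra.Polynomial_FPS"
    "HOL-Algebra.Algebraic_Closure_Type"
    "HOL-Library.Function_Algebras"
begin

section \<open>The field of Laurent series in the inverse of \<theta> and its completed algebraic closure\<close>

text \<open>
  The finite field is a type \<^typ>\<open>'a :: {finite, field}\<close>, so q is \<^term>\<open>CARD('a)\<close>.
  The ring A of polynomials in \<theta> is \<^typ>\<open>'a poly\<close>. The field \<^typ>\<open>'a fls\<close> of formal Laurent
  series in X is used with X the inverse of \<theta>: thus \<theta> is \<^term>\<open>fls_X_inv\<close>, and the coefficient
  of the n-th power of \<theta> in b is \<^term>\<open>fls_nth b (- n)\<close>.
\<close>

definition A_to_K :: "'a::{finite, field} poly \<Rightarrow> 'a fls" where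
  "A_to_K a = poly (map_poly fls_const a) fls_X_inv"

definition abs_K :: "'a::{finite, field} fls \<Rightarrow> real" where
  "abs_K f = (if f = 0 then 0 else real CARD('a) powi (- fls_subdegree f))"

text \<open>
  Fields with a (not necessarily nontrivial) ultrametric absolute value. The library classes of
  normed fields are all algebras over the reals.
\<close>

class ultrametric_field = field + metric_space +
  fixes absv :: "'a \<Rightarrow> real"
  assumes absv_nonneg: "absv x \<ge> 0"
    and absv_eq_0_iff: "absv x = 0 \<longleftrightarrow> x = 0"
    and absv_add: "absv (x + y) \<le> max (absv x) (absv y)"
    and absv_mult: "absv (x * y) = absv x * absv y"
    and dist_absv: "dist x y = absv (x - y)"

text \<open>
  A complete type \<^typ>\<open>'c\<close> together with a map j as below is a completion of an algebraic closure
  of \<^typ>\<open>'a fls\<close>, with respect to the unique extension of the absolute value \<^const>\<open>abs_K\<close>.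
\<close>

locale C_infinity =
  fixes j :: "'a::{finite, field} fls alg_closure \<Rightarrow> 'c::{ultrametric_field, complete_space}"
  assumes j_one: "j 1 = 1"
    and j_add: "j (x + y) = j x + j y"
    and j_mult: "j (x * y) = j x * j y"
    and absv_j: "absv (j (to_ac f)) = abs_K f"
    and dense: "closure (range j) = UNIV"

definition K_to_C :: "('a::{finite, field} fls alg_closure \<Rightarrow> 'c) \<Rightarrow> 'a fls \<Rightarrow> 'c" where
  "K_to_C j b = j (to_ac b)"

definition A_to_C :: "('a::{finite, field} fls alg_closure \<Rightarrow> 'c) \<Rightarrow> 'a poly \<Rightarrow> 'c" where
  "A_to_C j a = K_to_C j (A_to_K a)"

definition Fq_to_C :: "('a::{finite, field} fls alg_closure \<Rightarrow> 'c) \<Rightarrow> 'a \<Rightarrow> 'c" where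
  "Fq_to_C j c = K_to_C j (fls_const c)"

abbreviation theta_C :: "('a::{finite, field} fls alg_closure \<Rightarrow> 'c) \<Rightarrow> 'c" where
  "theta_C j \<equiv> A_to_C j [:0, 1:]"


section \<open>Drinfeld modules and their exponentials\<close>

text \<open>
  The product of twisted power series in \<tau>, a series being represented by its sequence of
  coefficients (written on the left); it extends \<open>\<tau> c = c^q \<tau>\<close>. Twisted polynomials are
  represented by \<^typ>\<open>'c poly\<close>, via \<^const>\<open>fps_of_poly\<close>.
\<close>

definition skew_mult :: "nat \<Rightarrow> 'c::comm_ring_1 fps \<Rightarrow> 'c fps \<Rightarrow> 'c fps" where
  "skew_mult q f g = Abs_fps (\<lambda>n. \<Sum>i\<le>n. fps_nth f i * fps_nth g (n - i) ^ (q ^ i))"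

definition drinfeld_module ::
  "('a::{finite, field} fls alg_closure \<Rightarrow> 'c::field) \<Rightarrow> ('a poly \<Rightarrow> 'c poly) \<Rightarrow> bool" where
  "drinfeld_module j \<phi> \<longleftrightarrow>
     (\<forall>a b. \<phi> (a + b) = \<phi> a + \<phi> b) \<and>
     (\<forall>a b. fps_of_poly (\<phi> (a * b)) =
        skew_mult CARD('a) (fps_of_poly (\<phi> a)) (fps_of_poly (\<phi> b))) \<and>
     (\<forall>c. \<phi> [:c:] = [:Fq_to_C j c:]) \<and>
     (\<forall>a. poly.coeff (\<phi> a) 0 = A_to_C j a) \<and>
     (\<exists>a. \<phi> a \<noteq> [:A_to_C j a:])"

text \<open>The degree in \<tau> of the image of a is the rank times the degree of a; take \<open>a = \<theta>\<close>.\<close>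

definition drinfeld_rank :: "('a::{finite, field} poly \<Rightarrow> 'c::field poly) \<Rightarrow> nat" where
  "drinfeld_rank \<phi> = Polynomial.degree (\<phi> [:0, 1:])"

definition exp_series ::
  "('a::{finite, field} fls alg_closure \<Rightarrow> 'c::field) \<Rightarrow> ('a poly \<Rightarrow> 'c poly) \<Rightarrow> 'c fps" where
  "exp_series j \<phi> = (THE e. fps_nth e 0 = 1 \<and>
     (\<forall>a. skew_mult CARD('a) e (fps_const (A_to_C j a)) =
          skew_mult CARD('a) (fps_of_poly (\<phi> a)) e))"

definition drinfeld_exp ::
  "('a::{finite, field} fls alg_closure \<Rightarrow> 'c::ultrametric_field) \<Rightarrow> ('a poly \<Rightarrow> 'c poly) \<Rightarrow> 'c \<Rightarrow> 'c"
  where "drinfeld_exp j \<phi> z = (\<Sum>n. fps_nth (exp_series j \<phi>) n * z ^ (CARD('a) ^ n))"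

definition period_lattice ::
  "('a::{finite, field} fls alg_closure \<Rightarrow> 'c::ultrametric_field) \<Rightarrow> ('a poly \<Rightarrow> 'c poly) \<Rightarrow> 'c set"
  where "period_lattice j \<phi> = {z. drinfeld_exp j \<phi> z = 0}"


section \<open>Differentials, the dual of the lattice, and the pairing\<close>

text \<open>The module \<Omega> is free on \<open>d\<theta>\<close>; the polynomial a stands for the differential \<open>a d\<theta>\<close>.\<close>

type_synonym 'a differential = "'a poly"

definition d_theta :: "'a::{finite, field} differential" where
  "d_theta = 1"

text \<open>The pairing of \<Omega> with \<open>K/A\<close>, on representatives in K.\<close>

definition res_pairing :: "'a::{finite, field} differential \<Rightarrow> 'a fls \<Rightarrow> 'a" where
  "res_pairing a b = fls_nth (A_to_K a * b) 1"

lemma res_pairing_d_theta: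
  "res_pairing d_theta (fls_X_inv powi n) = (if n = -1 then 1 else 0 :: 'a::{finite, field})"
proof -
  have "fls_X_inv powi n = (fls_X_intpow (- n) :: 'a fls)"
  proof (cases "n \<ge> 0")
    case True
    then show ?thesis
      by (simp add: power_int_def fls_X_inv_power_conv_shift_1)
  next
    case False
    then show ?thesis
      by (simp add: power_int_def fls_inverse_X_inv fls_X_power_conv_shift_1)
  qed
  then show ?thesis
    by (auto simp: res_pairing_def d_theta_def A_to_K_def)
qed

lemma res_pairing_mult: "res_pairing (a * w) b = res_pairing w (A_to_K a * b)"
proof -
  have pCons: "A_to_K (pCons c p) = fls_const c + fls_X_inv * A_to_K p" for c :: 'a and p
    by (simp add: A_to_K_def map_poly_pCons)
  have zero: "A_to_K 0 = (0 :: 'a fls)"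
    by (simp add: A_to_K_def)
  have add: "A_to_K (p + p') = A_to_K p + A_to_K p'" for p p' :: "'a poly"
    by (induction p p' rule: poly_induct2) (simp_all only: add_pCons zero pCons fls_plus_const[symmetric] distrib_left add_0_left add_0_right ac_simps)
  have smult: "A_to_K (Polynomial.smult c p) = fls_const c * A_to_K p" for c :: 'a and p
    by (induction p) (simp_all only: smult_pCons smult_0_right zero pCons fls_const_mult_const[symmetric] distrib_left mult_zero_right mult.left_commute)
  have "A_to_K (a * w) = A_to_K a * A_to_K w"
    by (induction a) (simp_all only: mult_pCons_left mult_zero_left zero pCons add smult distrib_right fls_const_0 add_0_left mult.assoc)
  then show ?thesis by (simp add: res_pairing_def mult_ac)
qed

text \<open>A-linear maps from L to \<Omega>, extended by 0 outside L.\<close>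

definition dual_lattice ::
  "('a::{finite, field} fls alg_closure \<Rightarrow> 'c::field) \<Rightarrow> 'c set \<Rightarrow> ('c \<Rightarrow> 'a differential) set" where
  "dual_lattice j L = {\<mu>. (\<forall>x. x \<notin> L \<longrightarrow> \<mu> x = 0) \<and>
     (\<forall>x\<in>L. \<forall>y\<in>L. \<mu> (x + y) = \<mu> x + \<mu> y) \<and>
     (\<forall>a. \<forall>x\<in>L. \<mu> (A_to_C j a * x) = a * \<mu> x)}"

definition K_span ::
  "('a::{finite, field} fls alg_closure \<Rightarrow> 'c::field) \<Rightarrow> 'c set \<Rightarrow> 'c set" where
  "K_span j L = module.span (\<lambda>b x. K_to_C j b * x) L"

text \<open>
  The pairing of an A-linear map \<mu> with the class modulo L of an element of the K-span of L.
  As L is discrete, its K-span is the tensor product of L and K over A, so the value does not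
  depend on the chosen expression for x.
\<close>

definition lattice_pairing ::
  "('a::{finite, field} fls alg_closure \<Rightarrow> 'c::field) \<Rightarrow> 'c set \<Rightarrow> ('c \<Rightarrow> 'a differential) \<Rightarrow> 'c \<Rightarrow> 'a"
  where "lattice_pairing j L \<mu> x = (THE v. \<exists>S b. finite S \<and> S \<subseteq> L \<and>
     x = (\<Sum>l\<in>S. K_to_C j (b l) * l) \<and> v = (\<Sum>l\<in>S. res_pairing (\<mu> l) (b l)))"

text \<open>
  A representative in the K-span of L of the member dual to \<mu> of the dual basis; it is unique
  modulo L.
\<close>

definition dual_basis_rep ::
  "('a::{finite, field} fls alg_closure \<Rightarrow> 'c::field) \<Rightarrow> 'c set \<Rightarrow>
     ('c \<Rightarrow> 'a differential) set \<Rightarrow> ('c \<Rightarrow> 'a differential) \<Rightarrow> 'c" where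
  "dual_basis_rep j L B \<mu> = (SOME x. x \<in> K_span j L \<and>
     (\<forall>\<nu>\<in>B. lattice_pairing j L \<nu> x = (if \<nu> = \<mu> then 1 else 0)))"


section \<open>Completed tensor products\<close>

definition Fq_scale_C :: "('a::{finite, field} fls alg_closure \<Rightarrow> 'c::field) \<Rightarrow> 'a \<Rightarrow> 'c \<Rightarrow> 'c" where
  "Fq_scale_C j c x = Fq_to_C j c * x"

definition Fq_scale_hom :: "'a::{finite, field} \<Rightarrow> ('c \<Rightarrow> 'a differential) \<Rightarrow> ('c \<Rightarrow> 'a differential)" where
  "Fq_scale_hom c \<mu> = (\<lambda>x. Polynomial.smult c (\<mu> x))"

definition is_basis :: "('a::field \<Rightarrow> 'm::ab_group_add \<Rightarrow> 'm) \<Rightarrow> 'm set \<Rightarrow> 'm set \<Rightarrow> bool" where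
  "is_basis sc B M \<longleftrightarrow> \<not> module.dependent sc B \<and> module.span sc B = M"

lemma (in C_infinity) vector_space_Fq_scale_C: "vector_space (Fq_scale_C j)"
proof
  show "Fq_scale_C j a (x + y) = Fq_scale_C j a x + Fq_scale_C j a y" for a x y
    by (simp add: Fq_scale_C_def algebra_simps)
  show "Fq_scale_C j (a + b) x = Fq_scale_C j a x + Fq_scale_C j b x" for a b x
    by (simp add: Fq_scale_C_def Fq_to_C_def K_to_C_def j_add algebra_simps flip: fls_plus_const)
  show "Fq_scale_C j a (Fq_scale_C j b x) = Fq_scale_C j (a * b) x" for a b x
    by (simp add: Fq_scale_C_def Fq_to_C_def K_to_C_def j_mult algebra_simps
        flip: fls_const_mult_const)
  show "Fq_scale_C j 1 x = x" for x
    by (simp add: Fq_scale_C_def Fq_to_C_def K_to_C_def j_one)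
qed

lemma vector_space_Fq_scale_hom:
  "vector_space (Fq_scale_hom :: 'a::{finite, field} \<Rightarrow> ('c \<Rightarrow> 'a differential) \<Rightarrow> _)"
  by standard (auto simp: Fq_scale_hom_def fun_eq_iff smult_add_right smult_add_left)

text \<open>
  Given a basis of a discrete vector space M indexed by I, the element \<open>\<Sum> c\<^sub>i \<otimes> m\<^sub>i\<close> of the
  completed tensor product with M is represented by the family of its coefficients \<open>c\<^sub>i\<close>,
  extended by 0 outside I. The sup norm is that of the family, so convergence is uniform
  convergence.
\<close>

definition completed_tensor :: "'i set \<Rightarrow> ('i \<Rightarrow> 'c::ultrametric_field) set" where
  "completed_tensor I = {x. (\<forall>i. i \<notin> I \<longrightarrow> x i = 0) \<and> (\<forall>e>0. finite {i\<in>I. absv (x i) \<ge> e})}"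

text \<open>Here \<open>crd m\<close> is the family of coordinates of m in the given basis.\<close>

definition pure_tensor ::
  "('a::{finite, field} fls alg_closure \<Rightarrow> 'c::field) \<Rightarrow> ('m \<Rightarrow> 'i \<Rightarrow> 'a) \<Rightarrow> 'c \<Rightarrow> 'm \<Rightarrow> ('i \<Rightarrow> 'c)" where
  "pure_tensor j crd c m = (\<lambda>i. c * Fq_to_C j (crd m i))"

text \<open>The unordered sum of a family \<open>(f k)\<close> for k in K, with respect to the sup norm.\<close>

definition tensor_sum ::
  "'i set \<Rightarrow> ('k \<Rightarrow> 'i \<Rightarrow> 'c::ultrametric_field) \<Rightarrow> 'k set \<Rightarrow> ('i \<Rightarrow> 'c)" where
  "tensor_sum I f K = (THE x. x \<in> completed_tensor I \<and>
     uniform_limit UNIV (\<lambda>F i. \<Sum>k\<in>F. f k i) x (finite_subsets_at_top K))"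

definition twist :: "nat \<Rightarrow> nat \<Rightarrow> ('i \<Rightarrow> 'c::field) \<Rightarrow> ('i \<Rightarrow> 'c)" where
  "twist q k x = (\<lambda>i. x i ^ (q ^ k))"

text \<open>
  A and \<Omega> have the bases \<open>(\<theta>\<^sup>n)\<close> and \<open>(\<theta>\<^sup>n d\<theta>)\<close> indexed by the naturals, with coordinates given
  by \<^const>\<open>poly.coeff\<close>. Their completed tensor products are represented by the power series whose
  coefficients are the coefficients in these bases; both the product of the former ring and its
  action on the latter module are then the product of power series.
\<close>

definition completed_tensor_poly :: "'c::ultrametric_field fps set" where
  "completed_tensor_poly = {f. fps_nth f \<in> completed_tensor UNIV}"

definition poly_tensor ::
  "('a::{finite, field} fls alg_closure \<Rightarrow> 'c::field) \<Rightarrow> 'c \<Rightarrow> 'a poly \<Rightarrow> 'c fps" where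
  "poly_tensor j c a = Abs_fps (pure_tensor j poly.coeff c a)"


text \<open>
  The element \<open>\<theta> \<otimes> 1 - 1 \<otimes> \<theta>\<close> is invertible in the completed tensor product with A: its inverse
  as a power series is a member, so that division by it is division of power series.
\<close>

context C_infinity
begin

lemma j_zero: "j 0 = 0"
  using j_add[of 0 0] by (metis add_0_right add_left_imp_eq)

lemma poly_tensor_one_d_theta: "poly_tensor j 1 d_theta = 1"
  by (rule fps_ext)
     (auto simp: poly_tensor_def pure_tensor_def d_theta_def Fq_to_C_def K_to_C_def j_one j_zero)

lemma poly_tensor_theta_diff:
  "poly_tensor j (theta_C j) 1 - poly_tensor j 1 [:0, 1:] = fps_const (theta_C j) - fps_X"
  by (rule fps_ext)
     (auto simp: poly_tensor_def pure_tensor_def Fq_to_C_def K_to_C_def j_one j_zero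
        coeff_pCons split: nat.splits)

lemma absv_theta: "absv (theta_C j) = real CARD('a)"
proof -
  have "A_to_K [:0, 1:] = (fls_X_inv :: 'a fls)"
    by (simp add: A_to_K_def map_poly_pCons)
  then show ?thesis
    by (simp add: A_to_C_def K_to_C_def absv_j abs_K_def)
qed

lemma theta_neq_0: "theta_C j \<noteq> 0"
  using absv_theta absv_eq_0_iff[of "theta_C j"] by auto

lemma inverse_theta_diff:
  defines "u \<equiv> poly_tensor j (theta_C j) 1 - poly_tensor j 1 [:0, 1:]"
  shows "1 / u \<in> completed_tensor_poly" and "u * (1 / u) = 1"
proof -
  define t where "t = theta_C j"
  define v where "v = Abs_fps (\<lambda>n. inverse t ^ Suc n)"
  have t: "t \<noteq> 0" unfolding t_def by (rule theta_neq_0)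
  have u: "u = fps_const t - fps_X"
    unfolding u_def t_def by (rule poly_tensor_theta_diff)
  have uv: "u * v = 1"
  proof (rule fps_ext)
    fix n show "fps_nth (u * v) n = fps_nth 1 n"
      using t by (cases n) (auto simp: u v_def left_diff_distrib)
  qed
  have u0: "fps_nth u 0 \<noteq> 0" using t by (simp add: u)
  show "u * (1 / u) = 1"
    using u0 by (simp add: fps_divide_unit inverse_mult_eq_1')
  have "1 / u = v"
    using u0 uv by (metis fps_divide_unit fps_inverse_unique mult_1)
  moreover have "fps_nth v \<in> completed_tensor UNIV"
  proof -
    let ?q = "real CARD('a)"
    have q: "?q > 1"
    proof -
      have "card {0, 1 :: 'a} \<le> CARD('a)" by (rule card_mono) auto
      then show ?thesis by simp
    qed
    have one: "absv (1 :: 'c) = 1"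
      using absv_mult[of "1 :: 'c" 1] absv_eq_0_iff[of "1 :: 'c"] by simp
    have "absv (inverse t) * ?q = 1"
      using absv_mult[of "inverse t" t] t one absv_theta by (simp add: t_def)
    then have inv: "absv (inverse t) = inverse ?q"
      using q by (simp add: field_simps)
    have nth: "absv (fps_nth v n) = inverse ?q ^ Suc n" for n
    proof -
      have "absv (inverse t ^ m) = inverse ?q ^ m" for m
        by (induction m) (auto simp: one absv_mult inv)
      then show ?thesis by (simp only: v_def fps_nth_Abs_fps)
    qed
    have "finite {i. absv (fps_nth v i) \<ge> e}" if "e > 0" for e
    proof -
      have "(\<lambda>n. inverse ?q ^ Suc n) \<longlonglongrightarrow> 0"
        using q by (intro LIMSEQ_Suc LIMSEQ_power_zero) (auto simp: field_simps)
      then have "eventually (\<lambda>n. inverse ?q ^ Suc n < e) sequentially"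
        using that by (rule order_tendstoD)
      then obtain N where N: "\<And>n. n \<ge> N \<Longrightarrow> inverse ?q ^ Suc n < e"
        unfolding eventually_sequentially by blast
      have "{i. absv (fps_nth v i) \<ge> e} \<subseteq> {..<N}"
      proof
        fix i assume "i \<in> {i. absv (fps_nth v i) \<ge> e}"
        then have "\<not> inverse ?q ^ Suc i < e" by (simp only: nth mem_Collect_eq not_less)
        with N[of i] show "i \<in> {..<N}" by (meson lessThan_iff not_le)
      qed
      then show ?thesis by (rule finite_subset) simp
    qed
    then show ?thesis by (simp add: completed_tensor_def)
  qed
  ultimately show "1 / u \<in> completed_tensor_poly"
    by (simp add: completed_tensor_poly_def)
qed

end


section \<open>The zeta element, the special function and their dot product\<close>

text \<open>
  B is a basis over the finite field of the period lattice, and B' one of its dual lattice; the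
  coordinates of the elements are indexed by the basis vectors themselves.
\<close>

definition drinfeld_zeta ::
  "('a::{finite, field} fls alg_closure \<Rightarrow> 'c::ultrametric_field) \<Rightarrow> ('a poly \<Rightarrow> 'c poly) \<Rightarrow> 'c set
     \<Rightarrow> ('c \<Rightarrow> 'c)" where
  "drinfeld_zeta j \<phi> B = - tensor_sum B
     (\<lambda>l. pure_tensor j (module.representation (Fq_scale_C j) B) (inverse l) l)
     (period_lattice j \<phi> - {0})"

definition drinfeld_omega ::
  "('a::{finite, field} fls alg_closure \<Rightarrow> 'c::ultrametric_field) \<Rightarrow> ('a poly \<Rightarrow> 'c poly) \<Rightarrow>
     ('c \<Rightarrow> 'a differential) set \<Rightarrow> (('c \<Rightarrow> 'a differential) \<Rightarrow> 'c)" where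
  "drinfeld_omega j \<phi> B' = (\<lambda>\<mu>. if \<mu> \<in> B'
     then drinfeld_exp j \<phi> (dual_basis_rep j (period_lattice j \<phi>) B' \<mu>) else 0)"

definition tensor_dot ::
  "('a::{finite, field} fls alg_closure \<Rightarrow> 'c::ultrametric_field) \<Rightarrow> 'c set \<Rightarrow>
     ('c \<Rightarrow> 'a differential) set \<Rightarrow> ('c \<Rightarrow> 'c) \<Rightarrow> (('c \<Rightarrow> 'a differential) \<Rightarrow> 'c) \<Rightarrow> 'c fps" where
  "tensor_dot j B B' x y = Abs_fps (tensor_sum UNIV
     (\<lambda>(l, \<mu>). pure_tensor j poly.coeff (x l * y \<mu>) (\<mu> l)) (B \<times> B'))"

end

theory Submission
  imports Defs
begin

text \<open>
  For \<open>b = \<theta>\<^bsup>-n-1\<^esup>\<close> the coefficient of \<open>\<theta>\<^sup>n d\<theta>\<close> in the product of \<open>\<zeta>\<close> and \<open>\<omega>\<^sup>(\<^sup>k\<^sup>)\<close> is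
  \<open>- \<Sum> \<lambda>\<inverse> exp(b \<lambda>)\<^bsup>q^k\<^esup>\<close>, the sum being over the nonzero periods, because the sum of the
  \<open>exp(\<mu>\<^sup>*) \<langle>\<mu>, b \<lambda>\<rangle>\<close> over a basis is \<open>exp(b \<lambda>)\<close>. Since exp is an isometry near 0, the periods
  \<open>\<lambda>\<close> with \<open>\<lambda> / \<theta>\<^sup>N\<close> small correspond to the small torsion points \<open>x = exp(\<lambda> / \<theta>\<^sup>N)\<close> of
  \<open>\<phi>\<close> at \<open>\<theta>\<^sup>N\<close>, and \<open>\<lambda>\<inverse>\<close> is close to \<open>\<theta>\<^bsup>-N\<^esup> x\<inverse>\<close>. So the sum is the limit of
  \<open>\<theta>\<^bsup>-N\<^esup> \<Sum> x\<inverse> \<phi>(x)\<^bsup>q^k\<^esup>\<close> over all nonzero torsion points, with \<open>\<phi>\<close> taken at \<open>\<theta>\<^bsup>N-n-1\<^esup>\<close>; the large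
  torsion points contribute nothing in the limit. As \<open>k\<close> is less than the rank, the summand is
  a polynomial in x of degree less than the number of torsion points minus 1, and Lagrange
  interpolation shows that its sum over all torsion points, 0 included, vanishes. Only the value
  at \<open>x = 0\<close> survives: it is \<open>\<theta>\<^bsup>N-n-1\<^esup>\<close> for \<open>k = 0\<close> and 0 otherwise.
\<close>

section \<open>Ultrametric fields and convergence of unordered sums\<close>

text \<open>Two things must be earned before the limit argument can run. First, the theta^N-torsion
  points must number exactly q^(rN), so the complete field has to be algebraically closed; this is
  proved by approximating coefficients. Separability is free: the torsion polynomials have constant
  nonzero derivative, which also makes all Lagrange denominators equal. Second, \<open>B'\<close> is
  an arbitrary algebraic basis of an infinite-dimensional space: it is not clear in advance that
  dual vectors exist or that the coefficients of omega tend to 0. The periods are therefore shown to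
  be discrete and finitely generated, both from finiteness of torsion, and duality is worked out for
  generators that may satisfy relations; a finite part of \<open>B'\<close> then controls an element
  modulo periods up to any given error. The torsion comparison has an error of order q^(-N) because,
  for fixed n, the values of \<open>\<phi>\<close> at theta^(N-n-1) on the torsion points lie in the
  finite theta^(n+1)-torsion, whatever N is. Ultrametric errors do not accumulate over finite sums,
  so one tolerance serves for all approximations.\<close>

lemma absv_zero [simp]: "absv (0 :: 'c::ultrametric_field) = 0"
  by (simp add: absv_eq_0_iff)

lemma absv_one [simp]: "absv (1 :: 'c::ultrametric_field) = 1"
  using absv_mult[of "1 :: 'c" 1] absv_eq_0_iff[of "1 :: 'c"] by simp

lemma absv_minus [simp]: "absv (- x) = absv (x :: 'c::ultrametric_field)"
  by (metis add.right_neutral add_uminus_conv_diff dist_absv dist_commute diff_0_right diff_0)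

lemma absv_pos_iff [simp]: "absv x > 0 \<longleftrightarrow> x \<noteq> (0 :: 'c::ultrametric_field)"
  using absv_nonneg[of x] absv_eq_0_iff[of x] by linarith

lemma absv_diff: "absv (x - y) \<le> max (absv x) (absv (y :: 'c::ultrametric_field))"
  using absv_add[of x "- y"] by simp

lemma absv_diff_commute: "absv (x - y) = absv (y - x :: 'c::ultrametric_field)"
  by (metis absv_minus minus_diff_eq)

lemma absv_diff_trans:
  "absv (x - z) \<le> max (absv (x - y)) (absv (y - z :: 'c::ultrametric_field))"
  using absv_add[of "x - y" "y - z"] by simp

lemma absv_power: "absv (x ^ n) = absv (x :: 'c::ultrametric_field) ^ n"
  by (induction n) (auto simp: absv_mult)

lemma absv_inverse: "absv (inverse x) = inverse (absv (x :: 'c::ultrametric_field))"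
proof (cases "x = 0")
  case False
  then have "absv (inverse x) * absv x = 1"
    by (simp flip: absv_mult)
  then show ?thesis
    by (metis inverse_unique mult.commute)
qed auto

lemma absv_divide: "absv (x / y) = absv x / absv (y :: 'c::ultrametric_field)"
  by (simp add: divide_inverse absv_mult absv_inverse)

lemma absv_add_eq:
  assumes "absv y < absv (x :: 'c::ultrametric_field)"
  shows "absv (x + y) = absv x"
  using absv_add[of x y] absv_diff[of "x + y" y] assms by simp

lemma absv_sum_le:
  assumes "\<And>i. i \<in> A \<Longrightarrow> absv (f i :: 'c::ultrametric_field) \<le> e" "e \<ge> 0"
  shows "absv (sum f A) \<le> e"
  using assms
  by (induction A rule: infinite_finite_induct) (auto intro: order_trans[OF absv_add])

lemma tendsto_absv_iff:
  "(f \<longlongrightarrow> l) F \<longleftrightarrow> ((\<lambda>x. absv (f x - l :: 'c::ultrametric_field)) \<longlongrightarrow> 0) F"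
  by (subst tendsto_dist_iff) (simp add: dist_absv)

lemma tendsto_by_bound:
  fixes l :: "'c::ultrametric_field"
  assumes "(g \<longlongrightarrow> (0::real)) F" "eventually (\<lambda>x. absv (f x - l) \<le> g x) F"
  shows "(f \<longlongrightarrow> l) F"
  unfolding tendsto_absv_iff
  by (rule tendsto_sandwich[OF _ assms(2) tendsto_const assms(1)]) (simp add: absv_nonneg)

instance ultrametric_field \<subseteq> topological_ab_group_add
proof
  fix a b :: 'a
  let ?F = "nhds a \<times>\<^sub>F nhds b"
  have "(fst \<longlongrightarrow> a) ?F"
    using tendsto_fst[OF filterlim_ident, of "(a, b)"] by (simp add: nhds_prod)
  then have a: "((\<lambda>x. absv (fst x - a)) \<longlongrightarrow> 0) ?F"
    by (simp only: tendsto_absv_iff)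
  have "(snd \<longlongrightarrow> b) ?F"
    using tendsto_snd[OF filterlim_ident, of "(a, b)"] by (simp add: nhds_prod)
  then have b: "((\<lambda>x. absv (snd x - b)) \<longlongrightarrow> 0) ?F"
    by (simp only: tendsto_absv_iff)
  have *: "absv (fst x + snd x - (a + b)) \<le> max (absv (fst x - a)) (absv (snd x - b))" for x
    using absv_add[of "fst x - a" "snd x - b"] by (simp add: algebra_simps)
  show "((\<lambda>x. fst x + snd x) \<longlongrightarrow> a + b) ?F"
    using tendsto_max[OF a b] * by (intro tendsto_by_bound[of "\<lambda>x. max (absv (fst x - a)) (absv (snd x - b))"]) auto
  have "((\<lambda>x. x) \<longlongrightarrow> a) (nhds a)"
    by (rule filterlim_ident)
  then have "((\<lambda>x. absv (x - a)) \<longlongrightarrow> 0) (nhds a)"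
    by (simp only: tendsto_absv_iff)
  moreover have "absv (- x - - a) = absv (x - a)" for x
    using absv_diff_commute[of x a] by simp
  ultimately show "(uminus \<longlongrightarrow> - a) (nhds a)"
    by (simp only: tendsto_absv_iff)
qed

instance ultrametric_field \<subseteq> topological_monoid_mult
proof
  fix a b :: 'a
  let ?F = "nhds a \<times>\<^sub>F nhds b"
  have "(fst \<longlongrightarrow> a) ?F"
    using tendsto_fst[OF filterlim_ident, of "(a, b)"] by (simp add: nhds_prod)
  then have a: "((\<lambda>x. absv (fst x - a)) \<longlongrightarrow> 0) ?F"
    by (simp only: tendsto_absv_iff)
  have "(snd \<longlongrightarrow> b) ?F"
    using tendsto_snd[OF filterlim_ident, of "(a, b)"] by (simp add: nhds_prod)
  then have b: "((\<lambda>x. absv (snd x - b)) \<longlongrightarrow> 0) ?F"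
    by (simp only: tendsto_absv_iff)
  let ?g = "\<lambda>x. absv (fst x - a) * absv (snd x - b) + (absv (fst x - a) * absv b + absv a * absv (snd x - b))"
  have *: "absv (fst x * snd x - a * b) \<le> ?g x" for x
  proof -
    have "fst x * snd x - a * b = (fst x - a) * (snd x - b) + ((fst x - a) * b + a * (snd x - b))"
      by (simp add: algebra_simps)
    then have "absv (fst x * snd x - a * b) \<le> max (absv (fst x - a) * absv (snd x - b))
        (max (absv (fst x - a) * absv b) (absv a * absv (snd x - b)))"
      using absv_add[of "(fst x - a) * (snd x - b)" "(fst x - a) * b + a * (snd x - b)"]
        absv_add[of "(fst x - a) * b" "a * (snd x - b)"]
      by (simp only: absv_mult)
    also have "\<dots> \<le> ?g x"
      by (intro max.boundedI) (auto intro: add_increasing add_increasing2 mult_nonneg_nonneg absv_nonneg)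
    finally show ?thesis .
  qed
  have "(?g \<longlongrightarrow> 0 * 0 + (0 * absv b + absv a * 0)) ?F"
    by (intro tendsto_intros a b)
  then show "((\<lambda>x. fst x * snd x) \<longlongrightarrow> a * b) ?F"
    using * by (intro tendsto_by_bound[of ?g]) auto
qed

lemma absv_limit_le:
  fixes l :: "'c::ultrametric_field"
  assumes "(f \<longlongrightarrow> l) F" "F \<noteq> bot" "eventually (\<lambda>x. absv (f x) \<le> e) F"
  shows "absv l \<le> e"
proof -
  have e: "e \<ge> 0"
    using eventually_happens[OF assms(3)] assms(2) absv_nonneg order_trans by blast
  have "absv l \<le> e + d" if "d > 0" for d
  proof -
    have "eventually (\<lambda>x. dist (f x) l < d) F"
      using assms(1) that by (simp add: tendsto_iff)
    with assms(3) have "eventually (\<lambda>x. absv (f x) \<le> e \<and> absv (f x - l) < d) F"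
      by eventually_elim (simp add: dist_absv)
    then obtain x where x: "absv (f x) \<le> e" "absv (f x - l) < d"
      using eventually_happens assms(2) by blast
    then show ?thesis
      using absv_diff[of "f x" "f x - l"] e that by (simp add: max_def split: if_splits)
  qed
  then show ?thesis
    by (rule field_le_epsilon)
qed

text \<open>The difference of two terms is a sum of consecutive steps, so by the strong triangle
  inequality it is no larger than the largest of these steps.\<close>

lemma Cauchy_ultrametricI:
  fixes x :: "nat \<Rightarrow> 'c::ultrametric_field"
  assumes "(\<lambda>n. absv (x (Suc n) - x n)) \<longlonglongrightarrow> 0"
  shows "Cauchy x"
proof (rule metric_CauchyI)
  fix e :: real assume e: "e > 0"
  then obtain N where N: "\<And>n. n \<ge> N \<Longrightarrow> absv (x (Suc n) - x n) < e"
    using order_tendstoD(2)[OF assms] unfolding eventually_sequentially by blast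
  have *: "absv (x n - x N) < e" if "n \<ge> N" for n
    using that
  proof (induction n rule: dec_induct)
    case (step n)
    then show ?case
      using absv_diff_trans[of "x (Suc n)" "x N" "x n"] N[of n] by linarith
  qed (use e in auto)
  show "\<exists>M. \<forall>m\<ge>M. \<forall>n\<ge>M. dist (x m) (x n) < e"
  proof (intro exI allI impI)
    fix m n assume "m \<ge> N" "n \<ge> N"
    then show "dist (x m) (x n) < e"
      using *[of m] *[of n] absv_diff_trans[of "x m" "x n" "x N"] absv_diff_commute[of "x n" "x N"]
      by (simp add: dist_absv)
  qed
qed

lemma summable_ultrametric:
  fixes f :: "nat \<Rightarrow> 'c::{ultrametric_field, complete_space}"
  assumes "(\<lambda>n. absv (f n)) \<longlonglongrightarrow> 0"
  shows "summable f"
proof -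
  have "Cauchy (\<lambda>n. \<Sum>i<n. f i)"
    by (rule Cauchy_ultrametricI) (use assms in simp)
  then show ?thesis
    by (simp add: summable_iff_convergent Cauchy_convergent_iff)
qed

lemma absv_sums_le:
  fixes f :: "nat \<Rightarrow> 'c::ultrametric_field"
  assumes "f sums s" "\<And>n. absv (f n) \<le> e"
  shows "absv s \<le> e"
proof (rule absv_limit_le)
  show "(\<lambda>n. \<Sum>i<n. f i) \<longlonglongrightarrow> s"
    using assms(1) by (simp add: sums_def)
  have "e \<ge> 0"
    using assms(2)[of 0] absv_nonneg[of "f 0"] by linarith
  then show "\<forall>\<^sub>F n in sequentially. absv (\<Sum>i<n. f i) \<le> e"
    by (intro always_eventually allI absv_sum_le assms(2))
qed auto

text \<open>Only finitely many members exceed a given bound anywhere, so adding further members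
  changes a partial sum uniformly by at most that bound. The sums over the nested sets
  \<open>G n\<close> converge in each coordinate, and the uniform estimate survives in the
  limit.\<close>

lemma tensor_sum_exists:
  fixes f :: "'k \<Rightarrow> 'i \<Rightarrow> 'c::{ultrametric_field, complete_space}"
  assumes f: "\<And>k. k \<in> K \<Longrightarrow> f k \<in> completed_tensor I"
    and fin: "\<And>e. e > 0 \<Longrightarrow> finite {k\<in>K. \<exists>i. absv (f k i) \<ge> e}"
  shows "\<exists>x\<in>completed_tensor I.
     uniform_limit UNIV (\<lambda>F i. \<Sum>k\<in>F. f k i) x (finite_subsets_at_top K)"
proof -
  define d where "d n = inverse (real (Suc n))" for n
  have d: "d n > 0" "d m \<le> d n" if "n \<le> m" for m n
    using that by (auto simp: d_def)
  have d0: "d \<longlonglongrightarrow> 0"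
    unfolding d_def by (rule LIMSEQ_inverse_real_of_nat)
  define G where "G n = {k\<in>K. \<exists>i. absv (f k i) \<ge> d n}" for n
  have G: "finite (G n)" "G n \<subseteq> K" for n
    using fin[of "d n"] d[of n n] by (auto simp: G_def)
  have near: "absv ((\<Sum>k\<in>F. f k i) - (\<Sum>k\<in>G n. f k i)) \<le> d n"
    if "finite F" "G n \<subseteq> F" "F \<subseteq> K" for F n i
  proof -
    have "(\<Sum>k\<in>F. f k i) - (\<Sum>k\<in>G n. f k i) = (\<Sum>k\<in>F - G n. f k i)"
      using sum_diff[OF that(1,2), of "\<lambda>k. f k i"] by simp
    moreover have "absv (f k i) \<le> d n" if "k \<in> F - G n" for k
    proof -
      have "k \<in> K" "k \<notin> G n"
        using that \<open>F \<subseteq> K\<close> by auto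
      then have "\<not> d n \<le> absv (f k i)"
        unfolding G_def by blast
      then show ?thesis by simp
    qed
    ultimately show ?thesis
      using d(1)[of n n] absv_sum_le[of "F - G n" "\<lambda>k. f k i" "d n"] by auto
  qed
  have mono: "G n \<subseteq> G m" if "n \<le> m" for m n
    using d(2)[OF that] unfolding G_def by (blast intro: order_trans)
  have "Cauchy (\<lambda>n. \<Sum>k\<in>G n. f k i)" for i
  proof (rule Cauchy_ultrametricI)
    have "absv ((\<Sum>k\<in>G (Suc n). f k i) - (\<Sum>k\<in>G n. f k i)) \<le> d n" for n
      using near[of "G (Suc n)" n i] mono[of n "Suc n"] G by auto
    then show "(\<lambda>n. absv ((\<Sum>k\<in>G (Suc n). f k i) - (\<Sum>k\<in>G n. f k i))) \<longlonglongrightarrow> 0"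
      by (intro tendsto_sandwich[OF _ _ tendsto_const d0] always_eventually allI) (auto simp: absv_nonneg)
  qed
  then have "\<exists>y. (\<lambda>n. \<Sum>k\<in>G n. f k i) \<longlonglongrightarrow> y" for i
    by (simp add: Cauchy_convergent_iff convergent_def)
  then obtain x where x: "\<And>i. (\<lambda>n. \<Sum>k\<in>G n. f k i) \<longlonglongrightarrow> x i"
    by metis
  have near_x: "absv ((\<Sum>k\<in>G n. f k i) - x i) \<le> d n" for n i
  proof (rule absv_limit_le)
    show "(\<lambda>m. (\<Sum>k\<in>G n. f k i) - (\<Sum>k\<in>G m. f k i)) \<longlonglongrightarrow> (\<Sum>k\<in>G n. f k i) - x i"
      by (intro tendsto_diff tendsto_const x)
    show "\<forall>\<^sub>F m in sequentially. absv ((\<Sum>k\<in>G n. f k i) - (\<Sum>k\<in>G m. f k i)) \<le> d n"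
      using eventually_ge_at_top[of n]
    proof eventually_elim
      case (elim m)
      then show ?case
        using near[of "G m" n i] G mono by (subst absv_diff_commute) auto
    qed
  qed auto
  have unif: "uniform_limit UNIV (\<lambda>F i. \<Sum>k\<in>F. f k i) x (finite_subsets_at_top K)"
  proof (rule uniform_limitI)
    fix e :: real assume "e > 0"
    then obtain n where n: "d n < e"
      using order_tendstoD(2)[OF d0] eventually_happens'[OF sequentially_bot] by blast
    show "\<forall>\<^sub>F F in finite_subsets_at_top K. \<forall>i\<in>UNIV. dist (\<Sum>k\<in>F. f k i) (x i) < e"
      unfolding eventually_finite_subsets_at_top
    proof (intro exI[of _ "G n"] conjI G allI impI ballI)
      fix F i assume "finite F \<and> G n \<subseteq> F \<and> F \<subseteq> K"
      then show "dist (\<Sum>k\<in>F. f k i) (x i) < e"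
        using near[of F n i] near_x[of i n] n
          absv_diff_trans[of "\<Sum>k\<in>F. f k i" "x i" "\<Sum>k\<in>G n. f k i"]
        by (simp add: dist_absv)
    qed
  qed
  have "x \<in> completed_tensor I"
    unfolding completed_tensor_def
  proof (intro CollectI conjI allI impI)
    fix i assume "i \<notin> I"
    then have "(\<Sum>k\<in>G n. f k i) = 0" for n
      using f G by (intro sum.neutral) (auto simp: completed_tensor_def)
    then have "(\<lambda>n. \<Sum>k\<in>G n. f k i) \<longlonglongrightarrow> 0"
      by simp
    then show "x i = 0"
      using x LIMSEQ_unique by blast
  next
    fix e :: real assume "e > 0"
    then obtain n where n: "d n < e"
      using order_tendstoD(2)[OF d0] eventually_happens'[OF sequentially_bot] by blast
    have "{i\<in>I. e \<le> absv (x i)} \<subseteq> (\<Union>k\<in>G n. {i\<in>I. e \<le> absv (f k i)})"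
    proof
      fix i assume i: "i \<in> {i\<in>I. e \<le> absv (x i)}"
      show "i \<in> (\<Union>k\<in>G n. {i\<in>I. e \<le> absv (f k i)})"
      proof (rule ccontr)
        assume "i \<notin> (\<Union>k\<in>G n. {i\<in>I. e \<le> absv (f k i)})"
        then have small: "absv (f k i) < e" if "k \<in> G n" for k
          using i that by auto
        \<comment> \<open>Bounds pass to sums and limits only as non-strict ones, so a number
          strictly below e is needed that dominates the finitely many terms and the error
          \<open>d n\<close>.\<close>
        obtain e' where e': "e' < e" "d n \<le> e'" "\<And>k. k \<in> G n \<Longrightarrow> absv (f k i) \<le> e'"
        proof
          show "Max (insert (d n) ((\<lambda>k. absv (f k i)) ` G n)) < e"
            using n small G by (subst Max_less_iff) auto
        qed (use G in auto)
        have "absv (\<Sum>k\<in>G n. f k i) \<le> e'"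
          using e' d(1)[of n n] by (intro absv_sum_le) auto
        then have "absv (x i) \<le> e'"
          using near_x[of i n] e' absv_diff[of "\<Sum>k\<in>G n. f k i" "(\<Sum>k\<in>G n. f k i) - x i"]
          by simp
        then show False
          using i e' by simp
      qed
    qed
    moreover have "finite (\<Union>k\<in>G n. {i\<in>I. e \<le> absv (f k i)})"
      using f G \<open>e > 0\<close> by (intro finite_UN_I) (auto simp: completed_tensor_def)
    ultimately show "finite {i\<in>I. e \<le> absv (x i)}"
      by (rule finite_subset)
  qed
  with unif show ?thesis
    by blast
qed

text \<open>\<open>tensor_sum\<close> is a definite description; limits along the nontrivial filter
  of finite subsets are unique, so existence makes it usable.\<close>

lemma tensor_sum_limit:
  fixes f :: "'k \<Rightarrow> 'i \<Rightarrow> 'c::{ultrametric_field, complete_space}"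
  assumes "\<And>k. k \<in> K \<Longrightarrow> f k \<in> completed_tensor I"
    and "\<And>e. e > 0 \<Longrightarrow> finite {k\<in>K. \<exists>i. absv (f k i) \<ge> e}"
  shows "tensor_sum I f K \<in> completed_tensor I"
    and "e > 0 \<Longrightarrow> \<forall>\<^sub>F F in finite_subsets_at_top K. \<forall>i. absv ((\<Sum>k\<in>F. f k i) - tensor_sum I f K i) < e"
proof -
  let ?P = "\<lambda>x. x \<in> completed_tensor I \<and>
     uniform_limit UNIV (\<lambda>F i. \<Sum>k\<in>F. f k i) x (finite_subsets_at_top K)"
  have "\<exists>!x. ?P x"
  proof (rule ex_ex1I)
    fix x y assume "?P x" "?P y"
    then have "((\<lambda>F. \<Sum>k\<in>F. f k i) \<longlongrightarrow> x i) (finite_subsets_at_top K)"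
        "((\<lambda>F. \<Sum>k\<in>F. f k i) \<longlongrightarrow> y i) (finite_subsets_at_top K)" for i
      using tendsto_uniform_limitI by fastforce+
    then show "x = y"
      by (intro ext) (metis tendsto_unique finite_subsets_at_top_neq_bot)
  qed (use tensor_sum_exists[OF assms] in blast)
  then have P: "?P (tensor_sum I f K)"
    unfolding tensor_sum_def by (rule theI')
  then show "tensor_sum I f K \<in> completed_tensor I"
    by blast
  show "\<forall>\<^sub>F F in finite_subsets_at_top K. \<forall>i. absv ((\<Sum>k\<in>F. f k i) - tensor_sum I f K i) < e" if "e > 0"
    using P that by (auto simp: uniform_limit_iff dist_absv)
qed

section \<open>Roots of polynomials and algebraic closedness\<close>

lemma prod_linear_factors_dvd:
  fixes p :: "'b::field poly"
  assumes "finite V" "\<And>v. v \<in> V \<Longrightarrow> poly p v = 0"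
  shows "(\<Prod>v\<in>V. [:- v, 1:]) dvd p"
  using assms
proof (induction V arbitrary: p rule: finite_induct)
  case (insert v V)
  then obtain s where s: "p = [:- v, 1:] * s"
    by (metis insertI1 poly_eq_0_iff_dvd dvdE)
  have "poly s w = 0" if "w \<in> V" for w
    using insert.prems[of w] insert.hyps that by (auto simp: s)
  then have "(\<Prod>v\<in>V. [:- v, 1:]) dvd s"
    by (rule insert.IH)
  then show ?case
    using insert.hyps unfolding s by (simp add: mult_dvd_mono del: mult_pCons_left)
qed auto

lemma degree_prod_linear_factors:
  "finite V \<Longrightarrow> Polynomial.degree (\<Prod>v\<in>V. [:- v, 1:]) = card (V :: 'b::field set)"
  by (subst degree_prod_eq_sum_degree) auto

text \<open>A root of the cofactor left after removing all distinct roots would be a double root,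
  hence a zero of the derivative; so the cofactor is constant.\<close>

lemma separable_poly_splits:
  fixes p :: "'b::field poly"
  assumes closed: "\<And>p :: 'b poly. Polynomial.degree p > 0 \<Longrightarrow> \<exists>x. poly p x = 0"
    and "p \<noteq> 0" and sep: "\<And>x. poly p x = 0 \<Longrightarrow> poly (pderiv p) x \<noteq> 0"
  shows "\<exists>c. c \<noteq> 0 \<and> p = Polynomial.smult c (\<Prod>v\<in>{x. poly p x = 0}. [:- v, 1:])"
proof -
  define V where "V = {x. poly p x = 0}"
  define P where "P = (\<Prod>v\<in>V. [:- v, 1:])"
  have fin: "finite V"
    using \<open>p \<noteq> 0\<close> unfolding V_def by (rule poly_roots_finite)
  have "P dvd p"
    unfolding P_def by (rule prod_linear_factors_dvd[OF fin]) (simp add: V_def)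
  then obtain s where s: "p = P * s" ..
  have "Polynomial.degree s = 0"
  proof (rule ccontr)
    assume "Polynomial.degree s \<noteq> 0"
    then obtain w where w: "poly s w = 0"
      using closed[of s] by auto
    then have "w \<in> V"
      by (simp add: V_def s)
    then have "poly P w = 0"
      using fin by (auto simp: P_def poly_prod)
    then have "poly (pderiv p) w = 0"
      using w by (simp add: s pderiv_mult)
    then show False
      using sep \<open>w \<in> V\<close> by (simp add: V_def)
  qed
  then obtain c where c: "s = [:c:]"
    by (rule degree_eq_zeroE)
  then have "c \<noteq> 0"
    using s \<open>p \<noteq> 0\<close> by auto
  then show ?thesis
    using s by (auto simp: c P_def V_def intro!: exI[of _ c])
qed

text \<open>
  Lagrange interpolation at the points of V: the derivative of the product is the common
  denominator, and the sum is the coefficient of degree \<^term>\<open>card V - 1\<close>.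
\<close>

lemma sum_poly_over_roots_eq_0:
  fixes g :: "'b::field poly"
  assumes fin: "finite V" and c: "c \<noteq> 0"
    and deriv: "\<And>v. v \<in> V \<Longrightarrow> poly (pderiv (\<Prod>v\<in>V. [:- v, 1:])) v = c"
    and deg: "Suc (Polynomial.degree g) < card V"
  shows "(\<Sum>v\<in>V. poly g v) = 0"
proof -
  define L where "L v = (\<Prod>w\<in>V - {v}. [:- w, 1:])" for v
  define h where "h = (\<Sum>v\<in>V. Polynomial.smult (poly g v) (L v))"
  have degL: "Polynomial.degree (L v) = card V - 1" if "v \<in> V" for v
    unfolding L_def using fin that by (subst degree_prod_linear_factors) auto
  have degh: "Polynomial.degree h \<le> card V - 1"
    unfolding h_def
    by (rule degree_sum_le[OF fin]) (metis degL degree_smult_le)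
  have L0: "poly (L v) u = 0" if "u \<in> V" "u \<noteq> v" for u v
    unfolding L_def poly_prod using fin that by (intro prod_zero) auto
  have Lc: "poly (L u) u = c" if "u \<in> V" for u
  proof -
    have "c = (\<Sum>v\<in>V. poly (L v) u)"
      using deriv[OF that] by (simp add: pderiv_prod poly_sum L_def pderiv_pCons)
    also have "\<dots> = (\<Sum>v\<in>V. if v = u then poly (L u) u else 0)"
      by (rule sum.cong) (use L0[OF that] in auto)
    also have "\<dots> = poly (L u) u"
      using fin that by simp
    finally show ?thesis by simp
  qed
  have "Polynomial.smult c g = h"
  proof (rule poly_eqI_degree)
    show "poly (Polynomial.smult c g) u = poly h u" if "u \<in> V" for u
    proof -
      have "poly h u = (\<Sum>v\<in>V. if v = u then poly g u * c else 0)"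
        unfolding h_def poly_sum by (rule sum.cong) (use L0[OF that] Lc[OF that] in auto)
      then show ?thesis
        using fin that by simp
    qed
    show "card V > Polynomial.degree (Polynomial.smult c g)"
      using deg by (meson Suc_lessD degree_smult_le order_le_less_trans)
    show "card V > Polynomial.degree h"
      using degh deg by linarith
  qed
  moreover have "poly.coeff g (card V - 1) = 0"
    using deg by (intro coeff_eq_0) auto
  moreover have "poly.coeff (L v) (card V - 1) = 1" if "v \<in> V" for v
    using lead_coeff_prod[of "\<lambda>w. [:- w, 1:]" "V - {v}"] degL[OF that] by (simp add: L_def)
  then have "poly.coeff h (card V - 1) = (\<Sum>v\<in>V. poly g v)"
    unfolding h_def by (simp add: coeff_sum)
  ultimately show ?thesis
    by (metis coeff_smult mult_zero_right)
qed

section \<open>Power maps and binomial coefficients over the finite field\<close>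

lemma card_field_gt_1: "1 < CARD('a::{finite, field})"
proof -
  have "card {0, 1 :: 'a} \<le> CARD('a)"
    by (rule card_mono) auto
  then show ?thesis by simp
qed

lemma finite_field_power_card: "(x :: 'a::{finite, field}) ^ CARD('a) = x"
proof (cases "x = 0")
  case True
  then show ?thesis
    using card_field_gt_1[where 'a = 'a] by (simp add: power_0_left)
next
  case False
  have "(\<Prod>y\<in>UNIV-{0}. x * y) = (\<Prod>y\<in>UNIV-{0}. y)"
    by (rule prod.reindex_bij_witness[of _ "\<lambda>y. y / x" "\<lambda>y. x * y"]) (use False in auto)
  then have "x ^ (CARD('a) - 1) * \<Prod>(UNIV - {0}) = 1 * \<Prod>(UNIV - {0} :: 'a set)"
    by (simp add: prod.distrib)
  moreover have "\<Prod>(UNIV - {0} :: 'a set) \<noteq> 0"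
    by auto
  ultimately have "x ^ (CARD('a) - 1) = 1"
    by (metis mult_right_cancel)
  then show ?thesis
    using card_field_gt_1[where 'a = 'a] by (metis One_nat_def Suc_pred less_trans mult.right_neutral power_Suc zero_less_one)
qed

text \<open>
  The polynomial \<open>(x + 1)^q - x^q - 1\<close> has degree less than q and vanishes at all q points.
\<close>

lemma of_nat_card_choose_eq_0:
  assumes "0 < k" "k < CARD('a::{finite, field})"
  shows "of_nat (CARD('a) choose k) = (0 :: 'a)"
proof -
  let ?q = "CARD('a)"
  define p :: "'a poly" where "p = (\<Sum>k\<in>{1..<?q}. Polynomial.monom (of_nat (?q choose k)) k)"
  have q: "0 < ?q"
    using assms by simp
  have "p = 0"
  proof (rule poly_eqI_degree)
    show "poly p x = poly 0 x" if "x \<in> UNIV" for x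
    proof -
      have "(x + 1) ^ ?q = (\<Sum>k\<le>?q. of_nat (?q choose k) * x ^ k)"
        using binomial_ring[of x 1 ?q] by simp
      also have "{..?q} = insert 0 (insert ?q {1..<?q})"
        using q by auto
      also have "(\<Sum>k\<in>\<dots>. of_nat (?q choose k) * x ^ k) = 1 + (x ^ ?q + poly p x)"
        using q by (simp add: p_def poly_sum poly_monom)
      finally show ?thesis
        by (simp add: finite_field_power_card)
    qed
    have "Polynomial.degree p \<le> ?q - 1"
      unfolding p_def by (rule degree_sum_le) (auto intro: order_trans[OF degree_monom_le])
    then show "card (UNIV :: 'a set) > Polynomial.degree p"
      using q by linarith
  qed (use q in auto)
  moreover have "poly.coeff p k = of_nat (?q choose k)"
    using assms by (simp add: p_def coeff_sum)
  ultimately show ?thesis by simp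
qed

section \<open>Algebraic closedness of the completion\<close>

lemma absv_prod_mset_ge:
  assumes "\<And>x. x \<in># A \<Longrightarrow> m \<le> absv (f x :: 'c::ultrametric_field)" "0 \<le> m"
  shows "m ^ size A \<le> absv (\<Prod>x\<in>#A. f x)"
  using assms by (induction A) (auto simp: absv_mult absv_nonneg intro!: mult_mono)

lemma absv_poly_diff_le:
  fixes p p' :: "'c::ultrametric_field poly"
  assumes "\<And>i. absv (poly.coeff p i - poly.coeff p' i) \<le> d"
    and "absv z \<le> H" "1 \<le> H" "Polynomial.degree p \<le> n" "Polynomial.degree p' \<le> n"
  shows "absv (poly p z - poly p' z) \<le> d * H ^ n"
proof -
  have d: "0 \<le> d"
    using assms(1)[of 0] absv_nonneg order_trans by blast
  have "Polynomial.degree (p - p') \<le> n"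
    using assms by (intro degree_diff_le)
  then have "poly (p - p') z = (\<Sum>i\<le>n. poly.coeff (p - p') i * z ^ i)"
    unfolding poly_altdef by (intro sum.mono_neutral_left) (auto simp del: coeff_diff intro: coeff_eq_0)
  moreover have "absv (poly.coeff (p - p') i * z ^ i) \<le> d * H ^ n" if "i \<le> n" for i
  proof -
    have "absv z ^ i \<le> H ^ i"
      using assms by (intro power_mono) (auto simp: absv_nonneg)
    also have "\<dots> \<le> H ^ n"
      using assms that by (intro power_increasing) auto
    finally show ?thesis
      using assms(1)[of i] d by (auto simp: absv_mult absv_power intro!: mult_mono zero_le_power absv_nonneg)
  qed
  ultimately show ?thesis
    using d assms by (auto intro!: absv_sum_le)
qed

text \<open>If z were larger than \<open>H\<close>, the leading term would exceed every other term
  of the polynomial.\<close>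

lemma absv_root_le:
  fixes p :: "'c::ultrametric_field poly"
  assumes "Polynomial.lead_coeff p = 1" "poly p z = 0" "0 < Polynomial.degree p"
    and "\<And>i. absv (poly.coeff p i) \<le> H" "1 \<le> H"
  shows "absv z \<le> H"
proof (rule ccontr)
  assume z: "\<not> absv z \<le> H"
  obtain n where n: "Polynomial.degree p = Suc n"
    using assms(3) gr0_implies_Suc by blast
  have "poly p z = z ^ Suc n + (\<Sum>i\<le>n. poly.coeff p i * z ^ i)"
    using assms(1) by (simp add: poly_altdef n)
  then have "z ^ Suc n = - (\<Sum>i\<le>n. poly.coeff p i * z ^ i)"
    using assms(2) by (simp add: eq_neg_iff_add_eq_0)
  then have "absv z ^ Suc n = absv (\<Sum>i\<le>n. poly.coeff p i * z ^ i)"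
    by (metis absv_minus absv_power)
  also have "\<dots> \<le> H * absv z ^ n"
  proof (rule absv_sum_le)
    fix i assume "i \<in> {..n}"
    then have "absv z ^ i \<le> absv z ^ n"
      using z assms by (intro power_increasing) auto
    then show "absv (poly.coeff p i * z ^ i) \<le> H * absv z ^ n"
      using assms(4)[of i] assms(5) by (auto simp: absv_mult absv_power intro!: mult_mono zero_le_power absv_nonneg)
  qed (use assms in \<open>auto simp: absv_nonneg\<close>)
  also have "\<dots> < absv z * absv z ^ n"
    using z assms by (intro mult_strict_right_mono zero_less_power) auto
  finally show False by simp
qed

context C_infinity
begin

lemma map_poly_j_add: "map_poly j (p + p') = map_poly j p + map_poly j p'"
  by (rule poly_eqI) (simp add: coeff_map_poly j_zero j_add)

lemma map_poly_j_smult: "map_poly j (Polynomial.smult c p) = Polynomial.smult (j c) (map_poly j p)"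
  by (rule poly_eqI) (simp add: coeff_map_poly j_zero j_mult)

lemma map_poly_j_pCons: "map_poly j (pCons c p) = pCons (j c) (map_poly j p)"
  by (rule poly_eqI) (simp add: coeff_map_poly j_zero coeff_pCons split: nat.splits)

lemma j_minus: "j (- x) = - j x"
  by (metis add_eq_0_iff j_add j_zero)

lemma map_poly_j_diff: "map_poly j (p - p') = map_poly j p - map_poly j p'"
  by (metis add_diff_cancel_right' diff_add_cancel map_poly_j_add)

lemma poly_map_poly_j_prod:
  "poly (map_poly j (\<Prod>x\<in>#A. [:- x, 1:])) z = (\<Prod>x\<in>#A. z - j x)"
proof (induction A)
  case empty
  then show ?case
    by (simp add: map_poly_1 j_zero j_one)
next
  case (add x A)
  then show ?case
    by (simp add: map_poly_j_diff map_poly_j_smult map_poly_j_pCons j_minus j_zero algebra_simps)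
qed

lemma j_eq_0_iff: "j x = 0 \<longleftrightarrow> x = 0"
  by (metis j_mult j_one j_zero mult_zero_left right_inverse zero_neq_one)

text \<open>Over the algebraic closure g splits, so the absolute value of g at z is the product of
  the distances from z to the roots; the nearest root serves as w.\<close>

lemma near_root:
  assumes "Polynomial.lead_coeff g = 1" "0 < Polynomial.degree g"
  shows "\<exists>w. poly (map_poly j g) w = 0 \<and> absv (z - w) ^ Polynomial.degree g \<le> absv (poly (map_poly j g) z)"
proof -
  obtain A where A: "size A = Polynomial.degree g" "g = (\<Prod>x\<in>#A. [:- x, 1:])"
    using alg_closed_imp_factorization[of g] assms by (metis leading_coeff_0_iff smult_1_left zero_neq_one)
  define m where "m = Min ((\<lambda>x. absv (z - j x)) ` set_mset A)"
  have ne: "set_mset A \<noteq> {}"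
    using A assms by auto
  then have "m \<in> (\<lambda>x. absv (z - j x)) ` set_mset A"
    unfolding m_def by (intro Min_in) auto
  then obtain x where x: "x \<in># A" "m = absv (z - j x)"
    by blast
  have "m ^ size A \<le> absv (\<Prod>x\<in>#A. z - j x)"
  proof (rule absv_prod_mset_ge)
    show "m \<le> absv (z - j y)" if "y \<in># A" for y
      unfolding m_def using that by (intro Min_le) auto
  qed (simp add: x absv_nonneg)
  moreover have "poly (map_poly j g) (j x) = 0"
    unfolding A(2) poly_map_poly_j_prod using x(1) by (simp add: prod_mset_zero_iff)
  ultimately show ?thesis
    unfolding A(2)[symmetric] using x A(1) by (metis A(2) poly_map_poly_j_prod)
qed

lemma poly_approx:
  assumes "Polynomial.lead_coeff (f :: 'c poly) = 1" "0 < Polynomial.degree f" "0 < d"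
  shows "\<exists>g. Polynomial.lead_coeff g = 1 \<and> Polynomial.degree g = Polynomial.degree f \<and>
    (\<forall>i. absv (poly.coeff (map_poly j g) i - poly.coeff f i) \<le> d)"
proof -
  have "\<exists>x. absv (j x - y) < d" for y
    using closure_approachable[of y "range j"] dense \<open>0 < d\<close> by (auto simp: dist_absv)
  then obtain h where h: "\<And>y. absv (j (h y) - y) < d"
    by metis
  let ?n = "Polynomial.degree f"
  define g where "g = Polynomial.monom 1 ?n + (\<Sum>i<?n. Polynomial.monom (h (poly.coeff f i)) i)"
  have coeff: "poly.coeff g i = (if i = ?n then 1 else if i < ?n then h (poly.coeff f i) else 0)" for i
    by (simp add: g_def coeff_sum)
  then have deg: "Polynomial.degree g = ?n"
    by (intro order_antisym degree_le le_degree) auto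
  moreover have "absv (poly.coeff (map_poly j g) i - poly.coeff f i) \<le> d" for i
    using h[of "poly.coeff f i"] assms(1,3)
    by (auto simp: coeff_map_poly j_zero coeff j_one coeff_eq_0 less_imp_le)
  ultimately show ?thesis
    by (intro exI[of _ g]) (auto simp: coeff)
qed

text \<open>Monic approximants with coefficients in the algebraic closure have roots. Choosing each
  time a root of the next approximant near the previous root gives a Cauchy sequence, and its limit
  is a root of f.\<close>

lemma monic_poly_has_root:
  fixes f :: "'c poly"
  assumes lc: "Polynomial.lead_coeff f = 1" and deg: "0 < Polynomial.degree f"
  shows "\<exists>z. poly f z = 0"
proof -
  define d where "d = Polynomial.degree f"
  \<comment> \<open>\<open>H\<close> will bound the coefficients of every approximant too, as these
    differ from those of f by at most 1; hence all their roots lie in one ball.\<close>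
  define H where "H = Max (insert 1 ((\<lambda>i. absv (poly.coeff f i)) ` {..d}))"
  have H1: "1 \<le> H"
    unfolding H_def by (intro Max_ge) auto
  have Hf: "absv (poly.coeff f i) \<le> H" for i
  proof (cases "i \<le> d")
    case True
    then show ?thesis unfolding H_def by (intro Max_ge) auto
  next
    case False
    then show ?thesis using H1 by (simp add: d_def coeff_eq_0)
  qed
  \<comment> \<open>On the ball of radius \<open>H\<close>, polynomials with coefficients
    \<open>e n\<close> apart have values at most \<open>e n * H ^ d\<close> apart. The choice makes
    this the d-th power of 2^(-n), matching the d-th power in \<open>near_root\<close>.\<close>
  define e where "e n = ((1/2) ^ n) ^ d / H ^ d" for n :: nat
  have e: "0 < e n" "e n \<le> 1" "e n * H ^ d = ((1/2) ^ n) ^ d" for n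
    using H1 by (auto simp: e_def divide_le_eq power_le_one intro: order_trans[of _ 1] one_le_power)
  have e_mono: "e (Suc n) \<le> e n" for n
    using H1 unfolding e_def by (intro divide_right_mono power_mono) auto
  have "\<exists>g. Polynomial.lead_coeff g = 1 \<and> Polynomial.degree g = d \<and>
    (\<forall>i. absv (poly.coeff (map_poly j g) i - poly.coeff f i) \<le> e n)" for n
    unfolding d_def by (rule poly_approx[OF lc deg e(1)])
  then obtain g where g: "\<And>n. Polynomial.lead_coeff (g n) = 1" "\<And>n. Polynomial.degree (g n) = d"
    "\<And>n i. absv (poly.coeff (map_poly j (g n)) i - poly.coeff f i) \<le> e n"
    by metis
  define G where "G n = map_poly j (g n)" for n
  have G: "Polynomial.degree (G n) = d" "Polynomial.lead_coeff (G n) = 1" for n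
  proof -
    show "Polynomial.degree (G n) = d"
      unfolding G_def by (subst degree_map_poly) (auto simp: g j_eq_0_iff)
    then show "Polynomial.lead_coeff (G n) = 1"
      using g(1,2)[of n] by (simp add: G_def coeff_map_poly j_zero j_one)
  qed
  have "absv (poly.coeff (G n) i) \<le> H" for n i
    using absv_diff[of "poly.coeff (G n) i - poly.coeff f i" "- poly.coeff f i"] g(3)[of n i] Hf[of i]
      e(2)[of n] H1 by (simp add: G_def)
  then have root_le: "absv z \<le> H" if "poly (G n) z = 0" for z n
    using G deg H1 that by (intro absv_root_le[of "G n" z]) (auto simp: d_def)
  have "\<exists>z. \<forall>n. poly (G n) (z n) = 0 \<and> absv (z n - z (Suc n)) ^ d \<le> absv (poly (G (Suc n)) (z n))"
  proof (rule dependent_nat_choice)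
    show "\<exists>z. poly (G 0) z = 0"
      using near_root[of "g 0"] g(1,2)[of 0] deg by (auto simp: G_def d_def)
    show "\<exists>w. poly (G (Suc n)) w = 0 \<and> absv (z - w) ^ d \<le> absv (poly (G (Suc n)) z)" for z n
      using near_root[of "g (Suc n)" z] g(1,2)[of "Suc n"] deg by (auto simp: G_def d_def)
  qed
  then obtain z where z: "\<And>n. poly (G n) (z n) = 0"
    "\<And>n. absv (z n - z (Suc n)) ^ d \<le> absv (poly (G (Suc n)) (z n))"
    by blast
  have step: "absv (z (Suc n) - z n) \<le> (1/2) ^ n" for n
  proof -
    have "absv (poly (G (Suc n)) (z n) - poly (G n) (z n)) \<le> e n * H ^ d"
    proof (rule absv_poly_diff_le)
      show "absv (poly.coeff (G (Suc n)) i - poly.coeff (G n) i) \<le> e n" for i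
        using absv_diff_trans[of "poly.coeff (G (Suc n)) i" "poly.coeff (G n) i" "poly.coeff f i"]
          g(3)[of "Suc n" i] g(3)[of n i] e_mono[of n] absv_diff_commute[of "poly.coeff f i"]
        by (simp add: G_def)
    qed (use root_le z H1 G in auto)
    then have "absv (z n - z (Suc n)) ^ d \<le> ((1/2) ^ n) ^ d"
      using z(2)[of n] z(1)[of n] by (simp add: e(3))
    then have "absv (z n - z (Suc n)) \<le> (1/2) ^ n"
      using deg by (subst (asm) power_mono_iff) (auto simp: d_def absv_nonneg)
    then show ?thesis
      by (simp add: absv_diff_commute)
  qed
  have half: "(\<lambda>n. (1/2 :: real) ^ n) \<longlonglongrightarrow> 0"
    by (intro LIMSEQ_power_zero) auto
  have "Cauchy z"
    by (rule Cauchy_ultrametricI)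
      (rule tendsto_sandwich[OF _ _ tendsto_const half], use step in \<open>auto simp: absv_nonneg\<close>)
  then obtain w where w: "z \<longlonglongrightarrow> w"
    using Cauchy_convergent_iff convergent_def by blast
  have "(\<lambda>n. poly p (z n)) \<longlonglongrightarrow> poly p w" for p
    by (induction p) (auto intro!: tendsto_intros w)
  then have lim: "(\<lambda>n. poly f (z n)) \<longlonglongrightarrow> poly f w" .
  have "absv (poly f (z n) - 0) \<le> (1/2) ^ n" for n
  proof -
    have "absv (poly (G n) (z n) - poly f (z n)) \<le> e n * H ^ d"
      by (rule absv_poly_diff_le) (use root_le z H1 G g(3) in \<open>auto simp: d_def G_def\<close>)
    also have "\<dots> \<le> (1/2) ^ n"
      unfolding e(3) using deg power_decreasing[of 1 d "(1/2 :: real) ^ n"]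
      by (simp add: d_def power_le_one)
    finally show ?thesis
      by (simp add: z)
  qed
  then have "(\<lambda>n. poly f (z n)) \<longlonglongrightarrow> 0"
    by (intro tendsto_by_bound[OF half] always_eventually allI)
  then show ?thesis
    using lim LIMSEQ_unique by blast
qed

lemma poly_has_root:
  fixes f :: "'c poly"
  assumes deg: "0 < Polynomial.degree f"
  shows "\<exists>z. poly f z = 0"
proof -
  have "Polynomial.lead_coeff f \<noteq> 0"
    using deg by auto
  then show ?thesis
    using monic_poly_has_root[of "Polynomial.smult (inverse (Polynomial.lead_coeff f)) f"] deg by auto
qed

section \<open>The q-power map on the completion and its fixed constants\<close>

lemma Fq_to_C_hom:
  "Fq_to_C j (x + y) = Fq_to_C j x + Fq_to_C j y" "Fq_to_C j (x * y) = Fq_to_C j x * Fq_to_C j y"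
  "Fq_to_C j 0 = 0" "Fq_to_C j 1 = 1"
  by (simp_all add: Fq_to_C_def K_to_C_def j_zero j_one flip: j_add j_mult to_ac_add to_ac_mult fls_plus_const fls_const_mult_const)

lemma of_nat_card_choose_C:
  assumes "0 < k" "k < CARD('a)"
  shows "of_nat (CARD('a) choose k) = (0 :: 'c)"
proof -
  have "Fq_to_C j (of_nat n) = of_nat n" for n
    by (induction n) (auto simp: Fq_to_C_hom)
  then show ?thesis
    using of_nat_card_choose_eq_0[OF assms] by (metis Fq_to_C_hom(3))
qed

lemma frobenius_add:
  fixes x y :: 'c
  shows "(x + y) ^ (CARD('a) ^ i) = x ^ (CARD('a) ^ i) + y ^ (CARD('a) ^ i)"
proof -
  let ?q = "CARD('a)"
  have q: "(x + y) ^ ?q = x ^ ?q + y ^ ?q" for x y :: 'c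
  proof -
    have "(x + y) ^ ?q = (\<Sum>k\<le>?q. of_nat (?q choose k) * x ^ k * y ^ (?q - k))"
      by (rule binomial_ring)
    also have "\<dots> = (\<Sum>k\<in>{0, ?q}. of_nat (?q choose k) * x ^ k * y ^ (?q - k))"
      using of_nat_card_choose_C by (intro sum.mono_neutral_right) auto
    finally show ?thesis
      using card_field_gt_1[where 'a = 'a] by (simp add: add.commute)
  qed
  show ?thesis
    by (induction i arbitrary: x y) (auto simp: q power_mult)
qed

lemma frobenius_zero [simp]: "(0 :: 'c) ^ (CARD('a) ^ i) = 0"
  using card_field_gt_1[where 'a = 'a] by (simp add: power_0_left)

lemma frobenius_minus: "(- (x :: 'c)) ^ (CARD('a) ^ i) = - (x ^ (CARD('a) ^ i))"
  using frobenius_add[of x "- x" i] by (simp add: eq_neg_iff_add_eq_0 add.commute)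

lemma frobenius_diff: "(x - y :: 'c) ^ (CARD('a) ^ i) = x ^ (CARD('a) ^ i) - y ^ (CARD('a) ^ i)"
  using frobenius_add[of x "- y" i] by (simp add: frobenius_minus)

lemma frobenius_sum: "(sum f A :: 'c) ^ (CARD('a) ^ i) = (\<Sum>x\<in>A. f x ^ (CARD('a) ^ i))"
  by (induction A rule: infinite_finite_induct) (auto simp: frobenius_add)

lemma frobenius_Fq: "Fq_to_C j c ^ (CARD('a) ^ i) = Fq_to_C j c"
proof -
  have "Fq_to_C j (c ^ n) = Fq_to_C j c ^ n" for n
    by (induction n) (auto simp: Fq_to_C_hom)
  then have "Fq_to_C j c ^ CARD('a) = Fq_to_C j c"
    by (metis finite_field_power_card)
  then show ?thesis
    by (induction i) (auto simp: power_mult)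
qed

end

section \<open>The exponential and its local inversion\<close>

lemma A_to_K_pCons: "A_to_K (pCons c p) = fls_const c + fls_X_inv * A_to_K p"
  by (simp add: A_to_K_def map_poly_pCons)

lemma A_to_K_nth: "fls_nth (A_to_K a) m = (if m \<le> 0 then poly.coeff a (nat (- m)) else 0)"
proof (induction a arbitrary: m)
  case 0
  then show ?case by (simp add: A_to_K_def)
next
  case (pCons c a)
  have "nat (- m) = Suc (nat (- (m + 1)))" if "m < 0"
    using that by simp
  then show ?case
    by (auto simp: A_to_K_pCons pCons.IH fls_X_inv_times_conv_shift coeff_pCons split: nat.splits)
qed

lemma A_to_K_add: "A_to_K (a + b) = A_to_K a + A_to_K b"
  by (rule fls_eqI) (simp add: A_to_K_nth)

lemma A_to_K_smult: "A_to_K (Polynomial.smult c a) = fls_const c * A_to_K a"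
  by (rule fls_eqI) (simp add: A_to_K_nth)

lemma A_to_K_const: "A_to_K [:c:] = fls_const c"
  by (rule fls_eqI) (auto simp: A_to_K_nth coeff_pCons split: nat.splits)

lemma A_to_K_mult: "A_to_K (a * b) = A_to_K a * A_to_K b"
proof (induction a)
  case 0
  then show ?case by (simp add: A_to_K_def)
next
  case (pCons c a)
  have "A_to_K (pCons c a * b) = A_to_K (Polynomial.smult c b) + A_to_K (pCons 0 (a * b))"
    by (simp add: A_to_K_add)
  then show ?case
    by (simp add: A_to_K_smult A_to_K_pCons pCons.IH algebra_simps)
qed

lemma sums_mult_topological:
  fixes f :: "nat \<Rightarrow> 'b::{topological_semigroup_mult, semiring_0}"
  assumes "f sums s"
  shows "(\<lambda>n. c * f n) sums (c * s)"
  using tendsto_mult[OF tendsto_const assms[unfolded sums_def], of c]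
  by (simp add: sums_def sum_distrib_left)

text \<open>Needed because multiplication by tau^i on the left moves a coefficient i places
  up.\<close>

lemma sums_shift_zeros:
  fixes f :: "nat \<Rightarrow> 'b::{comm_monoid_add, topological_space}"
  assumes "f sums s"
  shows "(\<lambda>n. if i \<le> n then f (n - i) else 0) sums s"
proof -
  have "(\<Sum>n<N + i. if i \<le> n then f (n - i) else 0) = (\<Sum>n<N. f n)" for N
    by (induction N) auto
  then have "(\<lambda>N. \<Sum>n<N + i. if i \<le> n then f (n - i) else 0) \<longlonglongrightarrow> s"
    using assms by (simp only: sums_def)
  then show ?thesis
    unfolding sums_def by (rule LIMSEQ_offset)
qed

context C_infinity
begin

lemma K_to_C_hom:
  "K_to_C j (x + y) = K_to_C j x + K_to_C j y" "K_to_C j (x * y) = K_to_C j x * K_to_C j y"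
  "K_to_C j 0 = 0" "K_to_C j 1 = 1"
  by (simp_all add: K_to_C_def j_zero j_one flip: j_add j_mult)

lemma K_to_C_minus: "K_to_C j (- x) = - K_to_C j x"
  by (simp add: K_to_C_def j_minus)

lemma K_to_C_diff: "K_to_C j (x - y) = K_to_C j x - K_to_C j y"
  using K_to_C_hom(1)[of x "- y"] by (simp add: K_to_C_minus)

lemma K_to_C_sum: "K_to_C j (sum f A) = (\<Sum>x\<in>A. K_to_C j (f x))"
  by (induction A rule: infinite_finite_induct) (auto simp: K_to_C_hom)

lemma absv_K_to_C: "absv (K_to_C j b) = abs_K b"
  by (simp add: K_to_C_def absv_j)

lemma A_to_C_hom:
  "A_to_C j (a + b) = A_to_C j a + A_to_C j b" "A_to_C j (a * b) = A_to_C j a * A_to_C j b"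
  "A_to_C j [:c:] = Fq_to_C j c" "A_to_C j 0 = 0" "A_to_C j 1 = 1"
  using A_to_K_const[of "0 :: 'a"] A_to_K_const[of "1 :: 'a"]
  by (auto simp: A_to_C_def A_to_K_add A_to_K_mult A_to_K_const K_to_C_hom Fq_to_C_def one_pCons)

lemma absv_Fq_to_C: "absv (Fq_to_C j c) = (if c = 0 then 0 else 1)"
  by (simp add: Fq_to_C_def absv_K_to_C abs_K_def)

text \<open>Frobenius is additive, so the outer twist passes through the inner sum; what is left is
  the reindexing of a sum over triples with fixed total.\<close>

lemma skew_mult_assoc:
  fixes f g h :: "'c fps"
  shows "skew_mult CARD('a) (skew_mult CARD('a) f g) h = skew_mult CARD('a) f (skew_mult CARD('a) g h)"
proof (rule fps_ext)
  fix n
  let ?q = "CARD('a)"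
  let ?t = "\<lambda>i k l. fps_nth f i * fps_nth g k ^ (?q ^ i) * fps_nth h l ^ (?q ^ (i + k))"
  have "fps_nth (skew_mult ?q (skew_mult ?q f g) h) n = (\<Sum>m=0..n. \<Sum>i=0..m. ?t i (m - i) (n - m))"
    by (simp add: skew_mult_def sum_distrib_right atMost_atLeast0)
  also have "\<dots> = (\<Sum>m=0..n. \<Sum>i=0..n - m. ?t m i (n - m - i))"
    by (rule fps_mult_assoc_lemma)
  also have "\<dots> = fps_nth (skew_mult ?q f (skew_mult ?q g h)) n"
    by (simp add: skew_mult_def frobenius_sum sum_distrib_left atMost_atLeast0
        power_mult_distrib mult.assoc power_add mult.commute flip: power_mult)
  finally show "fps_nth (skew_mult ?q (skew_mult ?q f g) h) n = fps_nth (skew_mult ?q f (skew_mult ?q g h)) n" .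
qed

lemma skew_mult_add_left:
  "skew_mult CARD('a) (f + g) h = skew_mult CARD('a) f h + skew_mult CARD('a) g (h :: 'c fps)"
  by (rule fps_ext) (simp add: skew_mult_def algebra_simps sum.distrib)

lemma skew_mult_add_right:
  "skew_mult CARD('a) f (g + h) = skew_mult CARD('a) f g + skew_mult CARD('a) f (h :: 'c fps)"
  by (rule fps_ext) (simp add: skew_mult_def algebra_simps sum.distrib frobenius_add)

lemma skew_mult_const_right:
  "fps_nth (skew_mult CARD('a) f (fps_const (c :: 'c))) n = fps_nth f n * c ^ (CARD('a) ^ n)"
proof -
  have "(\<Sum>i\<le>n. fps_nth f i * (if n - i = 0 then c else 0) ^ CARD('a) ^ i)
      = (\<Sum>i\<le>n. if i = n then fps_nth f n * c ^ (CARD('a) ^ n) else 0)"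
    by (rule sum.cong) auto
  then show ?thesis
    by (simp add: skew_mult_def)
qed

lemma skew_mult_const_left:
  "fps_nth (skew_mult CARD('a) (fps_const (c :: 'c)) f) n = c * fps_nth f n"
proof -
  have "(\<Sum>i\<le>n. (if i = 0 then c else 0) * fps_nth f (n - i) ^ CARD('a) ^ i)
      = (\<Sum>i\<le>n. if i = 0 then c * fps_nth f n else 0)"
    by (rule sum.cong) auto
  then show ?thesis
    by (simp add: skew_mult_def)
qed

text \<open>These differences are the denominators in the recursion for exp; theta^(q^n) strictly
  dominates theta.\<close>

lemma absv_theta_power_diff: "n > 0 \<Longrightarrow> absv (theta_C j ^ (CARD('a) ^ n) - theta_C j) = real CARD('a) ^ (CARD('a) ^ n)"
proof -
  assume "n > 0"
  then have "CARD('a) ^ 0 < CARD('a) ^ n"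
    using card_field_gt_1[where 'a = 'a] by (intro power_strict_increasing) auto
  then have "real CARD('a) ^ 1 < real CARD('a) ^ (CARD('a) ^ n)"
    using card_field_gt_1[where 'a = 'a] by (intro power_strict_increasing) auto
  then show ?thesis
    using absv_add_eq[of "- theta_C j" "theta_C j ^ (CARD('a) ^ n)"] by (simp add: absv_power absv_theta)
qed

end

locale drinfeld = C_infinity j
  for j :: "'a::{finite, field} fls alg_closure \<Rightarrow> 'c::{ultrametric_field, complete_space}" +
  fixes \<phi> :: "'a poly \<Rightarrow> 'c poly"
  assumes drinfeld: "drinfeld_module j \<phi>"
begin

abbreviation rk :: nat where "rk \<equiv> drinfeld_rank \<phi>"

abbreviation T :: 'c where "T \<equiv> theta_C j"

definition theta_coeff :: "nat \<Rightarrow> 'c" where "theta_coeff i = poly.coeff (\<phi> [:0, 1:]) i"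

lemma \<phi>_add: "\<phi> (a + b) = \<phi> a + \<phi> b"
  and \<phi>_mult: "fps_of_poly (\<phi> (a * b)) = skew_mult CARD('a) (fps_of_poly (\<phi> a)) (fps_of_poly (\<phi> b))"
  and \<phi>_const: "\<phi> [:c:] = [:Fq_to_C j c:]"
  and theta_coeff_0: "theta_coeff 0 = T"
  and \<phi>_nontrivial: "\<exists>a. \<phi> a \<noteq> [:A_to_C j a:]"
  using drinfeld by (auto simp: drinfeld_module_def theta_coeff_def)

lemma theta_coeff_eq_0: "i > rk \<Longrightarrow> theta_coeff i = 0"
  by (simp add: theta_coeff_def drinfeld_rank_def coeff_eq_0)

lemma pCons_eq: "pCons c a = [:c:] + [:0, 1:] * (a :: 'a poly)"
  by simp

text \<open>If \<open>\<phi>\<close> at theta were the constant theta, multiplicativity would force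
  every \<open>\<phi> a\<close> to be the constant a, against nontriviality.\<close>

lemma rk_pos: "rk > 0"
proof (rule ccontr)
  assume "\<not> rk > 0"
  then have theta: "\<phi> [:0, 1:] = [:T:]"
    using theta_coeff_0 by (intro poly_eqI) (auto simp: coeff_pCons theta_coeff_def[symmetric] theta_coeff_eq_0 split: nat.splits)
  have "\<phi> a = [:A_to_C j a:]" for a
  proof (induction a)
    case 0
    then show ?case
      using \<phi>_const[of 0] by (simp add: A_to_C_hom Fq_to_C_hom)
  next
    case (pCons c a)
    have "fps_of_poly (\<phi> ([:0, 1:] * a)) = fps_of_poly [:A_to_C j ([:0, 1:] * a):]"
      unfolding \<phi>_mult theta pCons.IH A_to_C_hom
      by (rule fps_ext) (simp add: fps_of_poly_const skew_mult_const_left)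
    then have "\<phi> ([:0, 1:] * a) = [:A_to_C j ([:0, 1:] * a):]"
      by (simp only: fps_of_poly_eq_iff)
    then show ?case
      by (subst (1 2) pCons_eq) (simp only: \<phi>_add \<phi>_const A_to_C_hom add_pCons add_0_right)
  qed
  then show False
    using \<phi>_nontrivial by blast
qed

lemma theta_coeff_rk: "theta_coeff rk \<noteq> 0"
proof -
  have "\<phi> [:0, 1:] \<noteq> 0"
    using theta_coeff_0 theta_neq_0 by (auto simp: theta_coeff_def)
  then show ?thesis
    by (simp add: theta_coeff_def drinfeld_rank_def)
qed

text \<open>
  Comparing the coefficients in \<open>exp \<theta> = \<phi>\<^sub>\<theta> exp\<close> gives the recursion for the coefficients of exp.
\<close>

function exp_coeff :: "nat \<Rightarrow> 'c" where
  "exp_coeff n = (if n = 0 then 1 else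
     (\<Sum>i\<in>{1..n}. theta_coeff i * exp_coeff (n - i) ^ (CARD('a) ^ i)) / (T ^ (CARD('a) ^ n) - T))"
  by auto
termination by (relation "Wellfounded.measure id") auto

declare exp_coeff.simps [simp del]

lemma exp_coeff_0 [simp]: "exp_coeff 0 = 1"
  by (simp add: exp_coeff.simps)

lemma theta_power_neq: "n > 0 \<Longrightarrow> T ^ (CARD('a) ^ n) - T \<noteq> 0"
  using absv_theta_power_diff[of n] card_field_gt_1[where 'a = 'a] by (metis absv_zero of_nat_0_less_iff less_trans zero_less_one zero_less_power less_irrefl)

lemma exp_coeff_rec:
  assumes "n > 0"
  shows "exp_coeff n * (T ^ (CARD('a) ^ n) - T) = (\<Sum>i\<in>{1..n}. theta_coeff i * exp_coeff (n - i) ^ (CARD('a) ^ i))"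
  using assms theta_power_neq[OF assms] by (subst exp_coeff.simps) simp

lemma sum_atMost_split0: "(\<Sum>i\<le>n. g i) = g 0 + (\<Sum>i\<in>{1..n::nat}. g i :: 'c)"
  by (simp add: atMost_atLeast0 sum.atLeast_Suc_atMost)

lemma exp_coeff_functional:
  "exp_coeff n * T ^ (CARD('a) ^ n) = (\<Sum>i\<le>n. theta_coeff i * exp_coeff (n - i) ^ (CARD('a) ^ i))"
proof (cases "n = 0")
  case True
  then show ?thesis
    by (simp add: theta_coeff_0)
next
  case False
  then show ?thesis
    using exp_coeff_rec[of n] unfolding sum_atMost_split0 by (simp add: theta_coeff_0 algebra_simps)
qed

text \<open>The recursion encodes the equation for theta alone. Constants commute with exp because
  they are fixed by Frobenius, and associativity of the skew product carries the equation to all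
  polynomials.\<close>

lemma exp_series_functional:
  "skew_mult CARD('a) (Abs_fps exp_coeff) (fps_const (A_to_C j a)) =
     skew_mult CARD('a) (fps_of_poly (\<phi> a)) (Abs_fps exp_coeff)"
proof -
  let ?q = "CARD('a)" and ?E = "Abs_fps exp_coeff"
  have const: "skew_mult ?q ?E (fps_const (A_to_C j [:c:])) = skew_mult ?q (fps_of_poly (\<phi> [:c:])) ?E" for c
    by (rule fps_ext) (simp add: \<phi>_const A_to_C_hom fps_of_poly_const skew_mult_const_right
        skew_mult_const_left frobenius_Fq)
  have theta: "skew_mult ?q ?E (fps_const T) = skew_mult ?q (fps_of_poly (\<phi> [:0, 1:])) ?E"
    by (rule fps_ext, unfold skew_mult_const_right) (simp add: exp_coeff_functional skew_mult_def theta_coeff_def)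
  show ?thesis
  proof (induction a)
    case 0
    then show ?case
      using const[of 0] by simp
  next
    case (pCons c a)
    have cmul: "fps_const (x * y) = skew_mult ?q (fps_const x) (fps_const y)" for x y :: 'c
      by (rule fps_ext) (simp add: skew_mult_const_left)
    have "skew_mult ?q ?E (fps_const (A_to_C j ([:0, 1:] * a))) =
        skew_mult ?q (fps_of_poly (\<phi> ([:0, 1:] * a))) ?E"
      unfolding A_to_C_hom cmul skew_mult_assoc[symmetric] theta \<phi>_mult
      unfolding skew_mult_assoc pCons.IH ..
    then show ?case
      unfolding pCons_eq[of c a] A_to_C_hom(1) \<phi>_add fps_of_poly_add fps_const_add[symmetric]
        skew_mult_add_left skew_mult_add_right const by simp
  qed
qed

text \<open>The equation at theta already gives every candidate the same recursion, and the
  denominators are nonzero, so the definite description picks out one series.\<close>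

lemma exp_series_eq: "exp_series j \<phi> = Abs_fps exp_coeff"
  unfolding exp_series_def
proof (rule the_equality)
  show "fps_nth (Abs_fps exp_coeff) 0 = 1 \<and> (\<forall>a. skew_mult CARD('a) (Abs_fps exp_coeff) (fps_const (A_to_C j a)) =
     skew_mult CARD('a) (fps_of_poly (\<phi> a)) (Abs_fps exp_coeff))"
    using exp_series_functional by simp
next
  fix e assume e: "fps_nth e 0 = 1 \<and> (\<forall>a. skew_mult CARD('a) e (fps_const (A_to_C j a)) =
     skew_mult CARD('a) (fps_of_poly (\<phi> a)) e)"
  have rec: "fps_nth e n * T ^ (CARD('a) ^ n) = (\<Sum>i\<le>n. theta_coeff i * fps_nth e (n - i) ^ (CARD('a) ^ i))" for n
    using arg_cong[OF e[THEN conjunct2, rule_format, of "[:0, 1:]"], of "\<lambda>f. fps_nth f n"]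
    unfolding skew_mult_const_right by (simp add: skew_mult_def theta_coeff_def)
  have "fps_nth e n = exp_coeff n" for n
  proof (induction n rule: less_induct)
    case (less n)
    show ?case
    proof (cases "n = 0")
      case True
      then show ?thesis using e by simp
    next
      case False
      have "fps_nth e n * (T ^ (CARD('a) ^ n) - T) = (\<Sum>i\<in>{1..n}. theta_coeff i * fps_nth e (n - i) ^ (CARD('a) ^ i))"
        using rec[of n] unfolding sum_atMost_split0 by (simp add: theta_coeff_0 algebra_simps)
      also have "\<dots> = exp_coeff n * (T ^ (CARD('a) ^ n) - T)"
        using False unfolding exp_coeff_rec[OF False[unfolded neq0_conv]]
        by (intro sum.cong) (auto simp: less.IH)
      finally show ?thesis
        using theta_power_neq[of n] False by simp
    qed
  qed
  then show "e = Abs_fps exp_coeff"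
    by (intro fps_ext) simp
qed

text \<open>The value 1 is inserted so that powers of the bound increase with the exponent. The
  reciprocal is the radius below which exp turns out to be an isometry.\<close>

definition coeff_bound :: real where "coeff_bound = Max (insert 1 ((\<lambda>i. absv (theta_coeff i)) ` {..rk}))"

lemma coeff_bound_ge_1: "1 \<le> coeff_bound"
  unfolding coeff_bound_def by (intro Max_ge) auto

lemma absv_theta_coeff_le: "absv (theta_coeff i) \<le> coeff_bound"
proof (cases "i \<le> rk")
  case True
  then show ?thesis unfolding coeff_bound_def by (intro Max_ge) auto
next
  case False
  then show ?thesis using coeff_bound_ge_1 by (simp add: theta_coeff_eq_0)
qed

text \<open>Each pass through the recursion divides by an element of size q^(q^n) and goes back at
  most \<open>rk\<close> indices. After the Frobenius powers every such gain is again worth q^(q^n),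
  and at least \<open>n div rk\<close> of them accumulate; this decay makes exp entire.\<close>

lemma absv_exp_coeff_le:
  "absv (exp_coeff n) * real CARD('a) ^ ((n div rk) * CARD('a) ^ n) \<le> coeff_bound ^ (CARD('a) ^ n - 1)"
proof (induction n rule: less_induct)
  case (less n)
  let ?q = "CARD('a)"
  have q: "1 < real ?q"
    using card_field_gt_1[where 'a = 'a] by simp
  show ?case
  proof (cases "n = 0")
    case False
    \<comment> \<open>The exponent still to be gained once the outermost denominator is accounted
      for; truncated subtraction gives 0 for n below \<open>rk\<close>.\<close>
    define N where "N = (n div rk - 1) * ?q ^ n"
    have "absv (theta_coeff i * exp_coeff (n - i) ^ (?q ^ i)) * real ?q ^ N \<le> coeff_bound ^ (?q ^ n - 1)" if i: "i \<in> {1..n}" for i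
    proof (cases "i \<le> rk")
      case True
      have qi: "?q ^ (n - i) * ?q ^ i = ?q ^ n"
        using i by (simp flip: power_add)
      have "n div rk \<le> (n - i + rk) div rk"
        using True by (intro div_le_mono) auto
      then have "n div rk - 1 \<le> (n - i) div rk"
        using rk_pos by simp
      then have "N \<le> ((n - i) div rk) * ?q ^ n"
        unfolding N_def by (intro mult_right_mono) auto
      then have "real ?q ^ N \<le> real ?q ^ (((n - i) div rk) * ?q ^ n)"
        using q by (intro power_increasing) auto
      then have "absv (exp_coeff (n - i)) ^ (?q ^ i) * real ?q ^ N
          \<le> absv (exp_coeff (n - i)) ^ (?q ^ i) * real ?q ^ (((n - i) div rk) * ?q ^ n)"
        by (intro mult_left_mono zero_le_power absv_nonneg)
      also have "\<dots> = (absv (exp_coeff (n - i)) * real ?q ^ (((n - i) div rk) * ?q ^ (n - i))) ^ (?q ^ i)"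
        by (simp add: power_mult_distrib mult.assoc qi flip: power_mult)
      also have "\<dots> \<le> (coeff_bound ^ (?q ^ (n - i) - 1)) ^ (?q ^ i)"
        using i by (intro power_mono less.IH) (auto simp: absv_nonneg)
      also have "\<dots> = coeff_bound ^ (?q ^ n - ?q ^ i)"
        by (simp add: diff_mult_distrib qi flip: power_mult)
      finally have "absv (theta_coeff i) * (absv (exp_coeff (n - i)) ^ (?q ^ i) * real ?q ^ N) \<le> coeff_bound * coeff_bound ^ (?q ^ n - ?q ^ i)"
        using absv_theta_coeff_le coeff_bound_ge_1 by (intro mult_mono) (auto simp: absv_nonneg)
      also have "\<dots> = coeff_bound ^ Suc (?q ^ n - ?q ^ i)"
        by simp
      \<comment> \<open>The one extra factor \<open>coeff_bound\<close> is absorbed because i >= 1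
        gives q^i >= 2.\<close>
      also have "\<dots> \<le> coeff_bound ^ (?q ^ n - 1)"
      proof (rule power_increasing[OF _ coeff_bound_ge_1])
        have "?q ^ 1 \<le> ?q ^ i" "?q ^ i \<le> ?q ^ n"
          using i by (intro power_increasing; auto)+
        then show "Suc (?q ^ n - ?q ^ i) \<le> ?q ^ n - 1"
          using card_field_gt_1[where 'a = 'a] unfolding power_one_right by linarith
      qed
      finally show ?thesis
        by (simp add: absv_mult absv_power mult.assoc)
    next
      case False
      then show ?thesis using coeff_bound_ge_1 by (simp add: theta_coeff_eq_0)
    qed
    then have "absv (theta_coeff i * exp_coeff (n - i) ^ (?q ^ i)) \<le> coeff_bound ^ (?q ^ n - 1) / real ?q ^ N" if "i \<in> {1..n}" for i
      using q that by (simp add: pos_le_divide_eq)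
    then have "absv (\<Sum>i\<in>{1..n}. theta_coeff i * exp_coeff (n - i) ^ (?q ^ i)) \<le> coeff_bound ^ (?q ^ n - 1) / real ?q ^ N"
      using coeff_bound_ge_1 by (intro absv_sum_le) auto
    then have "absv (exp_coeff n) * real ?q ^ (?q ^ n) * real ?q ^ N \<le> coeff_bound ^ (?q ^ n - 1)"
      unfolding exp_coeff_rec[OF False[unfolded neq0_conv], symmetric] absv_mult absv_theta_power_diff[OF False[unfolded neq0_conv]]
      using q by (simp add: pos_le_divide_eq)
    moreover have "absv (exp_coeff n) * real ?q ^ ((n div rk) * ?q ^ n) \<le> absv (exp_coeff n) * real ?q ^ (?q ^ n + N)"
      using q unfolding N_def by (intro mult_left_mono power_increasing absv_nonneg) (auto simp: diff_mult_distrib)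
    ultimately show ?thesis
      by (simp add: power_add mult.assoc)
  qed auto
qed

section \<open>The exponential as an entire F_q-linear function\<close>

abbreviation ex :: "'c \<Rightarrow> 'c" where "ex \<equiv> drinfeld_exp j \<phi>"

abbreviation L :: "'c set" where "L \<equiv> period_lattice j \<phi>"

lemma L_iff: "z \<in> L \<longleftrightarrow> ex z = 0"
  by (simp add: period_lattice_def)

lemma absv_exp_term_le: "absv (exp_coeff n * z ^ (CARD('a) ^ n)) \<le> (coeff_bound * absv z / real CARD('a) ^ (n div rk)) ^ (CARD('a) ^ n)"
proof -
  let ?q = "CARD('a)"
  have q: "1 < real ?q"
    using card_field_gt_1[where 'a = 'a] by simp
  have "absv (exp_coeff n) \<le> coeff_bound ^ (?q ^ n - 1) / (real ?q ^ (n div rk)) ^ (?q ^ n)"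
    using absv_exp_coeff_le[of n] q by (simp add: pos_le_divide_eq power_mult)
  also have "\<dots> \<le> coeff_bound ^ (?q ^ n) / (real ?q ^ (n div rk)) ^ (?q ^ n)"
    using coeff_bound_ge_1 q by (intro divide_right_mono power_increasing) auto
  finally have "absv (exp_coeff n) * absv z ^ (?q ^ n) \<le> coeff_bound ^ (?q ^ n) / (real ?q ^ (n div rk)) ^ (?q ^ n) * absv z ^ (?q ^ n)"
    by (intro mult_right_mono zero_le_power absv_nonneg)
  then show ?thesis
    by (simp add: absv_mult absv_power power_mult_distrib power_divide)
qed

lemma exp_sums: "(\<lambda>n. exp_coeff n * z ^ (CARD('a) ^ n)) sums ex z"
proof -
  let ?q = "CARD('a)"
  have q: "1 < real ?q" "1 < ?q"
    using card_field_gt_1[where 'a = 'a] by simp_all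
  \<comment> \<open>From index \<open>k * rk\<close> on, the base of the power in
    \<open>absv_exp_term_le\<close> is at most 1/2.\<close>
  obtain k where k: "2 * (coeff_bound * absv z) < real ?q ^ k"
    using real_arch_pow[OF q(1)] by blast
  have "absv (exp_coeff n * z ^ (?q ^ n)) \<le> (1/2) ^ n" if "n \<ge> k * rk" for n
  proof -
    have "k \<le> n div rk"
      using that rk_pos by (simp add: less_eq_div_iff_mult_less_eq)
    then have "real ?q ^ k \<le> real ?q ^ (n div rk)"
      using q by (intro power_increasing) auto
    then have "2 * (coeff_bound * absv z) \<le> real ?q ^ (n div rk)"
      using k by linarith
    then have "coeff_bound * absv z / real ?q ^ (n div rk) \<le> 1/2"
      using q by (subst pos_divide_le_eq) auto
    then have "(coeff_bound * absv z / real ?q ^ (n div rk)) ^ (?q ^ n) \<le> (1/2) ^ (?q ^ n)"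
      using coeff_bound_ge_1 by (intro power_mono) (auto intro!: divide_nonneg_nonneg mult_nonneg_nonneg absv_nonneg)
    also have "\<dots> \<le> (1/2) ^ n"
      using q less_exp[of n] power_mono[of 2 ?q n] by (intro power_decreasing) (auto intro: order_trans less_imp_le)
    finally show ?thesis
      using absv_exp_term_le[of n z] by linarith
  qed
  then have "\<forall>\<^sub>F n in sequentially. absv (exp_coeff n * z ^ (?q ^ n)) \<le> (1/2) ^ n"
    unfolding eventually_sequentially by blast
  then have "(\<lambda>n. absv (exp_coeff n * z ^ (?q ^ n))) \<longlonglongrightarrow> 0"
    by (intro tendsto_sandwich[OF _ _ tendsto_const LIMSEQ_power_zero[of "1/2 :: real"]])
      (auto simp: absv_nonneg)
  then have "(\<lambda>n. exp_coeff n * z ^ (?q ^ n)) sums (\<Sum>n. exp_coeff n * z ^ (?q ^ n))"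
    by (intro summable_sums summable_ultrametric)
  then show ?thesis
    by (simp add: drinfeld_exp_def exp_series_eq)
qed

lemma exp_unique: "(\<lambda>n. exp_coeff n * z ^ (CARD('a) ^ n)) sums s \<Longrightarrow> ex z = s"
  by (rule sums_unique2[OF exp_sums])

lemma exp_add: "ex (x + y) = ex x + ex y"
  by (rule exp_unique) (use sums_add[OF exp_sums[of x] exp_sums[of y]] in \<open>simp add: frobenius_add algebra_simps\<close>)

lemma exp_zero [simp]: "ex 0 = 0"
  using exp_add[of 0 0] by (metis add_0 add_cancel_right_right)

lemma exp_minus: "ex (- x) = - ex x"
  using exp_add[of x "- x"] by (simp add: eq_neg_iff_add_eq_0 add.commute)

lemma exp_diff: "ex (x - y) = ex x - ex y"
  using exp_add[of x "- y"] by (simp add: exp_minus)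

lemma exp_Fq: "ex (Fq_to_C j c * z) = Fq_to_C j c * ex z"
  by (rule exp_unique) (use sums_mult_topological[OF exp_sums[of z], of "Fq_to_C j c"] in
    \<open>simp add: power_mult_distrib frobenius_Fq mult.left_commute\<close>)

lemma exp_sum: "ex (sum f A) = (\<Sum>x\<in>A. ex (f x))"
  by (induction A rule: infinite_finite_induct) (auto simp: exp_add)

definition theta_action :: "'c \<Rightarrow> 'c" where "theta_action x = (\<Sum>i\<le>rk. theta_coeff i * x ^ (CARD('a) ^ i))"

text \<open>Each coefficient of \<open>\<phi>\<close> at theta contributes a shifted Frobenius image
  of the exponential series. There are only \<open>rk + 1\<close> of these series, so they can be
  added term by term and regrouped by \<open>exp_coeff_functional\<close>.\<close>

lemma exp_theta: "ex (T * z) = theta_action (ex z)"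
proof (rule exp_unique)
  let ?q = "CARD('a)"
  define t where "t i n = (if i \<le> n then theta_coeff i * (exp_coeff (n - i) * z ^ (?q ^ (n - i))) ^ (?q ^ i) else 0)" for i n
  have "t i sums (theta_coeff i * ex z ^ (?q ^ i))" for i
  proof -
    have "(\<lambda>N. (\<Sum>n<N. exp_coeff n * z ^ (?q ^ n)) ^ (?q ^ i)) \<longlonglongrightarrow> ex z ^ (?q ^ i)"
      using exp_sums[of z] unfolding sums_def by (intro tendsto_power_strong tendsto_const)
    then have "(\<lambda>n. (exp_coeff n * z ^ (?q ^ n)) ^ (?q ^ i)) sums (ex z ^ (?q ^ i))"
      by (simp add: sums_def frobenius_sum)
    from sums_shift_zeros[OF sums_mult_topological[OF this], of i "theta_coeff i"] show ?thesis
      by (simp only: t_def[abs_def])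
  qed
  then have "(\<lambda>n. \<Sum>i\<le>rk. t i n) sums theta_action (ex z)"
    unfolding theta_action_def by (intro sums_sum)
  moreover have "(\<Sum>i\<le>rk. t i n) = exp_coeff n * (T * z) ^ (?q ^ n)" for n
  proof -
    have t: "t i n = theta_coeff i * exp_coeff (n - i) ^ (?q ^ i) * z ^ (?q ^ n)" if "i \<le> n" for i
      using that by (simp add: t_def power_mult_distrib mult.assoc flip: power_mult power_add)
    have "(\<Sum>i\<le>rk. t i n) = (\<Sum>i\<le>n. t i n)"
    proof -
      have "(\<Sum>i\<le>rk. t i n) = (\<Sum>i\<le>rk + n. t i n)"
        by (rule sum.mono_neutral_left) (auto simp: t_def theta_coeff_eq_0)
      also have "\<dots> = (\<Sum>i\<le>n. t i n)"
        by (rule sum.mono_neutral_right) (auto simp: t_def)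
      finally show ?thesis .
    qed
    also have "\<dots> = (\<Sum>i\<le>n. theta_coeff i * exp_coeff (n - i) ^ (?q ^ i)) * z ^ (?q ^ n)"
      unfolding sum_distrib_right by (rule sum.cong) (auto simp: t)
    also have "\<dots> = exp_coeff n * (T * z) ^ (?q ^ n)"
      by (simp add: exp_coeff_functional[symmetric] power_mult_distrib)
    finally show ?thesis .
  qed
  ultimately show "(\<lambda>n. exp_coeff n * (T * z) ^ (?q ^ n)) sums theta_action (ex z)"
    by simp
qed

lemma exp_theta_power: "ex (T ^ n * z) = (theta_action ^^ n) (ex z)"
  by (induction n) (auto simp: exp_theta mult.assoc)

lemma theta_action_add: "theta_action (x + y) = theta_action x + theta_action y"
  by (simp add: theta_action_def frobenius_add algebra_simps sum.distrib)

lemma theta_action_zero [simp]: "theta_action 0 = 0"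
  using theta_action_add[of 0 0] by (metis add_0 add_cancel_right_right)

lemma funpow_theta_action_zero [simp]: "(theta_action ^^ n) 0 = 0"
  by (induction n) auto

text \<open>Every term after the first has exponent q^n >= 2. The quadratic form of the bound
  matters later: it keeps the difference between the inverses of u and \<open>ex u\<close> bounded,
  however small u is.\<close>

lemma exp_approx:
  assumes "coeff_bound * absv u < 1"
  shows "absv (ex u - u) \<le> coeff_bound * absv u ^ 2"
proof (rule absv_sums_le)
  let ?q = "CARD('a)"
  let ?d = "\<lambda>n. exp_coeff n * u ^ (?q ^ n) - (if n = 0 then u else 0)"
  have "(\<lambda>n. if n = 0 then u else 0) sums u"
    using sums_single[of 0 "\<lambda>_. u"] by simp
  then show "?d sums (ex u - u)"
    using exp_sums[of u] unfolding sums_def by (simp add: sum_subtractf tendsto_diff)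
  show "absv (?d n) \<le> coeff_bound * absv u ^ 2" for n
  proof (cases "n = 0")
    case True
    then show ?thesis using coeff_bound_ge_1 by simp
  next
    case False
    then obtain m where m: "?q ^ n = Suc (Suc m)"
      using power_gt1[of ?q "n - 1"] card_field_gt_1[where 'a = 'a]
      by (metis Suc_pred' bot_nat_0.not_eq_extremum less_natE plus_1_eq_Suc)
    have "absv (exp_coeff n) * 1 \<le> absv (exp_coeff n) * real ?q ^ ((n div rk) * ?q ^ n)"
      using card_field_gt_1[where 'a = 'a] by (intro mult_left_mono one_le_power absv_nonneg) auto
    also have "\<dots> \<le> coeff_bound ^ Suc m"
      using absv_exp_coeff_le[of n] by (simp add: m)
    finally have "absv (exp_coeff n * u ^ (?q ^ n)) \<le> coeff_bound ^ Suc m * absv u ^ Suc (Suc m)"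
      unfolding absv_mult absv_power m by (intro mult_right_mono zero_le_power absv_nonneg) simp
    also have "\<dots> = coeff_bound * absv u ^ 2 * (coeff_bound * absv u) ^ m"
      by (simp add: power_mult_distrib power2_eq_square)
    also have "\<dots> \<le> coeff_bound * absv u ^ 2 * 1"
      using assms coeff_bound_ge_1 by (intro mult_left_mono power_le_one) (auto intro!: mult_nonneg_nonneg absv_nonneg)
    finally show ?thesis
      using False by simp
  qed
qed

lemma absv_exp_small:
  assumes "coeff_bound * absv u < 1"
  shows "absv (ex u) = absv u"
proof (cases "u = 0")
  case False
  have "absv (ex u - u) \<le> coeff_bound * absv u * absv u"
    using exp_approx[OF assms] by (simp add: power2_eq_square mult.assoc)
  also have "\<dots> < 1 * absv u"
    using assms False by (intro mult_strict_right_mono) auto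
  finally show ?thesis
    using absv_add_eq[of "ex u - u" u] by (simp add: add.commute)
qed auto

text \<open>A solution is a fixed point of u -> x - (ex u - u), which maps the ball of radius |x|
  into itself and, by additivity of exp, contracts it by the factor
  \<open>coeff_bound * absv x\<close>.\<close>

lemma exp_surj_small:
  assumes x: "coeff_bound * absv x < 1"
  shows "\<exists>u. ex u = x \<and> absv u = absv x"
proof -
  define g where "g u = x - (ex u - u)" for u
  define S where "S = cball (0 :: 'c) (absv x)"
  have S: "u \<in> S \<longleftrightarrow> absv u \<le> absv x" for u
    by (simp add: S_def dist_absv)
  have small: "absv (ex u - u) \<le> (coeff_bound * absv x) * absv u" if "absv u \<le> absv x" for u
  proof -
    have "coeff_bound * absv u \<le> coeff_bound * absv x"
      using that coeff_bound_ge_1 by (intro mult_left_mono) auto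
    then have "absv (ex u - u) \<le> coeff_bound * absv u * absv u"
      using exp_approx[of u] x by (simp add: power2_eq_square mult.assoc)
    also have "\<dots> \<le> (coeff_bound * absv x) * absv u"
      using \<open>coeff_bound * absv u \<le> coeff_bound * absv x\<close> by (intro mult_right_mono absv_nonneg)
    finally show ?thesis .
  qed
  have "\<exists>!u\<in>S. g u = u"
  proof (rule Banach_fix)
    show "complete S"
      unfolding S_def by (simp add: complete_eq_closed)
    show "S \<noteq> {}"
      by (use absv_nonneg[of x] in \<open>auto simp: S_def\<close>)
    show "0 \<le> coeff_bound * absv x"
      using coeff_bound_ge_1 by (intro mult_nonneg_nonneg absv_nonneg) auto
    show "g ` S \<subseteq> S"
    proof (intro image_subsetI)
      fix u assume "u \<in> S"
      then have u: "absv u \<le> absv x"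
        by (simp add: S)
      have "(coeff_bound * absv x) * absv u \<le> 1 * absv x"
        using u x by (intro mult_mono absv_nonneg) auto
      then show "g u \<in> S"
        using small[OF u] absv_diff[of x "ex u - u"] by (simp add: S g_def)
    qed
    show "dist (g u) (g v) \<le> coeff_bound * absv x * dist u v" if "u \<in> S" "v \<in> S" for u v
    proof -
      have "absv (u - v) \<le> absv x"
        using that absv_diff[of u v] by (simp add: S)
      then have "absv (ex (u - v) - (u - v)) \<le> coeff_bound * absv x * absv (u - v)"
        by (rule small)
      moreover have "g u - g v = - (ex (u - v) - (u - v))"
        by (simp add: g_def exp_diff)
      ultimately show ?thesis
        by (simp only: dist_absv absv_minus)
    qed
  qed (use x in auto)
  then obtain u where u: "u \<in> S" "g u = u"
    by blast
  then have "ex u = x"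
    by (simp add: g_def algebra_simps)
  moreover have "coeff_bound * absv u \<le> coeff_bound * absv x"
    using u coeff_bound_ge_1 by (intro mult_left_mono) (auto simp: S)
  ultimately show ?thesis
    using absv_exp_small[of u] x by (intro exI[of _ u]) auto
qed

section \<open>Torsion points of the powers of theta\<close>

definition theta_poly :: "'c poly" where "theta_poly = (\<Sum>i\<le>rk. Polynomial.monom (theta_coeff i) (CARD('a) ^ i))"

text \<open>This is \<open>\<phi>\<close> at theta^n with tau read as the q-th power, an ordinary
  polynomial; composition takes the place of the skew product.\<close>

primrec iterate_poly :: "nat \<Rightarrow> 'c poly" where
  "iterate_poly 0 = [:0, 1:]"
| "iterate_poly (Suc n) = theta_poly \<circ>\<^sub>p iterate_poly n"

lemma poly_iterate_poly: "poly (iterate_poly n) x = (theta_action ^^ n) x"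
proof -
  have "poly theta_poly x = theta_action x" for x
    by (simp add: theta_poly_def theta_action_def poly_sum poly_monom)
  then show ?thesis
    by (induction n) (auto simp: poly_pcompose)
qed

lemma degree_theta_poly: "Polynomial.degree theta_poly = CARD('a) ^ rk"
proof (rule order_antisym)
  show "Polynomial.degree theta_poly \<le> CARD('a) ^ rk"
    unfolding theta_poly_def using card_field_gt_1[where 'a = 'a]
    by (intro degree_sum_le) (auto intro!: order_trans[OF degree_monom_le] power_increasing)
  have "poly.coeff theta_poly (CARD('a) ^ rk) = (\<Sum>i\<le>rk. if i = rk then theta_coeff rk else 0)"
    unfolding theta_poly_def coeff_sum using card_field_gt_1[where 'a = 'a]
    by (intro sum.cong) (auto simp: power_inject_exp)
  then show "CARD('a) ^ rk \<le> Polynomial.degree theta_poly"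
    using theta_coeff_rk by (intro le_degree) auto
qed

lemma degree_iterate_poly: "Polynomial.degree (iterate_poly n) = CARD('a) ^ (rk * n)"
  by (induction n) (auto simp: degree_pcompose degree_theta_poly power_add)

lemma of_nat_card_power: "i > 0 \<Longrightarrow> of_nat (CARD('a) ^ i) = (0 :: 'c)"
  using of_nat_card_choose_C[of 1] card_field_gt_1[where 'a = 'a] by (simp add: power_0_left)

lemma pderiv_theta_poly: "pderiv theta_poly = [:T:]"
proof -
  have "pderiv theta_poly = (\<Sum>i\<le>rk. pderiv (Polynomial.monom (theta_coeff i) (CARD('a) ^ i)))"
  proof -
    have "pderiv (sum f A) = (\<Sum>i\<in>A. pderiv (f i))" for f :: "nat \<Rightarrow> 'c poly" and A
      by (induction A rule: infinite_finite_induct) (auto simp: pderiv_add)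
    then show ?thesis
      by (simp only: theta_poly_def)
  qed
  also have "\<dots> = (\<Sum>i\<le>rk. if i = 0 then [:T:] else 0)"
  proof (rule sum.cong)
    fix i assume "i \<in> {..rk}"
    show "pderiv (Polynomial.monom (theta_coeff i) (CARD('a) ^ i)) = (if i = 0 then [:T:] else 0)"
      using of_nat_card_power[of i] by (auto simp: pderiv_monom theta_coeff_0 monom_0 simp del: of_nat_power)
  qed auto
  finally show ?thesis
    by simp
qed

text \<open>Only the linear term of \<open>theta_poly\<close> survives differentiation, so the chain
  rule multiplies constants. A nonzero constant derivative excludes multiple roots and gives all
  Lagrange denominators the same value.\<close>

lemma pderiv_iterate_poly: "pderiv (iterate_poly n) = [:T ^ n:]"
  by (induction n) (auto simp: pderiv_pCons pderiv_pcompose pderiv_theta_poly)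

definition torsion :: "nat \<Rightarrow> 'c set" where "torsion n = {x. (theta_action ^^ n) x = 0}"

lemma iterate_poly_splits: "\<exists>c. c \<noteq> 0 \<and> iterate_poly n = Polynomial.smult c (\<Prod>v\<in>torsion n. [:- v, 1:])"
proof -
  have "iterate_poly n \<noteq> 0"
    using pderiv_iterate_poly[of n] theta_neq_0 by auto
  then show ?thesis
    using separable_poly_splits[of "iterate_poly n"] poly_has_root theta_neq_0
    by (simp add: pderiv_iterate_poly poly_iterate_poly torsion_def)
qed

lemma finite_torsion: "finite (torsion n)"
proof -
  have "iterate_poly n \<noteq> 0"
    using pderiv_iterate_poly[of n] theta_neq_0 by auto
  then show ?thesis
    using poly_roots_finite[of "iterate_poly n"] by (simp add: torsion_def poly_iterate_poly)
qed

lemma card_torsion: "card (torsion n) = CARD('a) ^ (rk * n)"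
  using iterate_poly_splits[of n] degree_iterate_poly[of n] degree_prod_linear_factors[OF finite_torsion[of n]] by auto

lemma sum_torsion:
  assumes "rk * m + k < rk * n"
  shows "(\<Sum>v\<in>torsion n - {0}. (theta_action ^^ m) v ^ (CARD('a) ^ k) / v) = - (if k = 0 then T ^ m else 0)"
proof -
  let ?q = "CARD('a)"
  define h where "h = iterate_poly m ^ (?q ^ k)"
  have h: "poly h v = (theta_action ^^ m) v ^ (?q ^ k)" for v
    by (simp add: h_def poly_iterate_poly)
  have "poly h 0 = 0"
    by (simp add: h)
  then obtain g where g: "h = [:0, 1:] * g"
    by (metis dvdE minus_zero poly_eq_0_iff_dvd)
  have iterate_poly_neq: "iterate_poly m \<noteq> 0"
    using pderiv_iterate_poly[of m] theta_neq_0 by auto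
  then have "g \<noteq> 0"
    using g by (auto simp: h_def)
  then have "Suc (Polynomial.degree g) = Polynomial.degree h"
    unfolding g by (subst degree_mult_eq) auto
  also have "\<dots> = ?q ^ k * ?q ^ (rk * m)"
    unfolding h_def by (simp add: degree_power_eq[OF iterate_poly_neq] degree_iterate_poly)
  also have "\<dots> < ?q ^ (rk * n)"
    using assms card_field_gt_1[where 'a = 'a] by (subst power_add[symmetric], intro power_strict_increasing) auto
  finally have deg: "Suc (Polynomial.degree g) < card (torsion n)"
    by (simp add: card_torsion)
  obtain c where c: "c \<noteq> 0" "iterate_poly n = Polynomial.smult c (\<Prod>v\<in>torsion n. [:- v, 1:])"
    using iterate_poly_splits by blast
  have "poly (pderiv (\<Prod>v\<in>torsion n. [:- v, 1:])) v = T ^ n / c" for v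
  proof -
    have "c * poly (pderiv (\<Prod>v\<in>torsion n. [:- v, 1:])) v = T ^ n"
      using arg_cong[OF c(2), of "\<lambda>p. poly (pderiv p) v"] by (simp add: pderiv_iterate_poly pderiv_smult)
    then show ?thesis
      using c(1) by (simp add: field_simps)
  qed
  then have "(\<Sum>v\<in>torsion n. poly g v) = 0"
    using c theta_neq_0 by (intro sum_poly_over_roots_eq_0[OF finite_torsion _ _ deg, of "T ^ n / c"]) auto
  moreover have "0 \<in> torsion n"
    by (simp add: torsion_def)
  ultimately have "(\<Sum>v\<in>torsion n - {0}. poly g v) = - poly g 0"
    using sum.remove[OF finite_torsion, of 0 n "poly g"] by (simp add: eq_neg_iff_add_eq_0 add.commute)
  moreover have "poly g v = (theta_action ^^ m) v ^ (?q ^ k) / v" if "v \<in> torsion n - {0}" for v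
    using arg_cong[OF g, of "\<lambda>p. poly p v"] that by (simp add: h field_simps)
  \<comment> \<open>Since h is x times g, the value of g at 0 is the derivative of h there; a q^k-th
    power with k > 0 has derivative 0.\<close>
  moreover have "poly g 0 = (if k = 0 then T ^ m else 0)"
  proof -
    have "poly g 0 = poly (pderiv h) 0"
      unfolding g by (simp add: pderiv_mult pderiv_pCons)
    also have "\<dots> = (if k = 0 then T ^ m else 0)"
      using of_nat_card_power[of k] by (auto simp: h_def pderiv_power pderiv_iterate_poly simp del: of_nat_power)
    finally show ?thesis .
  qed
  ultimately show ?thesis
    by simp
qed

section \<open>Comparison of periods with torsion points\<close>

lemma absv_T_power: "absv (T ^ n) = real CARD('a) ^ n"
  by (simp add: absv_power absv_theta)

text \<open>The bound says exactly that z / theta^N lies in the ball where exp is an isometry. As N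
  grows these sets exhaust the nonzero periods.\<close>

definition small_periods :: "nat \<Rightarrow> 'c set" where
  "small_periods N = {z \<in> L. z \<noteq> 0 \<and> coeff_bound * absv z < real CARD('a) ^ N}"

lemma small_div_T:
  assumes "coeff_bound * absv z < real CARD('a) ^ N"
  shows "coeff_bound * absv (z / T ^ N) < 1"
  using assms card_field_gt_1[where 'a = 'a] by (simp add: absv_divide absv_T_power pos_divide_less_eq)

lemma exp_div_T: "(theta_action ^^ N) (ex (z / T ^ N)) = ex z"
  using exp_theta_power[of N "z / T ^ N"] theta_neq_0 by simp

text \<open>Injectivity is the isometry applied to a difference, which stays in the ball by the
  ultrametric inequality. Surjectivity is local inversion: theta^N times a small preimage of a
  torsion point is a period.\<close>

lemma bij_betw_small_periods: "bij_betw (\<lambda>z. ex (z / T ^ N)) (small_periods N) {v \<in> torsion N - {0}. coeff_bound * absv v < 1}"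
  unfolding bij_betw_def
proof (intro conjI inj_onI equalityI subsetI)
  fix z w assume z: "z \<in> small_periods N" and w: "w \<in> small_periods N" and eq: "ex (z / T ^ N) = ex (w / T ^ N)"
  have "coeff_bound * absv (z - w) \<le> coeff_bound * max (absv z) (absv w)"
    using coeff_bound_ge_1 by (intro mult_left_mono absv_diff) auto
  also have "\<dots> < real CARD('a) ^ N"
    using z w by (auto simp: small_periods_def max_def)
  finally have "absv (ex ((z - w) / T ^ N)) = absv ((z - w) / T ^ N)"
    by (intro absv_exp_small small_div_T)
  moreover have "ex ((z - w) / T ^ N) = 0"
    using eq by (simp add: diff_divide_distrib exp_diff)
  ultimately show "z = w"
    using theta_neq_0 by (simp add: absv_eq_0_iff)
next
  fix v assume "v \<in> (\<lambda>z. ex (z / T ^ N)) ` small_periods N"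
  then obtain z where z: "z \<in> small_periods N" "v = ex (z / T ^ N)"
    by blast
  then have small: "coeff_bound * absv (z / T ^ N) < 1"
    by (intro small_div_T) (simp add: small_periods_def)
  moreover have "z / T ^ N \<noteq> 0"
    using z theta_neq_0 by (simp add: small_periods_def)
  ultimately show "v \<in> {v \<in> torsion N - {0}. coeff_bound * absv v < 1}"
    using z absv_exp_small[OF small] by (auto simp: torsion_def exp_div_T small_periods_def L_iff absv_eq_0_iff)
next
  fix v assume v: "v \<in> {v \<in> torsion N - {0}. coeff_bound * absv v < 1}"
  then obtain u where u: "ex u = v" "absv u = absv v"
    using exp_surj_small[of v] by blast
  have "T ^ N * u \<in> small_periods N"
  proof -
    have "ex (T ^ N * u) = 0"
      using v u by (simp add: exp_theta_power torsion_def)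
    moreover have "u \<noteq> 0"
      using u v by auto
    moreover have "coeff_bound * absv (T ^ N * u) < real CARD('a) ^ N"
      using v u card_field_gt_1[where 'a = 'a] by (simp add: absv_mult absv_T_power mult.left_commute)
    ultimately show ?thesis
      using theta_neq_0 by (simp add: small_periods_def L_iff)
  qed
  then show "v \<in> (\<lambda>z. ex (z / T ^ N)) ` small_periods N"
    using u theta_neq_0 by (intro image_eqI[of _ _ "T ^ N * u"]) auto
qed

lemma finite_small_periods: "finite (small_periods N)"
  using bij_betw_finite[OF bij_betw_small_periods[of N]] finite_torsion by simp

text \<open>Passing from small torsion points to periods and dropping the large torsion points cost
  errors governed by the same constant \<open>coeff_bound * K\<close>, in which N does not
  occur.\<close>

lemma sum_small_periods_bound:
  assumes k: "k < rk"
  shows "\<exists>D. \<forall>N>n. absv ((\<Sum>z\<in>small_periods N. ex (z / T ^ Suc n) ^ (CARD('a) ^ k) / z)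
    + (if k = 0 then 1 / T ^ Suc n else 0)) \<le> D / real CARD('a) ^ N"
proof -
  let ?q = "CARD('a)"
  \<comment> \<open>For N = m + n + 1, applying theta^m to a theta^N-torsion point lands in the
    theta^(n+1)-torsion, a fixed finite set; so this maximum bounds all numerators, for every
    N.\<close>
  define K where "K = Max ((\<lambda>y. absv y ^ (?q ^ k)) ` torsion (Suc n))"
  have K: "absv y ^ (?q ^ k) \<le> K" if "y \<in> torsion (Suc n)" for y
    unfolding K_def using that finite_torsion by (intro Max_ge) auto
  have K0: "0 \<le> K"
    by (rule order_trans[OF _ K[of 0]]) (auto simp: torsion_def)
  have "absv ((\<Sum>z\<in>small_periods N. ex (z / T ^ Suc n) ^ (?q ^ k) / z)
    + (if k = 0 then 1 / T ^ Suc n else 0)) \<le> coeff_bound * K / real ?q ^ N" if "N > n" for N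
  proof -
    define m where "m = N - Suc n"
    have N: "N = m + Suc n"
      using that by (simp add: m_def)
    let ?w = "\<lambda>v. (theta_action ^^ m) v ^ (?q ^ k) / v / T ^ N"
    let ?h = "\<lambda>z. ex (z / T ^ N)"
    let ?S = "{v \<in> torsion N - {0}. coeff_bound * absv v < 1}" and ?B = "{v \<in> torsion N - {0}. \<not> coeff_bound * absv v < 1}"
    have rkn: "rk * m + k < rk * N"
      using k by (simp add: N algebra_simps)
    have "(\<Sum>v\<in>torsion N - {0}. ?w v) = - (if k = 0 then T ^ m else 0) / T ^ N"
      by (subst sum_divide_distrib[symmetric]) (simp add: sum_torsion[OF rkn])
    also have "\<dots> = - (if k = 0 then 1 / T ^ Suc n else 0)"
      using theta_neq_0 by (simp add: N power_add)
    finally have total: "(\<Sum>v\<in>torsion N - {0}. ?w v) = - (if k = 0 then 1 / T ^ Suc n else 0)" .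
    have "(\<Sum>v\<in>torsion N - {0}. ?w v) = (\<Sum>v\<in>?S. ?w v) + (\<Sum>v\<in>?B. ?w v)"
      by (subst sum.union_disjoint[symmetric]) (auto simp: finite_torsion intro!: sum.cong)
    also have "(\<Sum>v\<in>?S. ?w v) = (\<Sum>z\<in>small_periods N. ?w (?h z))"
      by (rule sum.reindex_bij_betw[OF bij_betw_small_periods, symmetric])
    finally have split: "- (if k = 0 then 1 / T ^ Suc n else 0) = (\<Sum>z\<in>small_periods N. ?w (?h z)) + (\<Sum>v\<in>?B. ?w v)"
      using total by simp
    have FV: "(theta_action ^^ m) v \<in> torsion (Suc n)" if "v \<in> torsion N" for v
    proof -
      have "(theta_action ^^ (Suc n + m)) v = (theta_action ^^ Suc n) ((theta_action ^^ m) v)"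
        by (simp only: funpow_add o_apply)
      then show ?thesis
        using that by (simp add: torsion_def N add.commute)
    qed
    have big: "absv (?w v) \<le> coeff_bound * K / real ?q ^ N" if v: "v \<in> ?B" for v
    proof -
      have "1 / absv v \<le> coeff_bound"
        using v by (simp add: pos_divide_le_eq)
      moreover have "absv ((theta_action ^^ m) v) ^ (?q ^ k) \<le> K"
        using v by (intro K FV) auto
      ultimately have "(1 / absv v) * absv ((theta_action ^^ m) v) ^ (?q ^ k) \<le> coeff_bound * K"
        using coeff_bound_ge_1 by (intro mult_mono) (auto intro: zero_le_power absv_nonneg)
      then have "(1 / absv v) * absv ((theta_action ^^ m) v) ^ (?q ^ k) / real ?q ^ N \<le> coeff_bound * K / real ?q ^ N"
        by (intro divide_right_mono) auto
      then show ?thesis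
        by (simp add: absv_mult absv_divide absv_power absv_theta)
    qed
    \<comment> \<open>With z = theta^N u, the two summands differ by the numerator times (1/u - 1/ex
      u) / theta^N, and \<open>exp_approx\<close> bounds the bracket by
      \<open>coeff_bound\<close>.\<close>
    have small: "absv (ex (z / T ^ Suc n) ^ (?q ^ k) / z - ?w (?h z)) \<le> coeff_bound * K / real ?q ^ N"
      if z: "z \<in> small_periods N" for z
    proof -
      define u where "u = z / T ^ N"
      have zu: "z = T ^ N * u"
        using theta_neq_0 by (simp add: u_def)
      have u: "coeff_bound * absv u < 1" "u \<noteq> 0"
        using z theta_neq_0 small_div_T[of z N] by (auto simp: small_periods_def u_def)
      have eu: "absv (ex u) = absv u" "ex u \<noteq> 0"
        using absv_exp_small[OF u(1)] u(2) by (auto simp: absv_eq_0_iff)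
      have "ex u \<in> torsion N"
        using z by (simp add: torsion_def u_def exp_div_T small_periods_def L_iff)
      have "z / T ^ Suc n = T ^ m * u"
        using theta_neq_0 by (simp add: zu N power_add)
      then have Fm: "ex (z / T ^ Suc n) = (theta_action ^^ m) (ex u)"
        by (simp add: exp_theta_power)
      have diff: "ex (z / T ^ Suc n) ^ (?q ^ k) / z - ?w (?h z)
          = (theta_action ^^ m) (ex u) ^ (?q ^ k) * ((ex u - u) / (u * ex u)) / T ^ N"
        unfolding Fm u_def[symmetric] using u eu theta_neq_0 by (simp add: zu field_simps)
      have "absv (ex u - u) / absv u ^ 2 \<le> coeff_bound"
        using exp_approx[OF u(1)] u(2) by (subst pos_divide_le_eq) (auto simp: absv_eq_0_iff)
      then have "absv ((theta_action ^^ m) (ex u)) ^ (?q ^ k) * (absv (ex u - u) / absv u ^ 2) \<le> K * coeff_bound"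
        using K0 \<open>ex u \<in> torsion N\<close>
        by (intro mult_mono K FV) (auto intro!: divide_nonneg_nonneg absv_nonneg)
      then have "absv ((theta_action ^^ m) (ex u)) ^ (?q ^ k) * (absv (ex u - u) / absv u ^ 2) / real ?q ^ N
          \<le> K * coeff_bound / real ?q ^ N"
        by (intro divide_right_mono) auto
      then show ?thesis
        unfolding diff absv_mult absv_divide absv_power absv_theta eu power2_eq_square
        by (simp add: mult.commute)
    qed
    have c0: "0 \<le> coeff_bound * K / real ?q ^ N"
      using K0 coeff_bound_ge_1 by simp
    have eq: "(\<Sum>z\<in>small_periods N. ex (z / T ^ Suc n) ^ (?q ^ k) / z) + (if k = 0 then 1 / T ^ Suc n else 0)
        = (\<Sum>z\<in>small_periods N. ex (z / T ^ Suc n) ^ (?q ^ k) / z - ?w (?h z)) - (\<Sum>v\<in>?B. ?w v)"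
      using split by (simp add: sum_subtractf algebra_simps add_eq_0_iff)
    have "absv ((\<Sum>z\<in>small_periods N. ex (z / T ^ Suc n) ^ (?q ^ k) / z - ?w (?h z)) - (\<Sum>v\<in>?B. ?w v))
        \<le> coeff_bound * K / real ?q ^ N"
      by (rule order_trans[OF absv_diff max.boundedI[OF absv_sum_le[OF small c0] absv_sum_le[OF big c0]]])
    then show ?thesis
      unfolding eq .
  qed
  then show ?thesis
    by blast
qed

section \<open>The periods as a discrete finitely generated A-module\<close>

lemma L_zero: "0 \<in> L" and L_add: "x \<in> L \<Longrightarrow> y \<in> L \<Longrightarrow> x + y \<in> L"
  by (auto simp: L_iff exp_add)

lemma L_scale: "x \<in> L \<Longrightarrow> A_to_C j a * x \<in> L"
proof (induction a arbitrary: x)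
  case 0
  then show ?case by (simp add: A_to_C_hom L_zero)
next
  case (pCons c a)
  have "T * x \<in> L"
    using pCons.prems by (simp add: L_iff exp_theta)
  moreover have "A_to_C j (pCons c a) * x = Fq_to_C j c * x + A_to_C j a * (T * x)"
    unfolding pCons_eq[of c a] A_to_C_hom by (simp add: algebra_simps)
  ultimately show ?case
    using pCons by (simp add: L_iff exp_add exp_Fq)
qed

text \<open>This is discreteness: the nonzero periods in a ball inject into the finite set of
  torsion points of some level.\<close>

lemma finite_ball_L: "finite {z \<in> L. absv z \<le> R}"
proof -
  have "1 < real CARD('a)"
    using card_field_gt_1[where 'a = 'a] by simp
  then obtain N where N: "coeff_bound * R < real CARD('a) ^ N"
    using real_arch_pow by blast
  have "{z \<in> L. absv z \<le> R} \<subseteq> insert 0 (small_periods N)"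
  proof
    fix z assume z: "z \<in> {z \<in> L. absv z \<le> R}"
    then have "coeff_bound * absv z \<le> coeff_bound * R"
      using coeff_bound_ge_1 by (intro mult_left_mono) auto
    then show "z \<in> insert 0 (small_periods N)"
      using N z by (auto simp: small_periods_def)
  qed
  then show ?thesis
    using finite_small_periods finite_subset by blast
qed

text \<open>On periods, z -> exp(z / theta) takes finitely many values, all theta-torsion.
  Subtracting a representative with the same value and dividing by theta gives another period, with
  the bound on its size lowered by a factor q; the descent ends in a fixed ball, which is
  finite.\<close>

lemma L_finitely_generated:
  "\<exists>G. finite G \<and> G \<subseteq> L \<and> (\<forall>z\<in>L. \<exists>a. z = (\<Sum>g\<in>G. A_to_C j (a g) * g))"
proof -
  let ?q = "real CARD('a)"
  have q: "1 < ?q"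
    using card_field_gt_1[where 'a = 'a] by simp
  have "(\<lambda>z. ex (z / T)) ` L \<subseteq> torsion 1"
    using exp_div_T[of 1] by (auto simp: torsion_def L_iff)
  then have "finite ((\<lambda>z. ex (z / T)) ` L)"
    using finite_torsion finite_subset by blast
  then obtain C where C: "C \<subseteq> L" "finite C" "(\<lambda>z. ex (z / T)) ` L = (\<lambda>z. ex (z / T)) ` C"
    using finite_subset_image[of "(\<lambda>z. ex (z / T)) ` L" "\<lambda>z. ex (z / T)" L] by blast
  \<comment> \<open>The ball must contain the representatives \<open>C\<close>, since these reappear
    in the descent; the lower bound 1 lets the radii R q^n exhaust the field.\<close>
  define R where "R = Max (insert 1 (absv ` C))"
  have R: "1 \<le> R" "\<And>z. z \<in> C \<Longrightarrow> absv z \<le> R"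
    using C(2) by (auto simp: R_def)
  define G where "G = {z \<in> L. absv z \<le> R}"
  have G: "finite G" "G \<subseteq> L"
    using finite_ball_L by (auto simp: G_def)
  have gen: "\<exists>a. g = (\<Sum>x\<in>G. A_to_C j (a x) * x)" if "g \<in> G" for g
  proof -
    have "(\<Sum>x\<in>G. A_to_C j (if x = g then 1 else 0) * x) = (\<Sum>x\<in>G. if x = g then g else 0)"
      by (rule sum.cong) (auto simp: A_to_C_hom)
    then show ?thesis
      using that G by (intro exI[of _ "\<lambda>x. if x = g then 1 else 0"]) simp
  qed
  have "\<exists>a. z = (\<Sum>g\<in>G. A_to_C j (a g) * g)" if "z \<in> L" "absv z \<le> R * ?q ^ n" for z n
    using that
  proof (induction n arbitrary: z)
    case 0
    then show ?case
      by (intro gen) (simp add: G_def)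
  next
    case (Suc n)
    have "ex (z / T) \<in> (\<lambda>z. ex (z / T)) ` C"
      using Suc.prems C(3) by blast
    then obtain c where c: "c \<in> C" "ex (z / T) = ex (c / T)"
      by blast
    define w where "w = (z - c) / T"
    have "w \<in> L"
      using c by (simp add: L_iff w_def diff_divide_distrib exp_diff)
    have "R * 1 \<le> R * ?q ^ Suc n"
      using R q by (intro mult_left_mono one_le_power) auto
    then have "absv (z - c) \<le> R * ?q ^ Suc n"
      using absv_diff[of z c] R(2)[OF c(1)] Suc.prems by simp
    then have "absv w \<le> R * ?q ^ n"
      using q by (simp add: w_def absv_divide absv_theta pos_divide_le_eq mult_ac)
    then obtain a where a: "w = (\<Sum>g\<in>G. A_to_C j (a g) * g)"
      using Suc.IH \<open>w \<in> L\<close> by blast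
    have "c \<in> G"
      using c C R by (auto simp: G_def)
    then obtain b where b: "c = (\<Sum>g\<in>G. A_to_C j (b g) * g)"
      using gen by blast
    have "z = c + T * w"
      using theta_neq_0 by (simp add: w_def)
    also have "\<dots> = (\<Sum>g\<in>G. A_to_C j (b g + [:0, 1:] * a g) * g)"
      unfolding a b A_to_C_hom by (simp add: sum.distrib sum_distrib_left algebra_simps)
    finally show ?case
      by (intro exI)
  qed
  moreover have "\<exists>n. absv z \<le> R * ?q ^ n" for z
  proof -
    obtain n where "absv z < ?q ^ n"
      using real_arch_pow[OF q] by blast
    also have "1 * ?q ^ n \<le> R * ?q ^ n"
      using R q by (intro mult_right_mono) auto
    finally show ?thesis
      by (intro exI[of _ n]) simp
  qed
  ultimately show ?thesis
    using G by metis
qed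

end

section \<open>The duality between a lattice and its dual\<close>

lemma fls_X_inv_power_times_nth:
  fixes f :: "'b::comm_ring_1 fls"
  shows "fls_nth (f * fls_X_inv ^ N) i = fls_nth f (i + int N)"
proof (induction N arbitrary: i)
  case (Suc N)
  have "f * fls_X_inv ^ Suc N = fls_X_inv * (f * fls_X_inv ^ N)"
    by (simp only: power_Suc ac_simps)
  then show ?case
    using Suc by (simp add: fls_X_inv_times_conv_shift(1) algebra_simps del: power_Suc)
qed simp

lemma A_to_K_theta: "A_to_K [:0, 1:] = fls_X_inv"
  by (simp add: A_to_K_def map_poly_pCons)

lemma fls_nth_sum: "fls_nth (sum f A) i = (\<Sum>x\<in>A. fls_nth (f x) i)"
  by (induction A rule: infinite_finite_induct) auto

lemma fls_nth_const_mult_X_power: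
  "fls_nth (fls_const c * fls_X ^ n) k = (if k = int n then c else 0 :: 'b::comm_ring_1)"
  by (auto simp: fls_X_power_conv_shift_1)

lemma A_to_K_times_nth:
  assumes "Polynomial.degree p < N"
  shows "fls_nth (A_to_K p * f) i = (\<Sum>n<N. poly.coeff p n * fls_nth f (i + int n))"
  using assms
proof (induction p arbitrary: i N)
  case 0
  then show ?case by (simp add: A_to_K_def)
next
  case (pCons c p)
  show ?case
  proof (cases "p = 0")
    case True
    obtain M where M: "N = Suc M"
      using pCons.prems gr0_implies_Suc by (metis less_nat_zero_code not_gr_zero)
    show ?thesis
      unfolding M sum.lessThan_Suc_shift by (simp add: True A_to_K_const)
  next
    case False
    then obtain M where M: "N = Suc M" "Polynomial.degree p < M"
      using pCons.prems by (auto simp: less_Suc_eq_0_disj elim: lessE)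
    have "A_to_K (pCons c p) * f = fls_const c * f + fls_X_inv * (A_to_K p * f)"
      by (simp only: A_to_K_pCons distrib_right mult.assoc)
    then have "fls_nth (A_to_K (pCons c p) * f) i = c * fls_nth f i + fls_nth (A_to_K p * f) (i + 1)"
      by (simp add: fls_X_inv_times_conv_shift(1))
    also have "\<dots> = (\<Sum>n<N. poly.coeff (pCons c p) n * fls_nth f (i + int n))"
      unfolding M sum.lessThan_Suc_shift pCons.IH[OF M(2)] by (simp add: algebra_simps)
    finally show ?thesis .
  qed
qed

lemma res_pairing_eq_sum:
  assumes "Polynomial.degree p < N"
  shows "res_pairing p b = (\<Sum>n<N. poly.coeff p n * fls_nth b (int n + 1))"
  unfolding res_pairing_def A_to_K_times_nth[OF assms] by (simp add: add.commute)

lemma res_pairing_add_left: "res_pairing (p + p') b = res_pairing p b + res_pairing p' b"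
  by (simp add: res_pairing_def A_to_K_add distrib_right)

lemma res_pairing_smult_left: "res_pairing (Polynomial.smult c p) b = c * res_pairing p b"
  by (simp add: res_pairing_def A_to_K_smult mult.assoc)

lemma res_pairing_zero [simp]: "res_pairing 0 b = 0" "res_pairing p 0 = 0"
  by (simp_all add: res_pairing_def A_to_K_def)

lemma res_pairing_add: "res_pairing p (b + b') = res_pairing p b + res_pairing p b'"
  by (simp add: res_pairing_def distrib_left)

lemma res_pairing_diff: "res_pairing p (b - b') = res_pairing p b - res_pairing p b'"
  by (simp add: res_pairing_def right_diff_distrib)

lemma res_pairing_const_mult: "res_pairing p (fls_const c * b) = c * res_pairing p b"
  unfolding res_pairing_def mult.left_commute[of _ "fls_const c"] by simp

text \<open>Pairing with theta^(-n-1) extracts the coefficient of theta^n; this is how coefficients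
  of the dot product become values of exp at z / theta^(n+1).\<close>

lemma res_pairing_X_power: "res_pairing p (fls_X ^ Suc n) = poly.coeff p n"
proof -
  have "res_pairing p (fls_X ^ Suc n) = (\<Sum>m<Suc (Polynomial.degree p + n). if m = n then poly.coeff p n else 0)"
  proof (subst res_pairing_eq_sum)
    show "Polynomial.degree p < Suc (Polynomial.degree p + n)"
      by simp
    have "fls_nth (fls_X ^ Suc n) k = (if k = int (Suc n) then 1 else 0 :: 'a)" for k
      using fls_nth_const_mult_X_power[of "1 :: 'a" "Suc n" k] by simp
    then show "(\<Sum>m<Suc (Polynomial.degree p + n). poly.coeff p m * fls_nth (fls_X ^ Suc n) (int m + 1)) =
        (\<Sum>m<Suc (Polynomial.degree p + n). if m = n then poly.coeff p n else 0)"
      by (intro sum.cong) auto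
  qed
  then show ?thesis
    by simp
qed

lemma poly_part:
  fixes b :: "'a::{finite, field} fls"
  shows "\<exists>a. \<forall>i\<le>0. fls_nth (A_to_K a) i = fls_nth b i"
proof -
  define M where "M = nat (- fls_subdegree b)"
  define a where "a = (\<Sum>n\<le>M. Polynomial.monom (fls_nth b (- int n)) n)"
  have coeff: "poly.coeff a n = fls_nth b (- int n)" for n
  proof (cases "n \<le> M")
    case False
    then have "fls_nth b (- int n) = 0"
      by (intro fls_eq0_below_subdegree) (auto simp: M_def)
    then show ?thesis
      using False by (simp add: a_def coeff_sum)
  qed (simp add: a_def coeff_sum)
  show ?thesis
    by (intro exI[of _ a]) (auto simp: A_to_K_nth coeff)
qed

text \<open>The pieces play different roles: the polynomial is harmless modulo a lattice, the N
  digits span finitely many directions over F_q, and the tail is small.\<close>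

lemma fls_decomposition:
  fixes b :: "'a::{finite, field} fls"
  shows "\<exists>a w. b = A_to_K a + (\<Sum>n<N. fls_const (fls_nth b (int n + 1)) * fls_X ^ Suc n) + w \<and>
    (\<forall>i\<le>int N. fls_nth w i = 0)"
proof -
  obtain a where a: "\<And>i. i \<le> 0 \<Longrightarrow> fls_nth (A_to_K a) i = fls_nth b i"
    using poly_part by blast
  define s where "s = (\<Sum>n<N. fls_const (fls_nth b (int n + 1)) * fls_X ^ Suc n)"
  define w where "w = b - A_to_K a - s"
  have s_nth: "fls_nth s i = (\<Sum>n<N. if i = int n + 1 then fls_nth b i else 0)" for i
    unfolding s_def fls_nth_sum fls_nth_const_mult_X_power by (intro sum.cong) auto
  have "fls_nth w i = 0" if i: "i \<le> int N" for i
  proof (cases "i \<le> 0")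
    case True
    then have "fls_nth s i = 0"
      unfolding s_nth by (intro sum.neutral) auto
    then show ?thesis
      using True a by (simp add: w_def)
  next
    case False
    then have "fls_nth s i = (\<Sum>n<N. if n = nat (i - 1) then fls_nth b i else 0)"
      unfolding s_nth by (intro sum.cong) auto
    then show ?thesis
      using False i by (simp add: w_def A_to_K_nth)
  qed
  then show ?thesis
    by (intro exI[of _ a] exI[of _ w]) (simp add: w_def s_def)
qed

lemma abs_K_le:
  assumes "\<And>i. i \<le> int N \<Longrightarrow> fls_nth (w :: 'a::{finite, field} fls) i = 0"
  shows "abs_K w \<le> 1 / real CARD('a) ^ N"
proof (cases "w = 0")
  case False
  then have "int N \<le> fls_subdegree w"
    using assms by (intro fls_subdegree_geI) auto
  then have "real CARD('a) powi (- fls_subdegree w) \<le> real CARD('a) powi (- int N)"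
    using card_field_gt_1[where 'a = 'a] by (intro power_int_increasing) auto
  then show ?thesis
    using False by (simp add: abs_K_def power_int_minus divide_inverse)
qed (simp add: abs_K_def)

context C_infinity
begin

lemma vector_space_K: "vector_space (\<lambda>b x. K_to_C j b * x)"
  by standard (auto simp: K_to_C_hom algebra_simps)

lemma absv_K_to_C_X_power: "absv (K_to_C j (fls_X ^ n)) = 1 / real CARD('a) ^ n"
  by (simp add: absv_K_to_C abs_K_def power_int_minus divide_inverse)

lemma K_to_C_X_power: "K_to_C j (fls_X ^ n) = 1 / theta_C j ^ n"
proof -
  have "K_to_C j fls_X * theta_C j = K_to_C j (fls_X * fls_X_inv)"
    by (simp add: A_to_C_def A_to_K_theta K_to_C_hom(2))
  also have "fls_X * fls_X_inv = (1 :: 'a fls)"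
    by (metis fls_inverse_X fls_X_nonzero right_inverse)
  finally have "K_to_C j fls_X = 1 / theta_C j"
    using theta_neq_0 by (simp add: K_to_C_hom field_simps)
  moreover have "K_to_C j (x ^ n) = K_to_C j x ^ n" for x
    by (induction n) (auto simp: K_to_C_hom)
  ultimately show ?thesis
    by (simp add: power_divide)
qed

end

text \<open>The generators in \<open>G\<close> may satisfy relations, so the pairing has to be shown
  independent of the chosen expression; finiteness of balls is what makes this possible.\<close>

locale lattice = C_infinity j
  for j :: "'a::{finite, field} fls alg_closure \<Rightarrow> 'c::{ultrametric_field, complete_space}" +
  fixes L G :: "'c set"
  assumes L_zero: "0 \<in> L" and L_add: "x \<in> L \<Longrightarrow> y \<in> L \<Longrightarrow> x + y \<in> L"
    and L_scale: "x \<in> L \<Longrightarrow> A_to_C j a * x \<in> L"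
    and finite_ball: "finite {z \<in> L. absv z \<le> R}"
    and G: "finite G" "G \<subseteq> L"
    and G_generates: "z \<in> L \<Longrightarrow> \<exists>a. z = (\<Sum>g\<in>G. A_to_C j (a g) * g)"
begin

interpretation K: vector_space "\<lambda>b x. K_to_C j b * x"
  by (rule vector_space_K)

interpretation FqC: vector_space "Fq_scale_C j"
  by (rule vector_space_Fq_scale_C)

interpretation FqH: vector_space "Fq_scale_hom :: 'a \<Rightarrow> ('c \<Rightarrow> 'a differential) \<Rightarrow> _"
  by (rule vector_space_Fq_scale_hom)

abbreviation KL :: "'c set" where "KL \<equiv> K_span j L"

abbreviation dual :: "('c \<Rightarrow> 'a differential) set" where "dual \<equiv> dual_lattice j L"

lemma L_sum: "(\<And>i. i \<in> A \<Longrightarrow> f i \<in> L) \<Longrightarrow> sum f A \<in> L"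
  by (induction A rule: infinite_finite_induct) (auto simp: L_zero L_add)

lemma L_Fq: "z \<in> L \<Longrightarrow> Fq_to_C j c * z \<in> L"
  using L_scale[of z "[:c:]"] by (simp add: A_to_C_hom)

lemma dualD:
  assumes "\<mu> \<in> dual"
  shows "x \<notin> L \<Longrightarrow> \<mu> x = 0" "x \<in> L \<Longrightarrow> y \<in> L \<Longrightarrow> \<mu> (x + y) = \<mu> x + \<mu> y"
    "x \<in> L \<Longrightarrow> \<mu> (A_to_C j a * x) = a * \<mu> x"
  using assms by (auto simp: dual_lattice_def)

lemma dual_zero: "\<mu> \<in> dual \<Longrightarrow> \<mu> 0 = 0"
  using dualD(3)[of \<mu> 0 0] L_zero by simp

lemma dual_sum:
  assumes "\<mu> \<in> dual" "\<And>i. i \<in> A \<Longrightarrow> f i \<in> L"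
  shows "\<mu> (\<Sum>i\<in>A. A_to_C j (a i) * f i) = (\<Sum>i\<in>A. a i * \<mu> (f i))"
  using assms(2)
proof (induction A rule: infinite_finite_induct)
  case (insert i A)
  have "(\<Sum>i\<in>A. A_to_C j (a i) * f i) \<in> L"
    using insert.prems by (intro L_sum L_scale) auto
  then show ?case
    using insert by (simp add: dualD[OF assms(1)] L_scale)
qed (auto simp: dual_zero assms)

lemma KL_generated:
  assumes "x \<in> KL"
  shows "\<exists>b. x = (\<Sum>g\<in>G. K_to_C j (b g) * g)"
  using assms unfolding K_span_def
proof (induction rule: K.span_induct_alt)
  case base
  show ?case
    by (intro exI[of _ "\<lambda>_. 0"]) (simp add: K_to_C_hom)
next
  case (step c l y)
  obtain a b where a: "l = (\<Sum>g\<in>G. A_to_C j (a g) * g)" and b: "y = (\<Sum>g\<in>G. K_to_C j (b g) * g)"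
    using G_generates[OF step(1)] step(2) by blast
  have "K_to_C j c * l + y = (\<Sum>g\<in>G. K_to_C j (c * A_to_K (a g) + b g) * g)"
    unfolding a b sum_distrib_left sum.distrib[symmetric]
    by (intro sum.cong refl) (simp add: A_to_C_def K_to_C_hom algebra_simps)
  then show ?case
    by (rule exI[of _ "\<lambda>g. c * A_to_K (a g) + b g"])
qed

lemma KL_sum: "S \<subseteq> L \<Longrightarrow> (\<Sum>l\<in>S. K_to_C j (b l) * l) \<in> KL"
  unfolding K_span_def by (intro K.span_sum K.span_scale K.span_base) auto

lemma KL_scale: "l \<in> L \<Longrightarrow> K_to_C j b * l \<in> KL"
  unfolding K_span_def by (intro K.span_scale K.span_base)

lemma KL_add: "x \<in> KL \<Longrightarrow> y \<in> KL \<Longrightarrow> x + y \<in> KL"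
  and KL_diff: "x \<in> KL \<Longrightarrow> y \<in> KL \<Longrightarrow> x - y \<in> KL"
  and KL_zero: "0 \<in> KL"
  unfolding K_span_def by (auto intro: K.span_add K.span_diff K.span_zero)

lemma KL_Fq: "x \<in> KL \<Longrightarrow> Fq_to_C j c * x \<in> KL"
  unfolding K_span_def Fq_to_C_def by (rule K.span_scale)

text \<open>
  The approximation \<open>\<theta>\<^sup>N b\<^sub>l \<approx> a\<^sub>l\<close> by polynomials makes \<open>\<Sum> a\<^sub>l l\<close> an element of L of absolute
  value bounded independently of N. By discreteness, \<open>\<mu> (\<Sum> a\<^sub>l l)\<close> then has bounded degree.
\<close>

lemma relation_pairing_eq_0:
  assumes \<mu>: "\<mu> \<in> dual" and S: "finite S" "S \<subseteq> L" and rel: "(\<Sum>l\<in>S. K_to_C j (b l) * l) = 0"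
  shows "(\<Sum>l\<in>S. res_pairing (\<mu> l) (b l)) = 0"
proof -
  define R where "R = Max (insert 0 (absv ` S))"
  define D where "D = Max (insert 0 ((\<lambda>z. Polynomial.degree (\<mu> z)) ` ({z \<in> L. absv z \<le> R} \<union> S)))"
  \<comment> \<open>The residue becomes the coefficient at index 1 - N, that is of theta^(D+1), one
    beyond the degree bound \<open>D\<close>. Multiplying by \<open>\<mu> l\<close> then involves
    the tails \<open>w l\<close> only at negative indices, where they vanish.\<close>
  define N where "N = Suc (Suc D)"
  have R: "absv l \<le> R" if "l \<in> S" for l
    unfolding R_def using that S by (intro Max_ge) auto
  have D: "Polynomial.degree (\<mu> z) \<le> D" if "z \<in> L \<and> absv z \<le> R \<or> z \<in> S" for z
    unfolding D_def using that S finite_ball by (intro Max_ge) auto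
  have "\<forall>l. \<exists>a. \<forall>i\<le>0. fls_nth (A_to_K a) i = fls_nth (b l * fls_X_inv ^ N) i"
    using poly_part by blast
  then obtain a where a: "\<And>l i. i \<le> 0 \<Longrightarrow> fls_nth (A_to_K (a l)) i = fls_nth (b l * fls_X_inv ^ N) i"
    by metis
  define w where "w l = b l * fls_X_inv ^ N - A_to_K (a l)" for l
  have w: "fls_nth (w l) i = 0" if "i \<le> 0" for l i
    using a that by (simp add: w_def)
  define y where "y = (\<Sum>l\<in>S. A_to_C j (a l) * l)"
  have "y \<in> L"
    unfolding y_def using S by (intro L_sum L_scale) auto
  have "y + (\<Sum>l\<in>S. K_to_C j (w l) * l) = K_to_C j (fls_X_inv ^ N) * (\<Sum>l\<in>S. K_to_C j (b l) * l)"
    unfolding y_def sum_distrib_left sum.distrib[symmetric]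
    by (intro sum.cong refl) (simp add: w_def A_to_C_def K_to_C_hom K_to_C_diff algebra_simps)
  then have "absv y = absv (\<Sum>l\<in>S. K_to_C j (w l) * l)"
    unfolding rel by (metis absv_minus add.inverse_unique mult_zero_right)
  also have "\<dots> \<le> R"
  proof (rule absv_sum_le)
    fix l assume l: "l \<in> S"
    have "abs_K (w l) \<le> 1"
      using abs_K_le[of 0 "w l"] w by simp
    then show "absv (K_to_C j (w l) * l) \<le> R"
      using R[OF l] mult_mono[of "abs_K (w l)" 1 "absv l" R] absv_nonneg
      by (auto simp: absv_mult absv_K_to_C)
  qed (simp add: R_def S)
  finally have deg_y: "Polynomial.degree (\<mu> y) \<le> D"
    using D \<open>y \<in> L\<close> by blast
  have "res_pairing (\<mu> l) (b l) = fls_nth (A_to_K (a l * \<mu> l)) (1 - int N)" if l: "l \<in> S" for l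
  proof -
    have "res_pairing (\<mu> l) (b l) = fls_nth (A_to_K (\<mu> l) * b l * fls_X_inv ^ N) (1 - int N)"
      by (simp add: fls_X_inv_power_times_nth res_pairing_def)
    also have "A_to_K (\<mu> l) * b l * fls_X_inv ^ N = A_to_K (a l * \<mu> l) + A_to_K (\<mu> l) * w l"
      by (simp add: w_def A_to_K_mult algebra_simps)
    also have "fls_nth (A_to_K (\<mu> l) * w l) (1 - int N) = 0"
    proof -
      have "Polynomial.degree (\<mu> l) < Suc D"
        using D l by (simp add: less_Suc_eq_le)
      then show ?thesis
        by (subst A_to_K_times_nth) (auto intro!: sum.neutral simp: w N_def)
    qed
    ultimately show ?thesis
      by simp
  qed
  then have "(\<Sum>l\<in>S. res_pairing (\<mu> l) (b l)) = (\<Sum>l\<in>S. fls_nth (A_to_K (a l * \<mu> l)) (1 - int N))"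
    by simp
  also have "\<dots> = fls_nth (A_to_K (\<Sum>l\<in>S. a l * \<mu> l)) (1 - int N)"
    by (simp add: A_to_K_nth coeff_sum)
  also have "(\<Sum>l\<in>S. a l * \<mu> l) = \<mu> y"
    unfolding y_def using S by (subst dual_sum[OF \<mu>]) auto
  also have "fls_nth (A_to_K (\<mu> y)) (1 - int N) = 0"
    using deg_y by (simp add: A_to_K_nth N_def coeff_eq_0 nat_add_distrib)
  finally show ?thesis .
qed

text \<open>Two expressions of one element, extended by 0 to the union of their supports, differ by
  a relation, and the pairing vanishes on relations.\<close>

lemma pairing_eq:
  assumes \<mu>: "\<mu> \<in> dual" and S: "finite S" "S \<subseteq> L"
  shows "lattice_pairing j L \<mu> (\<Sum>l\<in>S. K_to_C j (b l) * l) = (\<Sum>l\<in>S. res_pairing (\<mu> l) (b l))"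
  unfolding lattice_pairing_def
proof (rule the_equality)
  show "\<exists>S' b'. finite S' \<and> S' \<subseteq> L \<and> (\<Sum>l\<in>S. K_to_C j (b l) * l) = (\<Sum>l\<in>S'. K_to_C j (b' l) * l)
      \<and> (\<Sum>l\<in>S. res_pairing (\<mu> l) (b l)) = (\<Sum>l\<in>S'. res_pairing (\<mu> l) (b' l))"
    using S by blast
next
  fix v
  assume "\<exists>S' b'. finite S' \<and> S' \<subseteq> L \<and> (\<Sum>l\<in>S. K_to_C j (b l) * l) = (\<Sum>l\<in>S'. K_to_C j (b' l) * l)
      \<and> v = (\<Sum>l\<in>S'. res_pairing (\<mu> l) (b' l))"
  then obtain S' b' where S': "finite S'" "S' \<subseteq> L"
    "(\<Sum>l\<in>S. K_to_C j (b l) * l) = (\<Sum>l\<in>S'. K_to_C j (b' l) * l)"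
    "v = (\<Sum>l\<in>S'. res_pairing (\<mu> l) (b' l))"
    by blast
  let ?U = "S \<union> S'"
  define c where "c l = (if l \<in> S then b l else 0)" for l
  define c' where "c' l = (if l \<in> S' then b' l else 0)" for l
  have ext: "(\<Sum>l\<in>S. K_to_C j (b l) * l) = (\<Sum>l\<in>?U. K_to_C j (c l) * l)"
    "(\<Sum>l\<in>S'. K_to_C j (b' l) * l) = (\<Sum>l\<in>?U. K_to_C j (c' l) * l)"
    "(\<Sum>l\<in>S. res_pairing (\<mu> l) (b l)) = (\<Sum>l\<in>?U. res_pairing (\<mu> l) (c l))"
    "(\<Sum>l\<in>S'. res_pairing (\<mu> l) (b' l)) = (\<Sum>l\<in>?U. res_pairing (\<mu> l) (c' l))"
    using S S'(1,2) by (auto intro!: sum.mono_neutral_cong_left simp: c_def c'_def K_to_C_hom)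
  have "(\<Sum>l\<in>?U. res_pairing (\<mu> l) (c' l - c l)) = 0"
    using S S' ext by (intro relation_pairing_eq_0[OF \<mu>]) (auto simp: K_to_C_diff left_diff_distrib sum_subtractf)
  then show "v = (\<Sum>l\<in>S. res_pairing (\<mu> l) (b l))"
    unfolding S'(4) ext by (simp add: res_pairing_diff sum_subtractf)
qed

lemma pairing_K_scale:
  assumes "\<mu> \<in> dual" "l \<in> L"
  shows "lattice_pairing j L \<mu> (K_to_C j b * l) = res_pairing (\<mu> l) b"
  using pairing_eq[OF assms(1), of "{l}" "\<lambda>_. b"] assms(2) by simp

lemma pairing_add:
  assumes "\<mu> \<in> dual" "x \<in> KL" "y \<in> KL"
  shows "lattice_pairing j L \<mu> (x + y) = lattice_pairing j L \<mu> x + lattice_pairing j L \<mu> y"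
proof -
  obtain b b' where b: "x = (\<Sum>g\<in>G. K_to_C j (b g) * g)" "y = (\<Sum>g\<in>G. K_to_C j (b' g) * g)"
    using assms KL_generated by meson
  have "x + y = (\<Sum>g\<in>G. K_to_C j (b g + b' g) * g)"
    by (simp add: b K_to_C_hom distrib_right sum.distrib)
  then show ?thesis
    using pairing_eq[OF assms(1) G] by (simp only: b res_pairing_add sum.distrib)
qed

lemma pairing_Fq:
  assumes "\<mu> \<in> dual" "x \<in> KL"
  shows "lattice_pairing j L \<mu> (Fq_to_C j c * x) = c * lattice_pairing j L \<mu> x"
proof -
  obtain b where b: "x = (\<Sum>g\<in>G. K_to_C j (b g) * g)"
    using assms KL_generated by meson
  have "Fq_to_C j c * x = (\<Sum>g\<in>G. K_to_C j (fls_const c * b g) * g)"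
    unfolding b sum_distrib_left
    by (intro sum.cong refl) (simp only: Fq_to_C_def K_to_C_hom mult.assoc)
  then show ?thesis
    using pairing_eq[OF assms(1) G] by (simp only: b res_pairing_const_mult sum_distrib_left)
qed

lemma pairing_zero: "\<mu> \<in> dual \<Longrightarrow> lattice_pairing j L \<mu> 0 = 0"
  using pairing_Fq[of \<mu> 0 0] KL_zero by simp

lemma pairing_diff:
  assumes "\<mu> \<in> dual" "x \<in> KL" "y \<in> KL"
  shows "lattice_pairing j L \<mu> (x - y) = lattice_pairing j L \<mu> x - lattice_pairing j L \<mu> y"
  using pairing_add[of \<mu> "x - y" y] assms KL_diff by (simp add: eq_diff_eq)

lemma pairing_sum:
  assumes "\<mu> \<in> dual" "\<And>i. i \<in> A \<Longrightarrow> f i \<in> KL"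
  shows "lattice_pairing j L \<mu> (\<Sum>i\<in>A. Fq_to_C j (c i) * f i) = (\<Sum>i\<in>A. c i * lattice_pairing j L \<mu> (f i))
    \<and> (\<Sum>i\<in>A. Fq_to_C j (c i) * f i) \<in> KL"
  using assms(2)
  by (induction A rule: infinite_finite_induct)
    (auto simp: pairing_zero assms KL_zero pairing_add pairing_Fq KL_Fq KL_add)

lemma pairing_span_eq_0:
  assumes "W \<subseteq> dual" "w \<in> FqH.span W" "w \<in> dual" "x \<in> KL"
    and "\<And>\<mu>. \<mu> \<in> W \<Longrightarrow> lattice_pairing j L \<mu> x = 0"
  shows "lattice_pairing j L w x = 0"
proof -
  obtain b where b: "x = (\<Sum>g\<in>G. K_to_C j (b g) * g)"
    using assms KL_generated by meson
  have "(\<Sum>g\<in>G. res_pairing (w g) (b g)) = 0"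
    using assms(2)
  proof (induction rule: FqH.span_induct_alt)
    case (step c \<mu> \<nu>)
    have "(\<Sum>g\<in>G. res_pairing (\<mu> g) (b g)) = 0"
      using assms(5)[OF step(1)] pairing_eq[of \<mu> G b] G step(1) assms(1) by (auto simp: b)
    then show ?case
      using step(2)
      by (simp add: Fq_scale_hom_def res_pairing_add_left res_pairing_smult_left sum.distrib
          flip: sum_distrib_left)
  qed simp
  then show ?thesis
    using pairing_eq[OF assms(3) G] by (simp add: b)
qed

lemma K_scale_decomposition:
  obtains a w where "K_to_C j b * l = A_to_C j a * l +
      (\<Sum>n<N. Fq_to_C j (fls_nth b (int n + 1)) * (K_to_C j (fls_X ^ Suc n) * l)) + K_to_C j w * l"
    "absv (K_to_C j w * l) \<le> absv l / real CARD('a) ^ N"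
proof -
  obtain a w where b: "b = A_to_K a + (\<Sum>n<N. fls_const (fls_nth b (int n + 1)) * fls_X ^ Suc n) + w"
    and w: "\<And>i. i \<le> int N \<Longrightarrow> fls_nth w i = 0"
    using fls_decomposition by blast
  have "K_to_C j b = A_to_C j a +
      (\<Sum>n<N. Fq_to_C j (fls_nth b (int n + 1)) * K_to_C j (fls_X ^ Suc n)) + K_to_C j w"
    by (subst b) (simp only: K_to_C_hom K_to_C_sum A_to_C_def Fq_to_C_def)
  then have 1: "K_to_C j b * l = A_to_C j a * l +
      (\<Sum>n<N. Fq_to_C j (fls_nth b (int n + 1)) * (K_to_C j (fls_X ^ Suc n) * l)) + K_to_C j w * l"
    by (simp only: distrib_right sum_distrib_right mult.assoc)
  have "absv (K_to_C j w * l) \<le> 1 / real CARD('a) ^ N * absv l"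
    unfolding absv_mult absv_K_to_C using w by (intro mult_right_mono abs_K_le absv_nonneg) auto
  then show ?thesis
    using that[OF 1] by simp
qed

lemma ex_power_less:
  assumes "0 < d"
  shows "\<exists>N. \<forall>n\<ge>N. x / real CARD('a) ^ n < d"
proof -
  have q: "1 < real CARD('a)"
    using card_field_gt_1[where 'a = 'a] by simp
  then obtain N where N: "x / d < real CARD('a) ^ N"
    using real_arch_pow by blast
  have "x / real CARD('a) ^ n < d" if "n \<ge> N" for n
  proof -
    have "real CARD('a) ^ N \<le> real CARD('a) ^ n"
      using that q by (intro power_increasing) auto
    then have "x / d < real CARD('a) ^ n"
      using N by linarith
    then show ?thesis
      using assms q by (subst pos_divide_less_eq) (auto simp: pos_divide_less_eq mult.commute)
  qed
  then show ?thesis by blast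
qed

text \<open>The form representing a functional f has the coefficients \<open>f(\<theta>\<^bsup>-n-1\<^esup>l)\<close>.\<close>

lemma continuous_functional_is_pairing:
  fixes f :: "'c \<Rightarrow> 'a"
  assumes f_add: "\<And>x y. x \<in> KL \<Longrightarrow> y \<in> KL \<Longrightarrow> f (x + y) = f x + f y"
    and f_Fq: "\<And>c x. x \<in> KL \<Longrightarrow> f (Fq_to_C j c * x) = c * f x"
    and f_L: "\<And>l. l \<in> L \<Longrightarrow> f l = 0"
    and f_small: "\<And>x. x \<in> KL \<Longrightarrow> absv x < d \<Longrightarrow> f x = 0" and d: "0 < d"
  shows "\<exists>\<mu>\<in>dual. \<forall>x\<in>KL. lattice_pairing j L \<mu> x = f x"
proof -
  define \<mu> where "\<mu> l = (if l \<in> L then Abs_poly (\<lambda>n. f (K_to_C j (fls_X ^ Suc n) * l)) else 0)" for l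
  have coeff: "poly.coeff (\<mu> l) n = f (K_to_C j (fls_X ^ Suc n) * l)" if l: "l \<in> L" for l n
  proof -
    \<comment> \<open>Vanishing of f near 0 makes the coefficient sequence eventually zero, so
      \<open>Abs_poly\<close> really has these coefficients.\<close>
    obtain N where N: "\<And>n. n \<ge> N \<Longrightarrow> absv l / real CARD('a) ^ n < d"
      using ex_power_less[OF d] by blast
    have "f (K_to_C j (fls_X ^ Suc n) * l) = 0" if "n > N" for n
      using that N[of "Suc n"] l
      by (intro f_small KL_scale) (simp_all only: absv_mult absv_K_to_C_X_power, simp)
    then have "poly.coeff (Abs_poly (\<lambda>n. f (K_to_C j (fls_X ^ Suc n) * l))) = (\<lambda>n. f (K_to_C j (fls_X ^ Suc n) * l))"
      by (rule coeff_Abs_poly)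
    then show ?thesis
      using l by (simp add: \<mu>_def)
  qed
  have f_sum: "f (sum g A) = (\<Sum>i\<in>A. f (g i)) \<and> sum g A \<in> KL" if "\<And>i. i \<in> A \<Longrightarrow> g i \<in> KL"
    for g :: "'i \<Rightarrow> 'c" and A
    using that
    by (induction A rule: infinite_finite_induct) (auto simp: f_add KL_add KL_zero f_L L_zero)
  have \<mu>_add: "\<mu> (x + y) = \<mu> x + \<mu> y" if "x \<in> L" "y \<in> L" for x y
    using that by (intro poly_eqI) (simp add: coeff L_add distrib_left f_add KL_scale)
  have \<mu>_Fq: "\<mu> (Fq_to_C j c * x) = Polynomial.smult c (\<mu> x)" if "x \<in> L" for c x
    using that by (intro poly_eqI) (simp add: coeff L_Fq mult.left_commute[of _ "Fq_to_C j c"] f_Fq KL_scale)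
  \<comment> \<open>Multiplication by theta shifts the coefficients by one; the new constant
    coefficient is the value of f at a lattice element, hence 0.\<close>
  have \<mu>_theta: "\<mu> (theta_C j * x) = pCons 0 (\<mu> x)" if x: "x \<in> L" for x
  proof (rule poly_eqI)
    fix n
    have eq: "K_to_C j (fls_X ^ Suc n) * (theta_C j * x) = K_to_C j (fls_X ^ n) * x"
      unfolding K_to_C_X_power using theta_neq_0 by simp
    have "poly.coeff (\<mu> (theta_C j * x)) n = f (K_to_C j (fls_X ^ n) * x)"
      by (simp only: coeff[OF L_scale[OF x]] eq)
    then show "poly.coeff (\<mu> (theta_C j * x)) n = poly.coeff (pCons 0 (\<mu> x)) n"
      using x by (cases n) (simp_all add: K_to_C_hom f_L coeff del: power_Suc)
  qed
  have "\<mu> (A_to_C j a * x) = a * \<mu> x" if "x \<in> L" for a x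
  proof (induction a)
    case 0
    have "\<mu> 0 = 0"
      using \<mu>_add[OF L_zero L_zero] by (metis add_0 add_cancel_right_right)
    then show ?case
      by (simp add: A_to_C_hom)
  next
    case (pCons c a)
    have "A_to_C j (pCons c a) = Fq_to_C j c + theta_C j * A_to_C j a"
      by (simp flip: A_to_C_hom)
    then have "A_to_C j (pCons c a) * x = Fq_to_C j c * x + theta_C j * (A_to_C j a * x)"
      by (simp only: distrib_right mult.assoc)
    then show ?case
      using that by (simp add: \<mu>_add L_Fq L_scale \<mu>_Fq \<mu>_theta pCons.IH)
  qed
  then have dual: "\<mu> \<in> dual"
    unfolding dual_lattice_def using \<mu>_add by (simp add: \<mu>_def)
  have step: "f (K_to_C j b * l) = res_pairing (\<mu> l) b" if l: "l \<in> L" for b l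
  proof -
    obtain N0 where N0: "\<And>n. n \<ge> N0 \<Longrightarrow> absv l / real CARD('a) ^ n < d"
      using ex_power_less[OF d] by blast
    \<comment> \<open>Large enough both for f to kill the tail and for the digits to cover the whole
      degree of \<open>\<mu> l\<close>.\<close>
    define N where "N = max N0 (Suc (Polynomial.degree (\<mu> l)))"
    obtain a w where dec: "K_to_C j b * l = A_to_C j a * l +
        (\<Sum>n<N. Fq_to_C j (fls_nth b (int n + 1)) * (K_to_C j (fls_X ^ Suc n) * l)) + K_to_C j w * l"
      and w: "absv (K_to_C j w * l) \<le> absv l / real CARD('a) ^ N"
      by (rule K_scale_decomposition[of b l N])
    let ?s = "\<Sum>n<N. Fq_to_C j (fls_nth b (int n + 1)) * (K_to_C j (fls_X ^ Suc n) * l)"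
    have s: "f ?s = (\<Sum>n<N. f (Fq_to_C j (fls_nth b (int n + 1)) * (K_to_C j (fls_X ^ Suc n) * l))) \<and> ?s \<in> KL"
      by (rule f_sum) (intro KL_Fq KL_scale l)
    have "f (K_to_C j w * l) = 0"
      using w N0[of N] by (intro f_small KL_scale l) (simp add: N_def)
    moreover have "f (A_to_C j a * l) = 0"
      by (intro f_L L_scale l)
    moreover have "A_to_C j a * l \<in> KL"
      unfolding A_to_C_def by (rule KL_scale[OF l])
    ultimately have "f (K_to_C j b * l) = (\<Sum>n<N. f (Fq_to_C j (fls_nth b (int n + 1)) * (K_to_C j (fls_X ^ Suc n) * l)))"
      unfolding dec using s KL_scale[OF l, of w] by (simp only: f_add KL_add add_0_left add_0_right)
    also have "\<dots> = (\<Sum>n<N. poly.coeff (\<mu> l) n * fls_nth b (int n + 1))"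
      by (intro sum.cong refl) (simp only: f_Fq[OF KL_scale[OF l]] coeff[OF l] mult.commute[of _ "fls_nth b _"])
    also have "\<dots> = res_pairing (\<mu> l) b"
      by (rule res_pairing_eq_sum[symmetric]) (simp add: N_def)
    finally show ?thesis .
  qed
  have "lattice_pairing j L \<mu> x = f x" if x: "x \<in> KL" for x
  proof -
    obtain b where b: "x = (\<Sum>g\<in>G. K_to_C j (b g) * g)"
      using KL_generated[OF x] by blast
    have "f x = (\<Sum>g\<in>G. f (K_to_C j (b g) * g))"
      unfolding b using f_sum[of G "\<lambda>g. K_to_C j (b g) * g"] G KL_scale by blast
    also have "\<dots> = (\<Sum>g\<in>G. res_pairing (\<mu> g) (b g))"
      using G step by (intro sum.cong) auto
    finally show ?thesis
      unfolding b using pairing_eq[OF dual G] by simp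
  qed
  with dual show ?thesis by blast
qed

text \<open>
  The quotient of the K-span by L plus a ball is finite, and its finitely many coordinate
  functionals come from the dual lattice.
\<close>

lemma dual_separates:
  assumes d: "0 < d"
  shows "\<exists>W. finite W \<and> W \<subseteq> dual \<and>
    (\<forall>x\<in>KL. (\<forall>w\<in>W. lattice_pairing j L w x = 0) \<longrightarrow> (\<exists>l\<in>L. absv (x - l) < d))"
proof -
  define Y where "Y = {y. \<exists>l\<in>L. absv (y - l) < d}"
  have L_Y: "l \<in> Y" if "l \<in> L" for l
    using that d by (auto simp: Y_def intro!: bexI[of _ l])
  have small_Y: "y \<in> Y" if "absv y < d" for y
    using that L_zero by (auto simp: Y_def intro!: bexI[of _ 0])
  have sub: "FqC.subspace Y"
  proof (rule FqC.subspaceI)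
    show "0 \<in> Y" by (rule L_Y[OF L_zero])
    show "x + y \<in> Y" if x: "x \<in> Y" and y: "y \<in> Y" for x y
    proof -
      obtain l l' where "l \<in> L" "absv (x - l) < d" "l' \<in> L" "absv (y - l') < d"
        using x y by (auto simp: Y_def)
      then show ?thesis
        using absv_add[of "x - l" "y - l'"] L_add
        by (auto simp: Y_def algebra_simps intro!: bexI[of _ "l + l'"])
    qed
    show "Fq_scale_C j c x \<in> Y" if x: "x \<in> Y" for c x
    proof -
      obtain l where l: "l \<in> L" "absv (x - l) < d"
        using x by (auto simp: Y_def)
      have "absv (Fq_to_C j c * x - Fq_to_C j c * l) = absv (Fq_to_C j c) * absv (x - l)"
        by (simp add: absv_mult flip: right_diff_distrib)
      also have "\<dots> < d"
        using l d by (simp add: absv_Fq_to_C)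
      finally show ?thesis
        using L_Fq[OF l(1)] by (auto simp: Y_def Fq_scale_C_def)
    qed
  qed
  define R where "R = Max (insert 0 (absv ` G))"
  have R: "absv g \<le> R" if "g \<in> G" for g
    unfolding R_def using that G by (intro Max_ge) auto
  obtain N where N: "R / real CARD('a) ^ N < d"
    using ex_power_less[OF d] by blast
  define E where "E = (\<lambda>(g, n). K_to_C j (fls_X ^ Suc n) * g) ` (G \<times> {..<N})"
  have "finite E"
    using G by (simp add: E_def)
  \<comment> \<open>A basis of \<open>Y\<close> will be extended by vectors from the finite set
    \<open>E\<close>. The coordinates along the added vectors vanish on \<open>Y\<close>, hence on
    the lattice and on small elements, which makes them continuous functionals.\<close>
  obtain BY where BY: "BY \<subseteq> Y" "FqC.independent BY" "Y \<subseteq> FqC.span BY"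
    by (rule FqC.maximal_independent_subset)
  obtain D where D: "BY \<subseteq> D" "D \<subseteq> BY \<union> E" "FqC.independent D" "BY \<union> E \<subseteq> FqC.span D"
    by (rule FqC.maximal_independent_subset_extend[of BY "BY \<union> E"]) (use BY in auto)
  have Y_span: "Y \<subseteq> FqC.span D"
    using BY(3) FqC.span_mono[OF D(1)] by blast
  have KL_span: "x \<in> FqC.span D" if x: "x \<in> KL" for x
  proof -
    obtain b where b: "x = (\<Sum>g\<in>G. K_to_C j (b g) * g)"
      using KL_generated[OF x] by blast
    have "K_to_C j (b g) * g \<in> FqC.span D" if g: "g \<in> G" for g
    proof -
      obtain a w where dec: "K_to_C j (b g) * g = A_to_C j a * g +
          (\<Sum>n<N. Fq_to_C j (fls_nth (b g) (int n + 1)) * (K_to_C j (fls_X ^ Suc n) * g)) + K_to_C j w * g"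
        and w: "absv (K_to_C j w * g) \<le> absv g / real CARD('a) ^ N"
        by (rule K_scale_decomposition[of "b g" g N])
      have "absv g / real CARD('a) ^ N \<le> R / real CARD('a) ^ N"
        using R[OF g] by (intro divide_right_mono) auto
      then have "K_to_C j w * g \<in> FqC.span D"
        using w N Y_span by (intro subsetD[OF Y_span] small_Y) linarith
      moreover have "A_to_C j a * g \<in> FqC.span D"
        using g G Y_span by (intro subsetD[OF Y_span] L_Y L_scale) auto
      moreover have "Fq_to_C j c * (K_to_C j (fls_X ^ Suc n) * g) \<in> FqC.span D" if "n < N" for c n
      proof -
        have "K_to_C j (fls_X ^ Suc n) * g \<in> E"
          unfolding E_def using that g by (intro image_eqI[of _ _ "(g, n)"]) auto
        then have "Fq_scale_C j c (K_to_C j (fls_X ^ Suc n) * g) \<in> FqC.span D"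
          using D by (intro FqC.span_scale) auto
        then show ?thesis
          by (simp only: Fq_scale_C_def)
      qed
      then have "(\<Sum>n<N. Fq_to_C j (fls_nth (b g) (int n + 1)) * (K_to_C j (fls_X ^ Suc n) * g)) \<in> FqC.span D"
        by (intro FqC.span_sum) simp
      ultimately show ?thesis
        unfolding dec by (intro FqC.span_add)
    qed
    then show ?thesis
      unfolding b by (rule FqC.span_sum)
  qed
  have "\<exists>\<mu>\<in>dual. \<forall>x\<in>KL. lattice_pairing j L \<mu> x = FqC.representation D x e" if e: "e \<in> D - BY" for e
  proof (rule continuous_functional_is_pairing[OF _ _ _ _ d])
    have Y0: "FqC.representation D y e = 0" if "y \<in> Y" for y
    proof -
      have "FqC.representation D y = FqC.representation BY y"
        using that BY by (intro FqC.representation_extend[OF D(3) _ D(1)]) auto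
      then show ?thesis
        using e FqC.representation_ne_zero[of BY y e] by auto
    qed
    show "FqC.representation D l e = 0" if "l \<in> L" for l
      by (rule Y0[OF L_Y[OF that]])
    show "FqC.representation D x e = 0" if "absv x < d" for x
      by (rule Y0[OF small_Y[OF that]])
    show "FqC.representation D (x + y) e = FqC.representation D x e + FqC.representation D y e"
      if "x \<in> KL" "y \<in> KL" for x y
      using that by (simp add: FqC.representation_add[OF D(3)] KL_span)
    show "FqC.representation D (Fq_to_C j c * x) e = c * FqC.representation D x e"
      if "x \<in> KL" for c x
      using that FqC.representation_scale[OF D(3), of x c] by (simp add: KL_span Fq_scale_C_def)
  qed
  then obtain m where m: "\<And>e. e \<in> D - BY \<Longrightarrow> m e \<in> dual"
    "\<And>e x. e \<in> D - BY \<Longrightarrow> x \<in> KL \<Longrightarrow> lattice_pairing j L (m e) x = FqC.representation D x e"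
    by metis
  have "\<exists>l\<in>L. absv (x - l) < d" if x: "x \<in> KL" "\<forall>w\<in>m ` (D - BY). lattice_pairing j L w x = 0" for x
  proof -
    have rep: "FqC.representation D x e \<noteq> 0 \<Longrightarrow> e \<in> BY" for e
      using x m FqC.representation_ne_zero[of D x e] by force
    have "x = (\<Sum>e | FqC.representation D x e \<noteq> 0. Fq_scale_C j (FqC.representation D x e) e)"
      using FqC.sum_nonzero_representation_eq[OF D(3) KL_span[OF x(1)]] by simp
    also have "\<dots> \<in> Y"
      using BY rep sub by (intro FqC.subspace_sum FqC.subspace_scale) auto
    finally show ?thesis
      by (simp add: Y_def)
  qed
  moreover have "finite (m ` (D - BY))"
    using D(2) \<open>finite E\<close> by (intro finite_imageI) (rule finite_subset[of _ E], auto)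
  ultimately show ?thesis
    using m(1) by (intro exI[of _ "m ` (D - BY)"]) blast
qed

section \<open>Existence of dual vectors and separation by finitely many basis elements\<close>

lemma dual_ext:
  assumes "\<mu> \<in> dual" "\<nu> \<in> dual" "\<And>g. g \<in> G \<Longrightarrow> \<mu> g = \<nu> g"
  shows "\<mu> = \<nu>"
proof
  fix z
  show "\<mu> z = \<nu> z"
  proof (cases "z \<in> L")
    case True
    then obtain a where a: "z = (\<Sum>g\<in>G. A_to_C j (a g) * g)"
      using G_generates by blast
    show ?thesis
      unfolding a using assms G by (subst (1 2) dual_sum) (auto intro!: sum.cong)
  qed (simp add: dualD(1)[OF assms(1)] dualD(1)[OF assms(2)])
qed

text \<open>Restriction to the generators embeds the dual in a space of polynomial-valued functions,
  where the image of \<open>B'\<close> extends to a basis; f is the coordinate along the image of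
  \<open>\<mu>\<close>. Its values on monomials form arbitrary sequences, and any sequence can serve
  as the digits of a Laurent series, so f is a pairing with an element of the K-span.\<close>

lemma dual_basis_exists:
  assumes B': "is_basis Fq_scale_hom B' dual" and \<mu>: "\<mu> \<in> B'"
  shows "\<exists>x\<in>KL. \<forall>\<nu>\<in>B'. lattice_pairing j L \<nu> x = (if \<nu> = \<mu> then 1 else 0)"
proof -
  have ind: "FqH.independent B'" and span: "FqH.span B' = dual"
    using B' by (auto simp: is_basis_def)
  then have B'_dual: "B' \<subseteq> dual"
    using FqH.span_superset by blast
  define E :: "('c \<Rightarrow> 'a differential) \<Rightarrow> ('c \<Rightarrow> 'a differential)"
    where "E h = (\<lambda>z. if z \<in> G then h z else 0)" for h
  interpret E: Vector_Spaces.linear Fq_scale_hom Fq_scale_hom E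
    by unfold_locales (auto simp: E_def Fq_scale_hom_def fun_eq_iff smult_add_right smult_add_left)
  have inj: "inj_on E dual"
  proof (rule inj_onI)
    fix h k assume "h \<in> dual" "k \<in> dual" "E h = E k"
    then show "h = k"
      by (intro dual_ext) (auto simp: E_def fun_eq_iff split: if_splits)
  qed
  have "FqH.independent (E ` B')"
    by (rule E.independent_injective_image[OF ind]) (simp add: span inj)
  then obtain D where D: "E ` B' \<subseteq> D" "FqH.independent D" "UNIV \<subseteq> FqH.span D"
    by (rule FqH.maximal_independent_subset_extend[of "E ` B'" UNIV, OF subset_UNIV]) blast
  define f where "f h = FqH.representation D h (E \<mu>)" for h
  have span_D: "h \<in> FqH.span D" for h
    using D(3) by blast
  have f_scale: "f (Fq_scale_hom c h) = c * f h" for c h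
    by (simp add: f_def FqH.representation_scale[OF D(2) span_D])
  have f_sum: "f (sum h A) = (\<Sum>i\<in>A. f (h i))" for h :: "'i \<Rightarrow> ('c \<Rightarrow> 'a differential)" and A
    unfolding f_def by (subst FqH.representation_sum[OF D(2) span_D]) (rule refl)
  have f_E: "f (E \<nu>) = (if \<nu> = \<mu> then 1 else 0)" if "\<nu> \<in> B'" for \<nu>
  proof -
    have "f (E \<nu>) = (if E \<mu> = E \<nu> then 1 else 0)"
      unfolding f_def using that D by (subst FqH.representation_basis) auto
    also have "E \<mu> = E \<nu> \<longleftrightarrow> \<nu> = \<mu>"
      using inj B'_dual that \<mu> by (auto dest: inj_onD)
    finally show ?thesis .
  qed
  define e :: "'c \<Rightarrow> nat \<Rightarrow> 'c \<Rightarrow> 'a differential"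
    where "e g n = (\<lambda>z. if z = g then Polynomial.monom 1 n else 0)" for g n
  \<comment> \<open>The factor \<open>fls_X\<close> moves the value of f on the monomial of degree n
    to index n + 1, where the residue pairing reads it.\<close>
  define b where "b g = fls_X * fps_to_fls (Abs_fps (\<lambda>n. f (e g n)))" for g
  have b_nth: "fls_nth (b g) (int n + 1) = f (e g n)" for g n
    by (simp add: b_def fls_X_times_conv_shift)
  have sum_apply: "sum h A z = (\<Sum>i\<in>A. h i z)" for h :: "'i \<Rightarrow> ('c \<Rightarrow> 'a differential)" and A z
    by (induction A rule: infinite_finite_induct) auto
  have E_sum: "E \<nu> = (\<Sum>g\<in>G. \<Sum>n<Suc (Polynomial.degree (\<nu> g)). Fq_scale_hom (poly.coeff (\<nu> g) n) (e g n))" for \<nu>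
  proof
    fix z
    have "(\<Sum>n<Suc (Polynomial.degree (\<nu> g)). Fq_scale_hom (poly.coeff (\<nu> g) n) (e g n) z)
        = (if g = z then \<nu> z else 0)" for g
    proof (cases "g = z")
      case True
      then show ?thesis
        using poly_as_sum_of_monoms[of "\<nu> z"]
        by (simp add: Fq_scale_hom_def e_def smult_monom lessThan_Suc_atMost)
    qed (simp add: Fq_scale_hom_def e_def)
    then show "E \<nu> z = (\<Sum>g\<in>G. \<Sum>n<Suc (Polynomial.degree (\<nu> g)). Fq_scale_hom (poly.coeff (\<nu> g) n) (e g n)) z"
      unfolding sum_apply using G by (simp add: E_def del: sum.lessThan_Suc)
  qed
  have "lattice_pairing j L \<nu> (\<Sum>g\<in>G. K_to_C j (b g) * g) = (if \<nu> = \<mu> then 1 else 0)" if \<nu>: "\<nu> \<in> B'" for \<nu>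
  proof -
    have "lattice_pairing j L \<nu> (\<Sum>g\<in>G. K_to_C j (b g) * g) = (\<Sum>g\<in>G. res_pairing (\<nu> g) (b g))"
      using \<nu> B'_dual by (intro pairing_eq G) auto
    also have "\<dots> = (\<Sum>g\<in>G. \<Sum>n<Suc (Polynomial.degree (\<nu> g)). poly.coeff (\<nu> g) n * f (e g n))"
      by (intro sum.cong refl) (simp only: res_pairing_eq_sum[OF lessI] b_nth)
    also have "\<dots> = f (E \<nu>)"
      by (simp only: E_sum f_sum f_scale)
    finally show ?thesis
      by (simp only: f_E[OF \<nu>])
  qed
  then show ?thesis
    using KL_sum[OF G(2)] by blast
qed

lemma dual_basis_rep:
  assumes "is_basis Fq_scale_hom B' dual" "\<mu> \<in> B'"
  shows "dual_basis_rep j L B' \<mu> \<in> KL"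
    and "\<nu> \<in> B' \<Longrightarrow> lattice_pairing j L \<nu> (dual_basis_rep j L B' \<mu>) = (if \<nu> = \<mu> then 1 else 0)"
proof -
  have "dual_basis_rep j L B' \<mu> \<in> KL \<and>
      (\<forall>\<nu>\<in>B'. lattice_pairing j L \<nu> (dual_basis_rep j L B' \<mu>) = (if \<nu> = \<mu> then 1 else 0))"
    unfolding dual_basis_rep_def by (rule someI_ex) (use dual_basis_exists[OF assms] in blast)
  then show "dual_basis_rep j L B' \<mu> \<in> KL"
    "\<nu> \<in> B' \<Longrightarrow> lattice_pairing j L \<nu> (dual_basis_rep j L B' \<mu>) = (if \<nu> = \<mu> then 1 else 0)"
    by blast+
qed

text \<open>Each of the finitely many separating elements is a finite combination of members of
  \<open>B'\<close>; collecting these members suffices.\<close>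

lemma dual_basis_separates:
  assumes B': "is_basis Fq_scale_hom B' dual" and d: "0 < d"
  shows "\<exists>F\<subseteq>B'. finite F \<and>
    (\<forall>x\<in>KL. (\<forall>\<mu>\<in>F. lattice_pairing j L \<mu> x = 0) \<longrightarrow> (\<exists>l\<in>L. absv (x - l) < d))"
proof -
  obtain W where W: "finite W" "W \<subseteq> dual"
    "\<And>x. x \<in> KL \<Longrightarrow> (\<forall>w\<in>W. lattice_pairing j L w x = 0) \<Longrightarrow> \<exists>l\<in>L. absv (x - l) < d"
    using dual_separates[OF d] by blast
  have span: "FqH.span B' = dual"
    using B' by (simp add: is_basis_def)
  have "\<exists>t. finite t \<and> t \<subseteq> B' \<and> w \<in> FqH.span t" if "w \<in> W" for w
  proof -
    have "w \<in> FqH.span B'"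
      using that W span by auto
    then obtain t r where t: "finite t" "t \<subseteq> B'" "w = (\<Sum>a\<in>t. Fq_scale_hom (r a) a)"
      unfolding FqH.span_explicit by blast
    then have "w \<in> FqH.span t"
      unfolding t(3) by (intro FqH.span_sum FqH.span_scale FqH.span_base)
    then show ?thesis
      using t by blast
  qed
  then obtain t where t: "\<And>w. w \<in> W \<Longrightarrow> finite (t w)" "\<And>w. w \<in> W \<Longrightarrow> t w \<subseteq> B'"
    "\<And>w. w \<in> W \<Longrightarrow> w \<in> FqH.span (t w)"
    by metis
  have "B' \<subseteq> dual"
    using span FqH.span_superset by blast
  then have zero: "lattice_pairing j L w x = 0"
    if "w \<in> W" "x \<in> KL" "\<forall>\<mu>\<in>\<Union> (t ` W). lattice_pairing j L \<mu> x = 0" for w x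
    using that t[OF that(1)] W by (intro pairing_span_eq_0[of "t w" w x]) auto
  show ?thesis
  proof (intro exI[of _ "\<Union> (t ` W)"] conjI ballI impI)
    show "\<Union> (t ` W) \<subseteq> B'"
      by (intro UN_least t(2))
    show "finite (\<Union> (t ` W))"
      by (intro finite_UN_I W(1) t(1))
    fix x assume x: "x \<in> KL" and x0: "\<forall>\<mu>\<in>\<Union> (t ` W). lattice_pairing j L \<mu> x = 0"
    have "\<forall>w\<in>W. lattice_pairing j L w x = 0"
      by (rule ballI) (rule zero[OF _ x x0])
    then show "\<exists>l\<in>L. absv (x - l) < d"
      by (rule W(3)[OF x])
  qed
qed

end

section \<open>The product of zeta and omega\<close>

lemma completed_tensor_bounded:
  assumes "x \<in> completed_tensor I"
  obtains M where "1 \<le> M" "\<And>i. absv (x i) \<le> M"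
proof -
  let ?A = "{i \<in> I. 1 \<le> absv (x i)}"
  define M where "M = Max (insert 1 ((\<lambda>i. absv (x i)) ` ?A))"
  have fin: "finite ?A"
    using assms by (simp add: completed_tensor_def)
  have "absv (x i) \<le> M" for i
  proof (cases "i \<in> ?A")
    case True
    then show ?thesis unfolding M_def using fin by (intro Max_ge) auto
  next
    case False
    then have "absv (x i) \<le> 1"
      using assms by (cases "i \<in> I") (auto simp: completed_tensor_def)
    also have "1 \<le> M"
      unfolding M_def using fin by (intro Max_ge) auto
    finally show ?thesis .
  qed
  moreover have "1 \<le> M"
    unfolding M_def using fin by (intro Max_ge) auto
  ultimately show ?thesis
    using that by blast
qed

locale drinfeld_dual_bases = drinfeld j \<phi> + Lat: lattice j "period_lattice j \<phi>" G
  for j :: "'a::{finite, field} fls alg_closure \<Rightarrow> 'c::{ultrametric_field, complete_space}"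
    and \<phi> :: "'a poly \<Rightarrow> 'c poly" and G +
  fixes B :: "'c set" and B' :: "('c \<Rightarrow> 'a differential) set"
  assumes B: "is_basis (Fq_scale_C j) B (period_lattice j \<phi>)"
    and B': "is_basis Fq_scale_hom B' (dual_lattice j (period_lattice j \<phi>))"
begin

interpretation FqC: vector_space "Fq_scale_C j"
  by (rule vector_space_Fq_scale_C)

interpretation FqH: vector_space "Fq_scale_hom :: 'a \<Rightarrow> ('c \<Rightarrow> 'a differential) \<Rightarrow> _"
  by (rule vector_space_Fq_scale_hom)

abbreviation pr :: "('c \<Rightarrow> 'a differential) \<Rightarrow> 'c \<Rightarrow> 'a" where "pr \<equiv> lattice_pairing j L"

abbreviation omega :: "('c \<Rightarrow> 'a differential) \<Rightarrow> 'c" where "omega \<equiv> drinfeld_omega j \<phi> B'"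

abbreviation zeta :: "'c \<Rightarrow> 'c" where "zeta \<equiv> drinfeld_zeta j \<phi> B"

abbreviation rB :: "'c \<Rightarrow> 'c \<Rightarrow> 'a" where "rB \<equiv> FqC.representation B"

lemma B_props: "FqC.independent B" "FqC.span B = L" "B \<subseteq> L"
  using B FqC.span_superset[of B] by (auto simp: is_basis_def)

lemma B'_props: "B' \<subseteq> dual_lattice j L"
  using B' FqH.span_superset[of B'] by (auto simp: is_basis_def)

text \<open>exp kills the periods and is an isometry near 0, so closeness to a period makes exp
  small. The finite set depends on e but not on x, which yields both the decay of omega and its
  expansions.\<close>

lemma exp_small_if_pairing_eq_0:
  assumes e: "0 < e"
  shows "\<exists>F\<subseteq>B'. finite F \<and> (\<forall>x\<in>K_span j L. (\<forall>\<mu>\<in>F. pr \<mu> x = 0) \<longrightarrow> absv (ex x) < e)"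
proof -
  define d where "d = min e (1 / coeff_bound)"
  have d: "0 < d" "d \<le> e" "coeff_bound * d \<le> 1"
    using e coeff_bound_ge_1 by (auto simp: d_def min_def field_simps)
  obtain F where F: "F \<subseteq> B'" "finite F"
    "\<And>x. x \<in> K_span j L \<Longrightarrow> (\<forall>\<mu>\<in>F. pr \<mu> x = 0) \<Longrightarrow> \<exists>l\<in>L. absv (x - l) < d"
    using Lat.dual_basis_separates[OF B' d(1)] by blast
  have "absv (ex x) < e" if x: "x \<in> K_span j L" and x0: "\<forall>\<mu>\<in>F. pr \<mu> x = 0" for x
  proof -
    obtain l where l: "l \<in> L" "absv (x - l) < d"
      using F(3)[OF x x0] by blast
    have "coeff_bound * absv (x - l) < coeff_bound * d"
      using l coeff_bound_ge_1 by (intro mult_strict_left_mono) auto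
    then have "absv (ex (x - l)) = absv (x - l)"
      using d by (intro absv_exp_small) linarith
    then show ?thesis
      using l d by (simp add: exp_diff L_iff)
  qed
  then show ?thesis
    using F(1,2) by blast
qed

lemma omega_eq: "\<mu> \<in> B' \<Longrightarrow> omega \<mu> = ex (dual_basis_rep j L B' \<mu>)"
  by (simp add: drinfeld_omega_def)

text \<open>The dual vector of a basis element outside \<open>F\<close> pairs to 0 with all of
  \<open>F\<close>, so exp is small on it. Values below 1 do not grow under q^k-th powers, hence the
  bound \<open>min e 1\<close>.\<close>

lemma omega_completed_tensor: "twist CARD('a) k omega \<in> completed_tensor B'"
  unfolding completed_tensor_def
proof (intro CollectI conjI allI impI)
  fix e :: real assume "0 < e"
  then have e: "0 < min e 1"
    by simp
  obtain F where F: "F \<subseteq> B'" "finite F"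
    "\<And>x. x \<in> K_span j L \<Longrightarrow> (\<forall>\<mu>\<in>F. pr \<mu> x = 0) \<Longrightarrow> absv (ex x) < min e 1"
    using exp_small_if_pairing_eq_0[OF e] by blast
  have "absv (twist CARD('a) k omega \<mu>) < e" if \<mu>: "\<mu> \<in> B'" "\<mu> \<notin> F" for \<mu>
  proof -
    have "\<forall>\<nu>\<in>F. pr \<nu> (dual_basis_rep j L B' \<mu>) = 0"
      using Lat.dual_basis_rep(2)[OF B' \<mu>(1)] F(1) \<mu>(2) by auto
    then have "absv (omega \<mu>) < min e 1"
      unfolding omega_eq[OF \<mu>(1)] by (intro F(3) Lat.dual_basis_rep(1)[OF B' \<mu>(1)])
    moreover have "absv (omega \<mu>) ^ (CARD('a) ^ k) \<le> absv (omega \<mu>) ^ 1"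
      using calculation card_field_gt_1[where 'a = 'a] by (intro power_decreasing) (auto simp: absv_nonneg Suc_leI)
    ultimately show ?thesis
      by (simp add: twist_def absv_power)
  qed
  then have "{\<mu> \<in> B'. e \<le> absv (twist CARD('a) k omega \<mu>)} \<subseteq> F"
    by force
  then show "finite {\<mu> \<in> B'. e \<le> absv (twist CARD('a) k omega \<mu>)}"
    using F(2) finite_subset by blast
next
  fix \<mu> assume "\<mu> \<notin> B'"
  then show "twist CARD('a) k omega \<mu> = 0"
    by (simp add: twist_def drinfeld_omega_def)
qed

text \<open>The combination of dual vectors with the coefficients of \<open>\<mu> z\<close> has the
  same pairings with \<open>F0\<close> as z / theta^(n+1), so exp nearly agrees on the two.
  Additivity of Frobenius carries the estimate to the twist.\<close>

lemma omega_expansion: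
  assumes z: "z \<in> L" and e: "0 < e"
  shows "\<exists>F0\<subseteq>B'. finite F0 \<and> (\<forall>F. finite F \<and> F0 \<subseteq> F \<and> F \<subseteq> B' \<longrightarrow>
    absv (ex (z / T ^ Suc n) ^ (CARD('a) ^ k)
      - (\<Sum>\<mu>\<in>F. Fq_to_C j (poly.coeff (\<mu> z) n) * twist CARD('a) k omega \<mu>)) < e)"
proof -
  have e1: "0 < min e 1"
    using e by simp
  obtain F0 where F0: "F0 \<subseteq> B'" "finite F0"
    "\<And>x. x \<in> K_span j L \<Longrightarrow> (\<forall>\<mu>\<in>F0. pr \<mu> x = 0) \<Longrightarrow> absv (ex x) < min e 1"
    using exp_small_if_pairing_eq_0[OF e1] by blast
  have "absv (ex (z / T ^ Suc n) ^ (CARD('a) ^ k)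
      - (\<Sum>\<mu>\<in>F. Fq_to_C j (poly.coeff (\<mu> z) n) * twist CARD('a) k omega \<mu>)) < e"
    if F: "finite F" "F0 \<subseteq> F" "F \<subseteq> B'" for F
  proof -
    let ?s = "\<Sum>\<mu>\<in>F. Fq_to_C j (poly.coeff (\<mu> z) n) * dual_basis_rep j L B' \<mu>"
    have zK: "z / T ^ Suc n = K_to_C j (fls_X ^ Suc n) * z"
      unfolding K_to_C_X_power by simp
    have zKL: "z / T ^ Suc n \<in> K_span j L"
      unfolding zK by (rule Lat.KL_scale[OF z])
    have s: "pr \<nu> ?s = (\<Sum>\<mu>\<in>F. poly.coeff (\<mu> z) n * pr \<nu> (dual_basis_rep j L B' \<mu>)) \<and> ?s \<in> K_span j L"
      if "\<nu> \<in> B'" for \<nu>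
      using that F B'_props by (intro Lat.pairing_sum Lat.dual_basis_rep(1)[OF B']) auto
    have "absv (ex (z / T ^ Suc n - ?s)) < min e 1"
    \<comment> \<open>The membership part of \<open>s\<close> is available only through some element
      of \<open>B'\<close>, so an empty \<open>F\<close> is treated apart; then \<open>F0\<close> is
      empty as well.\<close>
    proof (cases "F = {}")
      case True
      then show ?thesis
        using F0(3)[OF zKL] F(2) by simp
    next
      case False
      then have sKL: "?s \<in> K_span j L"
        using s F by blast
      show ?thesis
      proof (rule F0(3)[OF Lat.KL_diff[OF zKL sKL]], rule ballI)
        fix \<nu> assume \<nu>: "\<nu> \<in> F0"
        then have \<nu>': "\<nu> \<in> B'" "\<nu> \<in> F" "\<nu> \<in> dual_lattice j L"
          using F F0 B'_props by auto
        have "pr \<nu> ?s = (\<Sum>\<mu>\<in>F. if \<mu> = \<nu> then poly.coeff (\<nu> z) n else 0)"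
          unfolding conjunct1[OF s[OF \<nu>'(1)]]
        proof (rule sum.cong[OF refl])
          fix \<mu> assume "\<mu> \<in> F"
          then have "\<mu> \<in> B'"
            using F by auto
          then show "poly.coeff (\<mu> z) n * pr \<nu> (dual_basis_rep j L B' \<mu>) = (if \<mu> = \<nu> then poly.coeff (\<nu> z) n else 0)"
            by (simp add: Lat.dual_basis_rep(2)[OF B' _ \<nu>'(1)])
        qed
        also have "\<dots> = poly.coeff (\<nu> z) n"
          using F \<nu>' by simp
        also have "\<dots> = pr \<nu> (z / T ^ Suc n)"
          unfolding zK Lat.pairing_K_scale[OF \<nu>'(3) z] by (rule res_pairing_X_power[symmetric])
        finally show "pr \<nu> (z / T ^ Suc n - ?s) = 0"
          unfolding Lat.pairing_diff[OF \<nu>'(3) zKL sKL] by simp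
      qed
    qed
    then have small: "absv (ex (z / T ^ Suc n - ?s)) < e" "absv (ex (z / T ^ Suc n - ?s)) < 1"
      by auto
    have "ex ?s = (\<Sum>\<mu>\<in>F. Fq_to_C j (poly.coeff (\<mu> z) n) * omega \<mu>)"
      unfolding exp_sum exp_Fq using F by (intro sum.cong) (auto simp: omega_eq)
    then have "ex ?s ^ (CARD('a) ^ k) = (\<Sum>\<mu>\<in>F. Fq_to_C j (poly.coeff (\<mu> z) n) * twist CARD('a) k omega \<mu>)"
      by (simp add: frobenius_sum power_mult_distrib frobenius_Fq twist_def)
    then have "absv (ex (z / T ^ Suc n) ^ (CARD('a) ^ k)
        - (\<Sum>\<mu>\<in>F. Fq_to_C j (poly.coeff (\<mu> z) n) * twist CARD('a) k omega \<mu>))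
        = absv (ex (z / T ^ Suc n - ?s)) ^ (CARD('a) ^ k)"
      by (simp only: exp_diff frobenius_diff absv_power[symmetric])
    also have "\<dots> \<le> absv (ex (z / T ^ Suc n - ?s)) ^ 1"
      using small card_field_gt_1[where 'a = 'a] by (intro power_decreasing) (auto simp: absv_nonneg Suc_leI)
    finally show ?thesis
      using small by simp
  qed
  then show ?thesis
    using F0(1,2) by blast
qed

text \<open>Nonzero constants have absolute value 1, so the member for z is bounded by 1/|z|, and
  discreteness leaves finitely many large members. Zeta carries a minus sign, which is why the
  partial sum is added.\<close>

lemma zeta_limit:
  shows "zeta \<in> completed_tensor B"
    and "0 < e \<Longrightarrow> \<exists>F0\<subseteq>L - {0}. finite F0 \<and> (\<forall>F. finite F \<and> F0 \<subseteq> F \<and> F \<subseteq> L - {0} \<longrightarrow>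
      (\<forall>l. absv (zeta l + (\<Sum>z\<in>F. inverse z * Fq_to_C j (rB z l))) < e))"
proof -
  let ?f = "\<lambda>z. pure_tensor j rB (inverse z) z"
  have le: "absv (?f z l) \<le> inverse (absv z)" for z l
    by (simp add: pure_tensor_def absv_mult absv_inverse absv_Fq_to_C absv_nonneg)
  have f: "?f z \<in> completed_tensor B" for z
    unfolding completed_tensor_def
  proof (intro CollectI conjI allI impI)
    show "?f z l = 0" if "l \<notin> B" for l
    proof -
      have "rB z l = 0"
        using FqC.representation_ne_zero[of B z l] that by blast
      then show ?thesis
        by (simp add: pure_tensor_def Fq_to_C_hom)
    qed
    fix e :: real assume "0 < e"
    then have "{l \<in> B. e \<le> absv (?f z l)} \<subseteq> {l. rB z l \<noteq> 0}"
      by (auto simp: pure_tensor_def Fq_to_C_hom)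
    then show "finite {l \<in> B. e \<le> absv (?f z l)}"
      using FqC.finite_representation finite_subset by blast
  qed
  have fin: "finite {z \<in> L - {0}. \<exists>l. e \<le> absv (?f z l)}" if e: "0 < e" for e
  proof (rule finite_subset[OF _ finite_ball_L[of "inverse e"]], rule subsetI)
    fix z assume "z \<in> {z \<in> L - {0}. \<exists>l. e \<le> absv (?f z l)}"
    then obtain l where z: "z \<in> L" "z \<noteq> 0" "e \<le> absv (?f z l)"
      by blast
    then have "e \<le> inverse (absv z)"
      using le order_trans by blast
    then have "absv z \<le> inverse e"
      using e le_imp_inverse_le[of e "inverse (absv z)"] by simp
    then show "z \<in> {z \<in> L. absv z \<le> inverse e}"
      using z by simp
  qed
  let ?Z = "tensor_sum B ?f (L - {0})"
  have zeta: "zeta l = - ?Z l" for l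
    by (simp add: drinfeld_zeta_def)
  show "zeta \<in> completed_tensor B"
    using tensor_sum_limit(1)[OF f fin] by (simp add: completed_tensor_def zeta)
  assume "0 < e"
  from tensor_sum_limit(2)[OF f fin this]
  obtain F0 where F0: "finite F0" "F0 \<subseteq> L - {0}"
    "\<And>F l. finite F \<Longrightarrow> F0 \<subseteq> F \<Longrightarrow> F \<subseteq> L - {0} \<Longrightarrow> absv ((\<Sum>z\<in>F. ?f z l) - ?Z l) < e"
    unfolding eventually_finite_subsets_at_top by meson
  have "absv (zeta l + (\<Sum>z\<in>F. inverse z * Fq_to_C j (rB z l))) < e"
    if "finite F" "F0 \<subseteq> F" "F \<subseteq> L - {0}" for F l
    using F0(3)[OF that, of l] by (simp add: zeta pure_tensor_def)
  then show "\<exists>F0\<subseteq>L - {0}. finite F0 \<and> (\<forall>F. finite F \<and> F0 \<subseteq> F \<and> F \<subseteq> L - {0} \<longrightarrow>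
      (\<forall>l. absv (zeta l + (\<Sum>z\<in>F. inverse z * Fq_to_C j (rB z l))) < e))"
    using F0(1,2) by blast
qed

text \<open>With x bounded by \<open>M\<close> and y by \<open>N\<close>, a product of size at least
  d forces both factors to be large, which happens for finitely many indices on either side.\<close>

lemma dot_limit:
  assumes x: "x \<in> completed_tensor B" and y: "y \<in> completed_tensor B'" and e: "0 < e"
  shows "\<exists>P0\<subseteq>B \<times> B'. finite P0 \<and> (\<forall>P. finite P \<and> P0 \<subseteq> P \<and> P \<subseteq> B \<times> B' \<longrightarrow>
    absv ((\<Sum>(l, \<mu>)\<in>P. x l * y \<mu> * Fq_to_C j (poly.coeff (\<mu> l) n)) - fps_nth (tensor_dot j B B' x y) n) < e)"
proof -
  obtain M where M: "1 \<le> M" "\<And>i. absv (x i) \<le> M"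
    by (rule completed_tensor_bounded[OF x]) blast
  obtain N where N: "1 \<le> N" "\<And>i. absv (y i) \<le> N"
    by (rule completed_tensor_bounded[OF y]) blast
  let ?f = "\<lambda>p. case p of (l, \<mu>) \<Rightarrow> pure_tensor j poly.coeff (x l * y \<mu>) (\<mu> l)"
  have f: "?f p \<in> completed_tensor UNIV" for p
  proof (cases p)
    case (Pair l \<mu>)
    have "{i. d \<le> absv (?f p i)} \<subseteq> {..Polynomial.degree (\<mu> l)}" if "0 < d" for d
    proof
      fix i assume "i \<in> {i. d \<le> absv (?f p i)}"
      then have "poly.coeff (\<mu> l) i \<noteq> 0"
        using that by (auto simp: Pair pure_tensor_def Fq_to_C_hom)
      then show "i \<in> {..Polynomial.degree (\<mu> l)}"
        using le_degree by blast
    qed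
    then show ?thesis
      using finite_subset by (fastforce simp: completed_tensor_def)
  qed
  have fin: "finite {p \<in> B \<times> B'. \<exists>i. d \<le> absv (?f p i)}" if d: "0 < d" for d
  proof (rule finite_subset)
    show "{p \<in> B \<times> B'. \<exists>i. d \<le> absv (?f p i)} \<subseteq>
      {l \<in> B. d / N \<le> absv (x l)} \<times> {\<mu> \<in> B'. d / M \<le> absv (y \<mu>)}"
    proof
      fix p assume p: "p \<in> {p \<in> B \<times> B'. \<exists>i. d \<le> absv (?f p i)}"
      obtain l \<mu> where lm: "p = (l, \<mu>)"
        by (cases p)
      obtain i where "d \<le> absv (?f p i)"
        using p by blast
      then have "d \<le> absv (x l) * absv (y \<mu>)"
        using d by (auto simp: lm pure_tensor_def absv_mult absv_Fq_to_C split: if_splits)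
      moreover have "absv (x l) * absv (y \<mu>) \<le> absv (x l) * N" "absv (x l) * absv (y \<mu>) \<le> M * absv (y \<mu>)"
        using M N by (auto intro!: mult_left_mono mult_right_mono simp: absv_nonneg)
      ultimately have "d \<le> absv (x l) * N" "d \<le> absv (y \<mu>) * M"
        by (auto simp: mult.commute)
      then show "p \<in> {l \<in> B. d / N \<le> absv (x l)} \<times> {\<mu> \<in> B'. d / M \<le> absv (y \<mu>)}"
        using p M N by (auto simp: lm pos_divide_le_eq)
    qed
    have "0 < d / N" "0 < d / M"
      using d M N by auto
    then show "finite ({l \<in> B. d / N \<le> absv (x l)} \<times> {\<mu> \<in> B'. d / M \<le> absv (y \<mu>)})"
      using x y by (intro finite_cartesian_product) (auto simp: completed_tensor_def)
  qed
  from tensor_sum_limit(2)[OF f fin e]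
  obtain P0 where P0: "finite P0" "P0 \<subseteq> B \<times> B'"
    "\<And>P i. finite P \<Longrightarrow> P0 \<subseteq> P \<Longrightarrow> P \<subseteq> B \<times> B' \<Longrightarrow> absv ((\<Sum>p\<in>P. ?f p i) - tensor_sum UNIV ?f (B \<times> B') i) < e"
    unfolding eventually_finite_subsets_at_top by meson
  have "absv ((\<Sum>(l, \<mu>)\<in>P. x l * y \<mu> * Fq_to_C j (poly.coeff (\<mu> l) n)) - fps_nth (tensor_dot j B B' x y) n) < e"
    if "finite P" "P0 \<subseteq> P" "P \<subseteq> B \<times> B'" for P
  proof -
    have "(\<Sum>p\<in>P. ?f p n) = (\<Sum>(l, \<mu>)\<in>P. x l * y \<mu> * Fq_to_C j (poly.coeff (\<mu> l) n))"
      by (intro sum.cong) (auto simp: pure_tensor_def)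
    then show ?thesis
      using P0(3)[OF that, of n] by (simp only: tensor_dot_def fps_nth_Abs_fps)
  qed
  then show ?thesis
    using P0(1,2) by blast
qed

lemma dual_eval:
  assumes \<mu>: "\<mu> \<in> dual_lattice j L" and z: "z \<in> L" and S: "finite S" "{l. rB z l \<noteq> 0} \<subseteq> S"
  shows "poly.coeff (\<mu> z) n = (\<Sum>l\<in>S. rB z l * poly.coeff (\<mu> l) n)"
proof -
  let ?R = "{l. rB z l \<noteq> 0}"
  have R: "?R \<subseteq> L"
    using FqC.representation_ne_zero[of B z] B_props(3) by auto
  have "z = (\<Sum>l\<in>?R. A_to_C j [:rB z l:] * l)"
    using FqC.sum_nonzero_representation_eq[of B z] B_props z by (simp add: Fq_scale_C_def A_to_C_hom)
  then have "\<mu> z = \<mu> (\<Sum>l\<in>?R. A_to_C j [:rB z l:] * l)"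
    by (rule arg_cong)
  also have "\<dots> = (\<Sum>l\<in>?R. [:rB z l:] * \<mu> l)"
    using R by (intro Lat.dual_sum[OF \<mu>]) auto
  finally have "poly.coeff (\<mu> z) n = (\<Sum>l\<in>?R. rB z l * poly.coeff (\<mu> l) n)"
    by (simp add: coeff_sum)
  also have "\<dots> = (\<Sum>l\<in>S. rB z l * poly.coeff (\<mu> l) n)"
    using S by (intro sum.mono_neutral_left) auto
  finally show ?thesis .
qed

text \<open>By \<open>dual_eval\<close> the coordinates of each period recombine, which turns a
  product of partial sums into a sum over periods of 1/z times an approximation of exp. The choices
  are nested: first the periods, then basis elements good for all these periods, then a rectangle of
  pairs.\<close>

lemma tensor_dot_nth:
  assumes k: "k < rk"
  shows "fps_nth (tensor_dot j B B' zeta (twist CARD('a) k omega)) n = (if k = 0 then 1 / T ^ Suc n else 0)"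
proof -
  let ?q = "CARD('a)" and ?y = "twist CARD('a) k omega"
  let ?c = "if k = 0 then 1 / T ^ Suc n else 0"
  let ?dot = "fps_nth (tensor_dot j B B' zeta ?y) n"
  have q: "1 < real ?q"
    using card_field_gt_1[where 'a = 'a] by simp
  obtain M where M: "1 \<le> M" "\<And>\<mu>. absv (?y \<mu>) \<le> M"
    by (rule completed_tensor_bounded[OF omega_completed_tensor[of k]]) blast
  obtain D where D: "\<And>N. n < N \<Longrightarrow> absv ((\<Sum>z\<in>small_periods N. ex (z / T ^ Suc n) ^ (?q ^ k) / z) + ?c) \<le> D / real ?q ^ N"
    using sum_small_periods_bound[OF k] by blast
  have "absv (?dot - ?c) \<le> e" if e: "0 < e" for e
  proof -
    \<comment> \<open>The error in zeta gets multiplied by coefficients of the twisted omega, which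
      are at most \<open>M\<close>.\<close>
    have "0 < e / M"
      using e M by simp
    then obtain Z where Z: "Z \<subseteq> L - {0}" "finite Z"
      "\<And>F l. finite F \<Longrightarrow> Z \<subseteq> F \<Longrightarrow> F \<subseteq> L - {0} \<Longrightarrow>
        absv (zeta l + (\<Sum>z\<in>F. inverse z * Fq_to_C j (rB z l))) < e / M"
      using zeta_limit(2) by meson
    obtain N1 where N1: "\<And>N. N \<ge> N1 \<Longrightarrow> D / real ?q ^ N < e"
      using Lat.ex_power_less[OF e] by blast
    obtain N2 where N2: "coeff_bound * Max (insert 0 (absv ` Z)) < real ?q ^ N2"
      using real_arch_pow[OF q] by blast
    \<comment> \<open>Beyond n, the level must make the torsion error small (\<open>N1\<close>) and
      the small periods include \<open>Z\<close> (\<open>N2\<close>).\<close>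
    define N where "N = Suc n + N1 + N2"
    define Q where "Q = small_periods N"
    have Q: "finite Q" "Q \<subseteq> L - {0}"
      using finite_small_periods by (auto simp: Q_def small_periods_def)
    have "Z \<subseteq> Q"
    proof
      fix z assume z: "z \<in> Z"
      have "absv z \<le> Max (insert 0 (absv ` Z))"
        using z Z(2) by (intro Max_ge) auto
      then have "coeff_bound * absv z \<le> coeff_bound * Max (insert 0 (absv ` Z))"
        using coeff_bound_ge_1 by (intro mult_left_mono) auto
      moreover have "real ?q ^ N2 \<le> real ?q ^ N"
        using q by (intro power_increasing) (auto simp: N_def)
      ultimately show "z \<in> Q"
        using N2 z Z(1) by (auto simp: Q_def small_periods_def)
    qed
    then have zeta_Q: "absv (zeta l + (\<Sum>z\<in>Q. inverse z * Fq_to_C j (rB z l))) \<le> e / M" for l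
      using Z(3)[OF Q(1) _ Q(2)] by (simp add: less_imp_le)
    have exp_Q: "absv ((\<Sum>z\<in>Q. ex (z / T ^ Suc n) ^ (?q ^ k) / z) + ?c) \<le> e"
      using D[of N] N1[of N] unfolding Q_def by (simp add: N_def)
    let ?err = "\<lambda>z F. absv (ex (z / T ^ Suc n) ^ (?q ^ k) - (\<Sum>\<mu>\<in>F. Fq_to_C j (poly.coeff (\<mu> z) n) * ?y \<mu>))"
    \<comment> \<open>The tolerance is scaled by |z| because the error is later divided by
      z.\<close>
    define good where "good z F0 \<longleftrightarrow> F0 \<subseteq> B' \<and> finite F0 \<and>
      (\<forall>F. finite F \<and> F0 \<subseteq> F \<and> F \<subseteq> B' \<longrightarrow> ?err z F < e * absv z)" for z F0
    have "\<exists>F0. good z F0" if "z \<in> Q" for z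
    proof -
      have z: "z \<in> L" "0 < absv z"
        using that Q(2) by auto
      then show ?thesis
        unfolding good_def by (intro omega_expansion mult_pos_pos e)
    qed
    then obtain F0 where "\<And>z. z \<in> Q \<Longrightarrow> good z (F0 z)"
      by metis
    then have F0: "\<And>z. z \<in> Q \<Longrightarrow> F0 z \<subseteq> B'" "\<And>z. z \<in> Q \<Longrightarrow> finite (F0 z)"
      "\<And>z F. z \<in> Q \<Longrightarrow> finite F \<Longrightarrow> F0 z \<subseteq> F \<Longrightarrow> F \<subseteq> B' \<Longrightarrow> ?err z F < e * absv z"
      unfolding good_def by blast+
    obtain P0 where P0: "P0 \<subseteq> B \<times> B'" "finite P0"
      "\<And>P. finite P \<Longrightarrow> P0 \<subseteq> P \<Longrightarrow> P \<subseteq> B \<times> B' \<Longrightarrow>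
        absv ((\<Sum>(l, \<mu>)\<in>P. zeta l * ?y \<mu> * Fq_to_C j (poly.coeff (\<mu> l) n)) - ?dot) < e"
      using dot_limit[OF zeta_limit(1) omega_completed_tensor e] by meson
    \<comment> \<open>Besides the first components of \<open>P0\<close>, this contains the supports
      of all periods in \<open>Q\<close>, so that \<open>dual_eval\<close> applies to each of them
      over the same index set.\<close>
    define S where "S = fst ` P0 \<union> (\<Union>z\<in>Q. {l. rB z l \<noteq> 0})"
    define F where "F = snd ` P0 \<union> (\<Union>z\<in>Q. F0 z)"
    have S: "finite S" "S \<subseteq> B"
      using P0 Q FqC.finite_representation[of B] FqC.representation_ne_zero[of B] by (auto simp: S_def)
    have F: "finite F"
      unfolding F_def by (intro finite_UnI finite_imageI finite_UN_I P0(2) Q(1) F0(2))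
    have FB': "F \<subseteq> B'"
      unfolding F_def
    proof (intro Un_least UN_least F0(1))
      show "snd ` P0 \<subseteq> B'"
        using P0(1) by auto
    qed
    have PSF: "P0 \<subseteq> S \<times> F"
      by (force simp: S_def F_def)
    \<comment> \<open>The chain of approximations is dot, dotSF, -U, -E, c, with each step costing
      at most e.\<close>
    define dotSF where "dotSF = (\<Sum>(l, \<mu>)\<in>S \<times> F. zeta l * ?y \<mu> * Fq_to_C j (poly.coeff (\<mu> l) n))"
    define U where "U = (\<Sum>(l, \<mu>)\<in>S \<times> F. (\<Sum>z\<in>Q. inverse z * Fq_to_C j (rB z l)) * ?y \<mu> * Fq_to_C j (poly.coeff (\<mu> l) n))"
    define E where "E = (\<Sum>z\<in>Q. ex (z / T ^ Suc n) ^ (?q ^ k) / z)"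
    have 1: "absv (dotSF - ?dot) \<le> e"
      unfolding dotSF_def by (rule less_imp_le, rule P0(3)[OF _ PSF]) (use S F FB' in auto)
    have 2: "absv (dotSF + U) \<le> e"
    proof -
      have "dotSF + U = (\<Sum>(l, \<mu>)\<in>S \<times> F. (zeta l + (\<Sum>z\<in>Q. inverse z * Fq_to_C j (rB z l))) * ?y \<mu> * Fq_to_C j (poly.coeff (\<mu> l) n))"
        unfolding dotSF_def U_def sum.distrib[symmetric] by (intro sum.cong) (auto simp: algebra_simps)
      moreover have "absv (case p of (l, \<mu>) \<Rightarrow> (zeta l + (\<Sum>z\<in>Q. inverse z * Fq_to_C j (rB z l))) * ?y \<mu> * Fq_to_C j (poly.coeff (\<mu> l) n)) \<le> e" for p
      proof (cases p)
        case (Pair l \<mu>)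
        have "absv (zeta l + (\<Sum>z\<in>Q. inverse z * Fq_to_C j (rB z l))) * absv (?y \<mu>) \<le> e / M * M"
          using M e by (intro mult_mono zeta_Q) (auto simp: absv_nonneg)
        then show ?thesis
          using M e by (simp add: Pair absv_mult absv_Fq_to_C)
      qed
      ultimately show ?thesis
        using e by (simp only:) (intro absv_sum_le, auto)
    qed
    have U: "U = (\<Sum>z\<in>Q. inverse z * (\<Sum>\<mu>\<in>F. Fq_to_C j (poly.coeff (\<mu> z) n) * ?y \<mu>))"
    proof -
      have "U = (\<Sum>l\<in>S. \<Sum>\<mu>\<in>F. \<Sum>z\<in>Q. inverse z * (Fq_to_C j (rB z l * poly.coeff (\<mu> l) n) * ?y \<mu>))"
        unfolding U_def sum.cartesian_product[symmetric] sum_distrib_right Fq_to_C_hom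
        by (intro sum.cong refl) (simp only: ac_simps)
      also have "\<dots> = (\<Sum>z\<in>Q. \<Sum>\<mu>\<in>F. \<Sum>l\<in>S. inverse z * (Fq_to_C j (rB z l * poly.coeff (\<mu> l) n) * ?y \<mu>))"
        by (subst sum.swap, subst (2) sum.swap, subst sum.swap) (rule refl)
      also have "\<dots> = (\<Sum>z\<in>Q. inverse z * (\<Sum>\<mu>\<in>F. Fq_to_C j (poly.coeff (\<mu> z) n) * ?y \<mu>))"
      proof (rule sum.cong[OF refl])
        fix z assume z: "z \<in> Q"
        have Fq_sum: "Fq_to_C j (sum g A) = (\<Sum>i\<in>A. Fq_to_C j (g i))" for g :: "'c \<Rightarrow> 'a" and A
          by (induction A rule: infinite_finite_induct) (auto simp: Fq_to_C_hom)
        have "Fq_to_C j (poly.coeff (\<mu> z) n) = (\<Sum>l\<in>S. Fq_to_C j (rB z l * poly.coeff (\<mu> l) n))" if "\<mu> \<in> F" for \<mu>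
        proof -
          have "poly.coeff (\<mu> z) n = (\<Sum>l\<in>S. rB z l * poly.coeff (\<mu> l) n)"
            using that FB' B'_props z Q S by (intro dual_eval) (auto simp: S_def)
          then show ?thesis
            by (simp only: Fq_sum)
        qed
        then show "(\<Sum>\<mu>\<in>F. \<Sum>l\<in>S. inverse z * (Fq_to_C j (rB z l * poly.coeff (\<mu> l) n) * ?y \<mu>))
            = inverse z * (\<Sum>\<mu>\<in>F. Fq_to_C j (poly.coeff (\<mu> z) n) * ?y \<mu>)"
          by (simp add: sum_distrib_left sum_distrib_right)
      qed
      finally show ?thesis .
    qed
    have 3: "absv (E - U) \<le> e"
    proof -
      have "E - U = (\<Sum>z\<in>Q. inverse z * (ex (z / T ^ Suc n) ^ (?q ^ k) - (\<Sum>\<mu>\<in>F. Fq_to_C j (poly.coeff (\<mu> z) n) * ?y \<mu>)))"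
        unfolding E_def U right_diff_distrib sum_subtractf by (simp add: divide_inverse mult.commute)
      also have "absv \<dots> \<le> e"
      proof (rule absv_sum_le)
        have scale: "inverse b * a \<le> e" if "0 < b" "a < e * b" for a b :: real
          using that by (simp add: field_simps)
        fix z assume z: "z \<in> Q"
        then have "absv (ex (z / T ^ Suc n) ^ (?q ^ k) - (\<Sum>\<mu>\<in>F. Fq_to_C j (poly.coeff (\<mu> z) n) * ?y \<mu>)) < e * absv z"
          using F FB' by (intro F0(3)) (auto simp: F_def)
        moreover have "0 < absv z"
          using z Q by auto
        ultimately show "absv (inverse z * (ex (z / T ^ Suc n) ^ (?q ^ k) - (\<Sum>\<mu>\<in>F. Fq_to_C j (poly.coeff (\<mu> z) n) * ?y \<mu>))) \<le> e"
          unfolding absv_mult absv_inverse by (rule scale[rotated])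
      qed (use e in simp)
      finally show ?thesis .
    qed
    have "?dot - ?c = ((dotSF + U) - (dotSF - ?dot)) + ((E - U) - (E + ?c))"
      by simp
    also have "absv \<dots> \<le> e"
      using absv_add[of "(dotSF + U) - (dotSF - ?dot)" "(E - U) - (E + ?c)"]
        absv_diff[of "dotSF + U" "dotSF - ?dot"] absv_diff[of "E - U" "E + ?c"] 1 2 3 exp_Q
      unfolding E_def by linarith
    finally show ?thesis .
  qed
  then have "absv (?dot - ?c) \<le> 0"
    using field_le_epsilon[of "absv (?dot - ?c)" 0] by simp
  then show ?thesis
    using absv_nonneg[of "?dot - ?c"] by (simp add: absv_eq_0_iff)
qed

text \<open>The coefficients found for k = 0 are those of the geometric series of 1 / (T -
  X).\<close>

lemma tensor_dot_zeta_omega: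
  "tensor_dot j B B' zeta omega =
     poly_tensor j 1 d_theta / (poly_tensor j (theta_C j) 1 - poly_tensor j 1 [:0, 1:])"
proof -
  let ?v = "Abs_fps (\<lambda>n. 1 / T ^ Suc n)" and ?u = "fps_const T - fps_X"
  have "?v * ?u = 1"
  proof (rule fps_ext)
    fix n show "fps_nth (?v * ?u) n = fps_nth 1 n"
      using theta_neq_0 by (cases n) (auto simp: right_diff_distrib)
  qed
  moreover have "?u \<noteq> 0"
    using calculation by auto
  ultimately have "?v = 1 / ?u"
    by (metis nonzero_mult_div_cancel_right)
  moreover have "tensor_dot j B B' zeta omega = ?v"
  proof (rule fps_ext)
    fix n
    have "twist CARD('a) 0 omega = omega"
      by (simp add: twist_def)
    then show "fps_nth (tensor_dot j B B' zeta omega) n = fps_nth ?v n"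
      using tensor_dot_nth[OF rk_pos, of n] by simp
  qed
  ultimately show ?thesis
    by (simp only: poly_tensor_one_d_theta poly_tensor_theta_diff)
qed

lemma tensor_dot_zeta_twist_omega:
  assumes "1 \<le> k" "k \<le> rk - 1"
  shows "tensor_dot j B B' zeta (twist CARD('a) k omega) = 0"
proof (rule fps_ext)
  fix n
  have "k < rk"
    using assms rk_pos by linarith
  then show "fps_nth (tensor_dot j B B' zeta (twist CARD('a) k omega)) n = fps_nth 0 n"
    using tensor_dot_nth[of k n] assms by simp
qed

end

theorem theorem9:
  fixes j :: "'a::{finite, field} fls alg_closure \<Rightarrow> 'c::{ultrametric_field, complete_space}"
    and \<phi> :: "'a poly \<Rightarrow> 'c poly" and r :: nat
    and B :: "'c set" and B' :: "('c \<Rightarrow> 'a differential) set"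
  assumes "C_infinity j"
    and "drinfeld_module j \<phi>"
    and "drinfeld_rank \<phi> = r"
    and "is_basis (Fq_scale_C j) B (period_lattice j \<phi>)"
    and "is_basis Fq_scale_hom B' (dual_lattice j (period_lattice j \<phi>))"
  shows "tensor_dot j B B' (drinfeld_zeta j \<phi> B) (drinfeld_omega j \<phi> B') =
           poly_tensor j 1 d_theta / (poly_tensor j (theta_C j) 1 - poly_tensor j 1 [:0, 1:])
       \<and> (\<forall>k. 1 \<le> k \<and> k \<le> r - 1 \<longrightarrow>
           tensor_dot j B B' (drinfeld_zeta j \<phi> B)
             (twist CARD('a) k (drinfeld_omega j \<phi> B')) = 0)"
proof -
  interpret drinfeld j \<phi>
    using assms(1,2) by (simp add: drinfeld_def drinfeld_axioms_def)
  obtain G where G: "finite G" "G \<subseteq> period_lattice j \<phi>"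
    "\<And>z. z \<in> period_lattice j \<phi> \<Longrightarrow> \<exists>a. z = (\<Sum>g\<in>G. A_to_C j (a g) * g)"
    using L_finitely_generated by blast
  interpret drinfeld_dual_bases j \<phi> G B B'
    by unfold_locales (use L_zero L_add L_scale finite_ball_L G assms(4,5) in auto)
  show ?thesis
    using tensor_dot_zeta_omega tensor_dot_zeta_twist_omega assms(3) by auto
qed

end
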